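(* Let $\mu_{\mathbb S^1}$ be the uniform probability measure on $\mathbb S^1$. With respect to $\mathcal L$, the persistence measure $U^{\mathrm{VR}}_{4,1}(\mathbb S^1)$ decomposes into a singular measure supported on $\Delta$ and a measure supported on $D^{\mathrm{VR}}_{4,1}(\mathbb S^1)\setminus\Delta$ with Radon-Nikodym derivative $$f(t_b,t_d)=\frac{12}{\pi^3}(\pi-t_d),\qquad (t_b,t_d)\in D^{\mathrm{VR}}_{4,1}(\mathbb S^1)\setminus\Delta.$$ In particular, the probability that the 1-dimensional persistence diagram of a $4$-point subset of $\mathbb S^1$ (four independent uniformly distributed points) is in $\Delta$ is $\frac 89$.
   Context: $\mathbb S^1=[0,2\pi]/(0\sim 2\pi)$ with the geodesic distance $d(x,y)=\min(|x-y|,2\pi-|x-y|)$. For a finite metric space $Y$ and $r\ge 0$, $\mathrm{VR}_r(Y)$ is the simplicial complex of nonempty subsets $\sigma\subset Y$ with $\mathrm{diam}(\sigma)\le r$. With a fixed coefficient field $\mathbb F$, the persistence module $r\mapsto\widetilde H_1(\mathrm{VR}_r(Y);\mathbb F)$ decomposes into finitely many interval modules on intervals $[b_\alpha,d_\alpha)$, and $\mathrm{dgm}_1^{\mathrm{VR}}(Y)$ is the multiset of points $(b_\alpha,d_\alpha)$. If $|Y|\le 4$ this diagram has at most one point. Let $\Delta=\{(x,x)\}\subset\mathbb R^2$ be the diagonal. Diagrams with at most one point are viewed as points of the quotient $\mathbb R^2/\Delta$ (diagonal collapsed to one point): $\{(t_b,t_d)\}$ corresponds to the class of $(t_b,t_d)$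 and the empty diagram corresponds to the class $\Delta$. $D^{\mathrm{VR}}_{4,1}(\mathbb S^1)\subset\mathbb R^2/\Delta$ is the set of all $\mathrm{dgm}_1^{\mathrm{VR}}(X')$ with $X'\subset\mathbb S^1$, $|X'|\le 4$. $U^{\mathrm{VR}}_{4,1}(\mathbb S^1)$ is the pushforward of the product measure $\mu_{\mathbb S^1}^{\otimes 4}$ under $(x_1,\dots,x_4)\mapsto \mathrm{dgm}_1^{\mathrm{VR}}(\{x_1,\dots,x_4\})$, regarded as a probability measure on $\mathbb R^2/\Delta$. $\mathcal L$ is the pushforward of Lebesgue measure under the quotient map $\mathbb R^2\to\mathbb R^2/\Delta$. *)

theory Defs
  imports "HOL-Probability.Probability" "HOL-Algebra.Module"
begin

section \<open>Vietoris--Rips complexes\<close>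

definition simplex_diam :: "('a \<Rightarrow> 'a \<Rightarrow> real) \<Rightarrow> 'a set \<Rightarrow> real" where
  "simplex_diam d \<sigma> = (SUP (x, y)\<in>\<sigma> \<times> \<sigma>. d x y)"

definition vietoris_rips :: "('a \<Rightarrow> 'a \<Rightarrow> real) \<Rightarrow> 'a set \<Rightarrow> real \<Rightarrow> 'a set set" where
  "vietoris_rips d Y r = {\<sigma>. \<sigma> \<subseteq> Y \<and> \<sigma> \<noteq> {} \<and> simplex_diam d \<sigma> \<le> r}"


section \<open>Reduced simplicial homology with coefficients in a field\<close>

text \<open>
  A complex \<open>K\<close> is a finite set of finite nonempty sets.  A chain is its coefficient function on
  simplices; each simplex is oriented by the linear order of the vertex type.
\<close>

definition chains :: "'a set set \<Rightarrow> nat \<Rightarrow> ('a set \<Rightarrow> 'f::field) set" where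
  "chains K n = {c. \<forall>\<sigma>. c \<sigma> \<noteq> 0 \<longrightarrow> \<sigma> \<in> K \<and> card \<sigma> = n + 1}"

text \<open>
  The faces of \<open>\<sigma> = {v\<^sub>0 < \<dots> < v\<^sub>n}\<close> are \<open>\<sigma> - {v\<^sub>i}\<close> with sign \<open>(-1) ^ i\<close>.  The face \<open>{}\<close> of a vertex
  is not dropped, so on 0-chains the boundary is the augmentation (read off at \<open>{}\<close>); this makes
  the homology below the reduced one.
\<close>

definition boundary :: "'a::linorder set set \<Rightarrow> ('a set \<Rightarrow> 'f::field) \<Rightarrow> 'a set \<Rightarrow> 'f" where
  "boundary K c = (\<lambda>\<tau>. \<Sum>\<sigma>\<in>K. c \<sigma> *
     (\<Sum>v\<in>\<sigma>. if \<tau> = \<sigma> - {v} then (-1) ^ card {w \<in> \<sigma>. w < v} else 0))"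

definition cycles :: "'a::linorder set set \<Rightarrow> nat \<Rightarrow> ('a set \<Rightarrow> 'f::field) set" where
  "cycles K n = {c \<in> chains K n. boundary K c = (\<lambda>_. 0)}"

definition boundaries :: "'a::linorder set set \<Rightarrow> nat \<Rightarrow> ('a set \<Rightarrow> 'f::field) set" where
  "boundaries K n = boundary K ` chains K (n + 1)"

definition homologous ::
    "'a::linorder set set \<Rightarrow> nat \<Rightarrow> (('a set \<Rightarrow> 'f::field) \<times> ('a set \<Rightarrow> 'f)) set" where
  "homologous K n =
     {(c, c'). c \<in> cycles K n \<and> c' \<in> cycles K n \<and> (\<lambda>\<sigma>. c \<sigma> - c' \<sigma>) \<in> boundaries K n}"

text \<open>
  Vector spaces over \<open>'f\<close> are given as records of type \<open>('f, 'v) module\<close>; the ring fields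
  \<open>mult\<close> and \<open>one\<close> of that record have no meaning for modules.
\<close>

definition reduced_homology ::
    "'a::linorder set set \<Rightarrow> nat \<Rightarrow> ('f::field, ('a set \<Rightarrow> 'f) set) module" where
  "reduced_homology K n =
     \<lparr> carrier = cycles K n // homologous K n,
       mult = undefined, one = undefined,
       zero = homologous K n `` {\<lambda>_. 0},
       add = (\<lambda>X Y. homologous K n `` {\<lambda>\<sigma>. x \<sigma> + y \<sigma> | x y. x \<in> X \<and> y \<in> Y}),
       smult = (\<lambda>a X. homologous K n `` {\<lambda>\<sigma>. a * x \<sigma> | x. x \<in> X}) \<rparr>"


section \<open>Persistence modules indexed by \<open>r \<ge> 0\<close>, and their diagrams\<close>

record ('f, 'v) persistence_module =
  fiber :: "real \<Rightarrow> ('f, 'v) module"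
  transition :: "real \<Rightarrow> real \<Rightarrow> 'v \<Rightarrow> 'v"

definition pm_isomorphic ::
    "('f, 'v) persistence_module \<Rightarrow> ('f, 'w) persistence_module \<Rightarrow> bool" where
  "pm_isomorphic M N \<longleftrightarrow> (\<exists>h.
     (\<forall>r\<ge>0. bij_betw (h r) (carrier (fiber M r)) (carrier (fiber N r)) \<and>
        (\<forall>x\<in>carrier (fiber M r). \<forall>y\<in>carrier (fiber M r).
           h r (x \<oplus>\<^bsub>fiber M r\<^esub> y) = h r x \<oplus>\<^bsub>fiber N r\<^esub> h r y) \<and>
        (\<forall>a. \<forall>x\<in>carrier (fiber M r).
           h r (a \<odot>\<^bsub>fiber M r\<^esub> x) = a \<odot>\<^bsub>fiber N r\<^esub> h r x)) \<and>
     (\<forall>r\<ge>0. \<forall>s\<ge>r. \<forall>x\<in>carrier (fiber M r).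
        h s (transition M r s x) = transition N r s (h r x)))"

definition interval_module :: "real \<Rightarrow> real \<Rightarrow> ('f::field, 'f) persistence_module" where
  "interval_module b d =
     \<lparr> fiber = (\<lambda>r.
         \<lparr> carrier = (if r \<in> {b..<d} then UNIV else {0}),
           mult = undefined, one = undefined,
           zero = 0, add = (+), smult = (*) \<rparr>),
       transition = (\<lambda>r s x. if r \<in> {b..<d} \<and> s \<in> {b..<d} then x else 0) \<rparr>"

definition direct_sum ::
    "('f, 'v) persistence_module list \<Rightarrow> ('f, nat \<Rightarrow> 'v) persistence_module" where
  "direct_sum Ms =
     \<lparr> fiber = (\<lambda>r.
         \<lparr> carrier = (\<Pi>\<^sub>E i\<in>{..<length Ms}. carrier (fiber (Ms ! i) r)),
           mult = undefined, one = undefined,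
           zero = (\<lambda>i\<in>{..<length Ms}. \<zero>\<^bsub>fiber (Ms ! i) r\<^esub>),
           add = (\<lambda>x y. \<lambda>i\<in>{..<length Ms}. x i \<oplus>\<^bsub>fiber (Ms ! i) r\<^esub> y i),
           smult = (\<lambda>a x. \<lambda>i\<in>{..<length Ms}. a \<odot>\<^bsub>fiber (Ms ! i) r\<^esub> x i) \<rparr>),
       transition = (\<lambda>r s x. \<lambda>i\<in>{..<length Ms}. transition (Ms ! i) r s (x i)) \<rparr>"

definition persistence_diagram ::
    "('f::field, 'v) persistence_module \<Rightarrow> (real \<times> real) multiset" where
  "persistence_diagram M = (THE D. \<exists>I. D = mset I \<and>
     (\<forall>(b, d)\<in>set I. 0 \<le> b \<and> b < d) \<and>
     pm_isomorphic M (direct_sum (map (\<lambda>(b, d). interval_module b d) I)))"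

definition vr_persistence_module ::
    "('a::linorder \<Rightarrow> 'a \<Rightarrow> real) \<Rightarrow> 'a set \<Rightarrow> nat \<Rightarrow>
     ('f::field, ('a set \<Rightarrow> 'f) set) persistence_module" where
  "vr_persistence_module d Y n =
     \<lparr> fiber = (\<lambda>r. reduced_homology (vietoris_rips d Y r) n),
       transition = (\<lambda>r s X. homologous (vietoris_rips d Y s) n `` X) \<rparr>"

definition vr_diagram ::
    "'f::field itself \<Rightarrow> nat \<Rightarrow> ('a::linorder \<Rightarrow> 'a \<Rightarrow> real) \<Rightarrow> 'a set \<Rightarrow> (real \<times> real) multiset" where
  "vr_diagram F n d Y = persistence_diagram
     (vr_persistence_module d Y n :: ('f, ('a set \<Rightarrow> 'f) set) persistence_module)"


section \<open>The plane with its diagonal collapsed to a point\<close>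

definition diagonal_collapse :: "real \<times> real \<Rightarrow> real \<times> real \<Rightarrow> bool" where
  "diagonal_collapse p q \<longleftrightarrow> p = q \<or> (fst p = snd p \<and> fst q = snd q)"

quotient_type plane_mod_diagonal = "real \<times> real" / diagonal_collapse
  morphisms rep_plane_class plane_class
  by (rule equivpI) (auto simp: reflp_def symp_def transp_def diagonal_collapse_def)

instantiation plane_mod_diagonal :: topological_space
begin

definition open_plane_mod_diagonal :: "plane_mod_diagonal set \<Rightarrow> bool" where
  "open_plane_mod_diagonal U \<longleftrightarrow> open (plane_class -` U)"

instance
  by standard (auto simp: open_plane_mod_diagonal_def vimage_Union)

end

definition diagonal_point :: plane_mod_diagonal where
  "diagonal_point = plane_class (0, 0)"

text \<open>Only meaningful for diagrams with at most one point.\<close>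

definition diagram_class :: "(real \<times> real) multiset \<Rightarrow> plane_mod_diagonal" where
  "diagram_class D = (if D = {#} then diagonal_point else plane_class (THE p. D = {#p#}))"

definition plane_mod_lebesgue :: "plane_mod_diagonal measure" where
  "plane_mod_lebesgue = distr lborel borel plane_class"


section \<open>The circle\<close>

text \<open>Each point of \<open>[0, 2\<pi>]/(0 \<sim> 2\<pi>)\<close> is given by its unique representative in \<open>[0, 2\<pi>)\<close>.\<close>

definition circle :: "real set" where
  "circle = {0..<2 * pi}"

definition circle_dist :: "real \<Rightarrow> real \<Rightarrow> real" where
  "circle_dist x y = min \<bar>x - y\<bar> (2 * pi - \<bar>x - y\<bar>)"

definition circle_measure :: "real measure" where
  "circle_measure = uniform_measure (restrict_space lborel circle) circle"

definition circle_measure4 :: "(nat \<Rightarrow> real) measure" where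
  "circle_measure4 = (\<Pi>\<^sub>M i\<in>{1..4}. circle_measure)"

definition circle_vr_class :: "'f::field itself \<Rightarrow> real set \<Rightarrow> plane_mod_diagonal" where
  "circle_vr_class F X = diagram_class (vr_diagram F 1 circle_dist X)"

definition circle_D41 :: "'f::field itself \<Rightarrow> plane_mod_diagonal set" where
  "circle_D41 F = {circle_vr_class F X | X. X \<subseteq> circle \<and> finite X \<and> card X \<le> 4}"

definition circle_U41 :: "'f::field itself \<Rightarrow> plane_mod_diagonal measure" where
  "circle_U41 F = distr circle_measure4 borel (\<lambda>x. circle_vr_class F (x ` {1..4}))"


section \<open>Singular measures\<close>

definition mutually_singular :: "'a measure \<Rightarrow> 'a measure \<Rightarrow> bool" where
  "mutually_singular M N \<longleftrightarrow> sets M = sets N \<and>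
     (\<exists>A\<in>sets M. emeasure M A = 0 \<and> emeasure N (space N - A) = 0)"

end

(*
  Four points carry a bar exactly when, for one of the three four-cycles through them, the longest
  edge t_b is shorter than the shorter diagonal t_d: in that range of scales the complex is a
  four-cycle, and any other flag complex on four vertices has no first homology.

  By symmetry the law of (t_b, t_d) is 24 times its restriction to the chamber of (p, q, r, s) in
  which pq is the longest edge and qs the shorter diagonal.  Rotate q to 0.  Given the positions of
  p and s, so that t_b and t_d are fixed, the point r must lie in an arc of length 2 (pi - t_d); this
  length is where the factor pi - t_d of the density comes from.
*)
theory Submission
  imports Defs
begin

section \<open>Homology classes\<close>

text \<open>\<open>persistence_diagram\<close> is a definite description, so a bar found by
  computation must still be shown to be the only barcode. This is done directly, by comparing a
  barcode with at most one bar to an arbitrary one; four points never require more.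

  Of the three four-cycles only the one in cyclic order \<open>a, b, c, d\<close> can carry a bar:
  each arc between \<open>a\<close> and \<open>c\<close> contains \<open>ab\<close> or
  \<open>cd\<close>, and \<open>bc\<close> or \<open>da\<close>, so the chord \<open>ac\<close> is
  never shorter than both diagonals of a crossed cycle.

  The factor 24 is 3 * 8: three four-cycles, and for each of them four choices of the longest edge
  times two of the shorter diagonal; ties are null. The density is 24 * 2 * 2 * (pi - t_d) / (2 *
  pi)^3: the middle 2 counts the two orientations of the circle, \<open>2 * (pi - t_d)\<close> is
  the arc left to \<open>r\<close>, and three angles remain once \<open>q\<close> is rotated to 0.

  The law is compared with its density through test functions on the plane that vanish at (0, 0),
  the point standing for the collapsed diagonal. The mass off the diagonal, 1/9, is then an
  elementary integral, and the diagonal receives the rest.\<close>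

lemma boundary_add:
  "boundary K (\<lambda>\<sigma>. a \<sigma> + b \<sigma>) = (\<lambda>\<tau>. boundary K a \<tau> + boundary K b \<tau>)"
  by (simp add: boundary_def sum.distrib distrib_right fun_eq_iff)

lemma boundary_scale:
  "boundary K (\<lambda>\<sigma>. t * a \<sigma>) = (\<lambda>\<tau>. t * boundary K a \<tau>)"
  by (simp add: boundary_def sum_distrib_left mult.assoc fun_eq_iff)

lemma boundary_zero: "boundary K (\<lambda>_. 0) = (\<lambda>_. 0)"
  by (simp add: boundary_def)

lemma chains_add: "a \<in> chains K n \<Longrightarrow> b \<in> chains K n \<Longrightarrow> (\<lambda>\<sigma>. a \<sigma> + b \<sigma>) \<in> chains K n"
proof -
  assume ab: "a \<in> chains K n" "b \<in> chains K n"
  have "a \<sigma> \<noteq> 0 \<or> b \<sigma> \<noteq> 0" if "a \<sigma> + b \<sigma> \<noteq> 0" for \<sigma>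
    using that by auto
  with ab show ?thesis unfolding chains_def by blast
qed

lemma chains_scale: "a \<in> chains K n \<Longrightarrow> (\<lambda>\<sigma>. t * a \<sigma>) \<in> chains K n"
  unfolding chains_def by auto

lemma chains_zero: "(\<lambda>_. 0) \<in> chains K n"
  by (simp add: chains_def)

lemma cycles_add: "a \<in> cycles K n \<Longrightarrow> b \<in> cycles K n \<Longrightarrow> (\<lambda>\<sigma>. a \<sigma> + b \<sigma>) \<in> cycles K n"
  by (simp add: cycles_def chains_add boundary_add)

lemma cycles_scale: "a \<in> cycles K n \<Longrightarrow> (\<lambda>\<sigma>. t * a \<sigma>) \<in> cycles K n"
  by (simp add: cycles_def chains_scale boundary_scale)

lemma cycles_zero: "(\<lambda>_. 0) \<in> cycles K n"
  by (simp add: cycles_def chains_zero boundary_zero)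

lemma boundaries_add:
  "a \<in> boundaries K n \<Longrightarrow> b \<in> boundaries K n \<Longrightarrow> (\<lambda>\<sigma>. a \<sigma> + b \<sigma>) \<in> boundaries K n"
  unfolding boundaries_def by (auto simp: boundary_add[symmetric] intro!: imageI chains_add)

lemma boundaries_scale: "a \<in> boundaries K n \<Longrightarrow> (\<lambda>\<sigma>. t * a \<sigma>) \<in> boundaries K n"
  unfolding boundaries_def by (auto simp: boundary_scale[symmetric] intro!: imageI chains_scale)

lemma boundaries_zero: "(\<lambda>_. 0) \<in> boundaries K n"
  unfolding boundaries_def
  by (rule image_eqI[where x = "\<lambda>_. 0"]) (simp_all add: boundary_zero chains_zero)

lemma equiv_homologous: "equiv (cycles K n) (homologous K n)"
proof (rule equivI)
  show "homologous K n \<subseteq> cycles K n \<times> cycles K n"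
    by (auto simp: homologous_def)
  show "refl_on (cycles K n) (homologous K n)"
    by (auto simp: refl_on_def homologous_def boundaries_zero)
  show "sym (homologous K n)"
  proof (rule symI)
    fix a b assume "(a, b) \<in> homologous K n"
    then show "(b, a) \<in> homologous K n"
      using boundaries_scale[of "\<lambda>\<sigma>. a \<sigma> - b \<sigma>" K n "-1"] by (auto simp: homologous_def)
  qed
  show "trans (homologous K n)"
  proof (rule transI)
    fix a b c assume "(a, b) \<in> homologous K n" "(b, c) \<in> homologous K n"
    then show "(a, c) \<in> homologous K n"
      using boundaries_add[of "\<lambda>\<sigma>. a \<sigma> - b \<sigma>" K n "\<lambda>\<sigma>. b \<sigma> - c \<sigma>"] by (auto simp: homologous_def)
  qed
qed

definition homology_class :: "'a::linorder set set \<Rightarrow> nat \<Rightarrow> ('a set \<Rightarrow> 'f::field) \<Rightarrow> ('a set \<Rightarrow> 'f) set"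
  where "homology_class K n c = homologous K n `` {c}"

lemma mem_homology_class: "x \<in> homology_class K n c \<longleftrightarrow> (c, x) \<in> homologous K n"
  by (simp add: homology_class_def)

lemma self_mem_homology_class: "c \<in> cycles K n \<Longrightarrow> c \<in> homology_class K n c"
  unfolding homology_class_def by (rule equiv_class_self[OF equiv_homologous])

lemma homology_class_eqI: "(a, b) \<in> homologous K n \<Longrightarrow> homology_class K n a = homology_class K n b"
  unfolding homology_class_def by (rule equiv_class_eq[OF equiv_homologous])

text \<open>The operations of \<open>reduced_homology\<close> and the transition maps of
  \<open>vr_persistence_module\<close> apply the relation to a whole set of representatives. Such an
  image is a single class as soon as all of them are homologous to one.\<close>

lemma homologous_Image_eq:
  assumes "c \<in> S" "\<And>x. x \<in> S \<Longrightarrow> (c, x) \<in> homologous K n"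
  shows "homologous K n `` S = homology_class K n c"
proof -
  have "homologous K n `` S = (\<Union>x\<in>S. homology_class K n x)"
    by (auto simp: homology_class_def)
  also have "\<dots> = (\<Union>x\<in>S. homology_class K n c)"
    by (intro SUP_cong refl homology_class_eqI[symmetric] assms(2))
  finally show ?thesis using assms(1) by auto
qed

lemma carrier_reduced_homology:
  "carrier (reduced_homology K n) = homology_class K n ` cycles K n"
  by (auto simp: reduced_homology_def quotient_def homology_class_def)

lemma add_homology_class:
  assumes "a \<in> cycles K n" "b \<in> cycles K n"
  shows "homology_class K n a \<oplus>\<^bsub>reduced_homology K n\<^esub> homology_class K n b
       = homology_class K n (\<lambda>\<sigma>. a \<sigma> + b \<sigma>)"
proof -
  have "(\<lambda>\<sigma>. a \<sigma> + b \<sigma>, \<lambda>\<sigma>. x \<sigma> + y \<sigma>) \<in> homologous K n"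
    if "(a, x) \<in> homologous K n" "(b, y) \<in> homologous K n" for x y
  proof -
    have eq: "(\<lambda>\<sigma>. (a \<sigma> + b \<sigma>) - (x \<sigma> + y \<sigma>)) = (\<lambda>\<sigma>. (a \<sigma> - x \<sigma>) + (b \<sigma> - y \<sigma>))"
      by (simp add: algebra_simps)
    from that show ?thesis
      unfolding homologous_def by (auto simp: eq intro!: cycles_add boundaries_add)
  qed
  then have "homologous K n `` {\<lambda>\<sigma>. x \<sigma> + y \<sigma> | x y. x \<in> homology_class K n a \<and> y \<in> homology_class K n b}
      = homology_class K n (\<lambda>\<sigma>. a \<sigma> + b \<sigma>)"
    using self_mem_homology_class[OF assms(1)] self_mem_homology_class[OF assms(2)]
    by (intro homologous_Image_eq) (blast, auto simp: mem_homology_class)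
  then show ?thesis by (simp add: reduced_homology_def)
qed

lemma smult_homology_class:
  assumes "a \<in> cycles K n"
  shows "t \<odot>\<^bsub>reduced_homology K n\<^esub> homology_class K n a = homology_class K n (\<lambda>\<sigma>. t * a \<sigma>)"
proof -
  have "(\<lambda>\<sigma>. t * a \<sigma>, \<lambda>\<sigma>. t * x \<sigma>) \<in> homologous K n" if "(a, x) \<in> homologous K n" for x
    using that cycles_scale boundaries_scale[of "\<lambda>\<sigma>. a \<sigma> - x \<sigma>" K n t]
    by (auto simp: homologous_def right_diff_distrib)
  then have "homologous K n `` {\<lambda>\<sigma>. t * x \<sigma> | x. x \<in> homology_class K n a}
      = homology_class K n (\<lambda>\<sigma>. t * a \<sigma>)"
    using self_mem_homology_class[OF assms]
    by (intro homologous_Image_eq) (blast, auto simp: mem_homology_class)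
  then show ?thesis by (simp add: reduced_homology_def)
qed

text \<open>The sum in \<open>boundary\<close> ranges over the complex itself, so passing to a
  larger complex could change it; it does not, because the new simplices carry coefficient
  0.\<close>

lemma boundary_mono:
  assumes "finite L" "K \<subseteq> L" "c \<in> chains K n"
  shows "boundary L c = boundary K c"
  unfolding boundary_def
proof
  fix \<tau>
  show "(\<Sum>\<sigma>\<in>L. c \<sigma> * (\<Sum>v\<in>\<sigma>. if \<tau> = \<sigma> - {v} then (-1) ^ card {w \<in> \<sigma>. w < v} else 0)) =
        (\<Sum>\<sigma>\<in>K. c \<sigma> * (\<Sum>v\<in>\<sigma>. if \<tau> = \<sigma> - {v} then (-1) ^ card {w \<in> \<sigma>. w < v} else 0))"
    using assms by (intro sum.mono_neutral_right) (auto simp: chains_def)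
qed

lemma chains_mono: "K \<subseteq> L \<Longrightarrow> chains K n \<subseteq> chains L n"
  by (auto simp: chains_def)

lemma cycles_mono: "finite L \<Longrightarrow> K \<subseteq> L \<Longrightarrow> cycles K n \<subseteq> cycles L n"
  using chains_mono[of K L n] by (auto simp: cycles_def boundary_mono)

lemma boundaries_mono:
  assumes "finite L" "K \<subseteq> L"
  shows "boundaries K n \<subseteq> boundaries L n"
proof
  fix x assume "x \<in> boundaries K n"
  then obtain c where c: "c \<in> chains K (n + 1)" "x = boundary K c"
    by (auto simp: boundaries_def)
  have "x = boundary L c" "c \<in> chains L (n + 1)"
    using c boundary_mono[OF assms c(1)] chains_mono[OF assms(2)] by auto
  then show "x \<in> boundaries L n"
    unfolding boundaries_def by (rule image_eqI)
qed

lemma transition_homology_class: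
  assumes "finite L" "K \<subseteq> L" "c \<in> cycles K n"
  shows "homologous L n `` homology_class K n c = homology_class L n c"
  using assms(3)
  by (intro homologous_Image_eq self_mem_homology_class)
     (auto simp: mem_homology_class homologous_def
        intro: subsetD[OF cycles_mono[OF assms(1,2)]] subsetD[OF boundaries_mono[OF assms(1,2)]])

section \<open>Complexes on at most four vertices\<close>

lemma subset_four_card_2:
  assumes "\<sigma> \<subseteq> {a, b, c, d}" "card \<sigma> = 2"
  shows "\<sigma> \<in> {{a, b}, {a, c}, {a, d}, {b, c}, {b, d}, {c, d}}"
proof -
  from assms(2) obtain x y where "\<sigma> = {x, y}" "x \<noteq> y" by (auto simp: card_2_iff)
  with assms(1) show ?thesis by auto
qed

lemma subset_four_card_3:
  assumes "\<sigma> \<subseteq> {a, b, c, d}" "card \<sigma> = 3"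
  shows "\<sigma> \<in> {{a, b, c}, {a, b, d}, {a, c, d}, {b, c, d}}"
proof -
  from assms(2) obtain x y z where "\<sigma> = {x, y, z}" "x \<noteq> y" "x \<noteq> z" "y \<noteq> z"
    by (auto simp: card_3_iff)
  with assms(1) show ?thesis by auto
qed

section \<open>Signed boundaries of edges and triangles\<close>

lemma edge_boundary_coeff:
  fixes x y :: "'a::linorder"
  assumes "x < y"
  shows "(\<Sum>v\<in>{x, y}. if \<tau> = {x, y} - {v} then (-1::'f::field) ^ card {w \<in> {x, y}. w < v} else 0)
       = (if \<tau> = {y} then 1 else 0) - (if \<tau> = {x} then 1 else 0)"
proof -
  have "{w. (w = x \<or> w = y) \<and> w < x} = {}" "{w. (w = x \<or> w = y) \<and> w < y} = {x}"
    "{x, y} - {x} = {y}" "{x, y} - {y} = {x}" "x \<noteq> y"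
    using assms by auto
  note [simp] = this
  show ?thesis by simp
qed

lemma triangle_boundary_coeff:
  fixes x y z :: "'a::linorder"
  assumes "x < y" "y < z"
  shows "(\<Sum>v\<in>{x, y, z}. if \<tau> = {x, y, z} - {v} then (-1::'f::field) ^ card {w \<in> {x, y, z}. w < v} else 0)
       = (if \<tau> = {y, z} then 1 else 0) - (if \<tau> = {x, z} then 1 else 0) + (if \<tau> = {x, y} then 1 else 0)"
proof -
  have "{w. (w = x \<or> w = y \<or> w = z) \<and> w < x} = {}" "{w. (w = x \<or> w = y \<or> w = z) \<and> w < y} = {x}"
    "{w. (w = x \<or> w = y \<or> w = z) \<and> w < z} = {x, y}"
    "{x, y, z} - {x} = {y, z}" "{x, y, z} - {y} = {x, z}" "{x, y, z} - {z} = {x, y}"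
    "x \<noteq> y" "x \<noteq> z" "y \<noteq> z" "{x, y} \<noteq> {y, z}" "{x, z} \<noteq> {y, z}" "{x, y} \<noteq> {x, z}"
    using assms by (auto simp: doubleton_eq_iff)
  note [simp] = this
  show ?thesis by simp
qed

text \<open>Sorted vertices make every sign of the boundary explicit. \<open>K\<close> may miss some
  of the four vertices, so smaller point sets are covered too.\<close>

locale four_vertices =
  fixes a b c d :: "'a::linorder" and K :: "'a set set"
  assumes ab: "a < b" and bc: "b < c" and cd: "c < d"
    and K: "K \<subseteq> Pow {a, b, c, d}"
begin

lemma order_facts [simp]:
  "a \<noteq> b" "a \<noteq> c" "a \<noteq> d" "b \<noteq> c" "b \<noteq> d" "c \<noteq> d"
  "b \<noteq> a" "c \<noteq> a" "d \<noteq> a" "c \<noteq> b" "d \<noteq> b" "d \<noteq> c"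
  "a < b" "a < c" "a < d" "b < c" "b < d" "c < d"
  using ab bc cd by auto

lemma edge_eqs [simp]:
  "{a, b} \<noteq> {a, c}" "{a, b} \<noteq> {a, d}" "{a, b} \<noteq> {b, c}" "{a, b} \<noteq> {b, d}" "{a, b} \<noteq> {c, d}"
  "{a, c} \<noteq> {a, b}" "{a, c} \<noteq> {a, d}" "{a, c} \<noteq> {b, c}" "{a, c} \<noteq> {b, d}" "{a, c} \<noteq> {c, d}"
  "{a, d} \<noteq> {a, b}" "{a, d} \<noteq> {a, c}" "{a, d} \<noteq> {b, c}" "{a, d} \<noteq> {b, d}" "{a, d} \<noteq> {c, d}"
  "{b, c} \<noteq> {a, b}" "{b, c} \<noteq> {a, c}" "{b, c} \<noteq> {a, d}" "{b, c} \<noteq> {b, d}" "{b, c} \<noteq> {c, d}"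
  "{b, d} \<noteq> {a, b}" "{b, d} \<noteq> {a, c}" "{b, d} \<noteq> {a, d}" "{b, d} \<noteq> {b, c}" "{b, d} \<noteq> {c, d}"
  "{c, d} \<noteq> {a, b}" "{c, d} \<noteq> {a, c}" "{c, d} \<noteq> {a, d}" "{c, d} \<noteq> {b, c}" "{c, d} \<noteq> {b, d}"
  by (auto simp: doubleton_eq_iff)

lemma triangle_eqs [simp]:
  "{a, b, c} \<noteq> {a, b, d}" "{a, b, c} \<noteq> {a, c, d}" "{a, b, c} \<noteq> {b, c, d}"
  "{a, b, d} \<noteq> {a, b, c}" "{a, b, d} \<noteq> {a, c, d}" "{a, b, d} \<noteq> {b, c, d}"
  "{a, c, d} \<noteq> {a, b, c}" "{a, c, d} \<noteq> {a, b, d}" "{a, c, d} \<noteq> {b, c, d}"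
  "{b, c, d} \<noteq> {a, b, c}" "{b, c, d} \<noteq> {a, b, d}" "{b, c, d} \<noteq> {a, c, d}"
  using order_facts by blast+

text \<open>A chain vanishes off \<open>K\<close> and off the simplices of its dimension, so the sum
  over the unknown \<open>K\<close> can be replaced by a sum over the fixed list of all candidate
  edges or triangles.\<close>

lemma boundary_supp:
  assumes "f \<in> chains K n" "finite S" "\<And>\<sigma>. \<sigma> \<subseteq> {a, b, c, d} \<Longrightarrow> card \<sigma> = n + 1 \<Longrightarrow> \<sigma> \<in> S"
  shows "boundary K f \<tau> = (\<Sum>\<sigma>\<in>S. f \<sigma> *
     (\<Sum>v\<in>\<sigma>. if \<tau> = \<sigma> - {v} then (-1) ^ card {w \<in> \<sigma>. w < v} else 0))"
proof -
  have "f \<sigma> = 0" if "\<sigma> \<in> K - S" for \<sigma>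
    using that assms(1,3) K by (auto simp: chains_def)
  moreover have "f \<sigma> = 0" if "\<sigma> \<in> S - K" for \<sigma>
    using that assms(1) by (auto simp: chains_def)
  moreover have "finite K" using K by (rule finite_subset) simp
  ultimately show ?thesis unfolding boundary_def
    using assms(2) by (intro sum.mono_neutral_cong) auto
qed

lemma sum_edges:
  fixes g :: "'a set \<Rightarrow> 'f::field"
  shows "sum g {{a, b}, {a, c}, {a, d}, {b, c}, {b, d}, {c, d}}
    = g {a, b} + g {a, c} + g {a, d} + g {b, c} + g {b, d} + g {c, d}"
  by (simp add: add.assoc)

lemma sum_triangles:
  fixes g :: "'a set \<Rightarrow> 'f::field"
  shows "sum g {{a, b, c}, {a, b, d}, {a, c, d}, {b, c, d}}
    = g {a, b, c} + g {a, b, d} + g {a, c, d} + g {b, c, d}"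
  by (simp add: add.assoc)

lemma boundary_edges:
  fixes f :: "'a set \<Rightarrow> 'f::field"
  assumes "f \<in> chains K 1"
  shows "boundary K f = (\<lambda>\<tau>.
    if \<tau> = {a} then - f {a, b} - f {a, c} - f {a, d}
    else if \<tau> = {b} then f {a, b} - f {b, c} - f {b, d}
    else if \<tau> = {c} then f {a, c} + f {b, c} - f {c, d}
    else if \<tau> = {d} then f {a, d} + f {b, d} + f {c, d} else 0)"
proof
  fix \<tau>
  have "boundary K f \<tau> = (\<Sum>\<sigma>\<in>{{a, b}, {a, c}, {a, d}, {b, c}, {b, d}, {c, d}}. f \<sigma> *
     (\<Sum>v\<in>\<sigma>. if \<tau> = \<sigma> - {v} then (-1) ^ card {w \<in> \<sigma>. w < v} else 0))"
    by (rule boundary_supp[OF assms], simp, rule subset_four_card_2, simp_all)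
  also have "\<dots> = (if \<tau> = {a} then - f {a, b} - f {a, c} - f {a, d}
    else if \<tau> = {b} then f {a, b} - f {b, c} - f {b, d}
    else if \<tau> = {c} then f {a, c} + f {b, c} - f {c, d}
    else if \<tau> = {d} then f {a, d} + f {b, d} + f {c, d} else 0)"
    unfolding sum_edges edge_boundary_coeff[OF order_facts(13)] edge_boundary_coeff[OF order_facts(14)]
      edge_boundary_coeff[OF order_facts(15)] edge_boundary_coeff[OF order_facts(16)]
      edge_boundary_coeff[OF order_facts(17)] edge_boundary_coeff[OF order_facts(18)]
    by (cases "\<tau> = {a}", simp, cases "\<tau> = {b}", simp, cases "\<tau> = {c}", simp,
        cases "\<tau> = {d}", simp, simp)
  finally show "boundary K f \<tau> = (if \<tau> = {a} then - f {a, b} - f {a, c} - f {a, d}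
    else if \<tau> = {b} then f {a, b} - f {b, c} - f {b, d}
    else if \<tau> = {c} then f {a, c} + f {b, c} - f {c, d}
    else if \<tau> = {d} then f {a, d} + f {b, d} + f {c, d} else 0)" .
qed

lemma boundary_triangles:
  fixes f :: "'a set \<Rightarrow> 'f::field"
  assumes "f \<in> chains K 2"
  shows "boundary K f = (\<lambda>\<tau>.
    if \<tau> = {a, b} then f {a, b, c} + f {a, b, d}
    else if \<tau> = {a, c} then f {a, c, d} - f {a, b, c}
    else if \<tau> = {a, d} then - f {a, b, d} - f {a, c, d}
    else if \<tau> = {b, c} then f {a, b, c} + f {b, c, d}
    else if \<tau> = {b, d} then f {a, b, d} - f {b, c, d}
    else if \<tau> = {c, d} then f {a, c, d} + f {b, c, d} else 0)"
proof
  fix \<tau>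
  have "boundary K f \<tau> = (\<Sum>\<sigma>\<in>{{a, b, c}, {a, b, d}, {a, c, d}, {b, c, d}}. f \<sigma> *
     (\<Sum>v\<in>\<sigma>. if \<tau> = \<sigma> - {v} then (-1) ^ card {w \<in> \<sigma>. w < v} else 0))"
    by (rule boundary_supp[OF assms], simp, rule subset_four_card_3, simp_all)
  also have "\<dots> = (if \<tau> = {a, b} then f {a, b, c} + f {a, b, d}
    else if \<tau> = {a, c} then f {a, c, d} - f {a, b, c}
    else if \<tau> = {a, d} then - f {a, b, d} - f {a, c, d}
    else if \<tau> = {b, c} then f {a, b, c} + f {b, c, d}
    else if \<tau> = {b, d} then f {a, b, d} - f {b, c, d}
    else if \<tau> = {c, d} then f {a, c, d} + f {b, c, d} else 0)"
    unfolding sum_triangles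
      triangle_boundary_coeff[OF order_facts(13,16)] triangle_boundary_coeff[OF order_facts(13,17)]
      triangle_boundary_coeff[OF order_facts(14,18)] triangle_boundary_coeff[OF order_facts(16,18)]
    by (cases "\<tau> = {a, b}", simp, cases "\<tau> = {a, c}", simp, cases "\<tau> = {a, d}", simp,
        cases "\<tau> = {b, c}", simp, cases "\<tau> = {b, d}", simp, cases "\<tau> = {c, d}", simp, simp)
  finally show "boundary K f \<tau> = (if \<tau> = {a, b} then f {a, b, c} + f {a, b, d}
    else if \<tau> = {a, c} then f {a, c, d} - f {a, b, c}
    else if \<tau> = {a, d} then - f {a, b, d} - f {a, c, d}
    else if \<tau> = {b, c} then f {a, b, c} + f {b, c, d}
    else if \<tau> = {b, d} then f {a, b, d} - f {b, c, d}
    else if \<tau> = {c, d} then f {a, c, d} + f {b, c, d} else 0)" .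
qed

lemma chain1_eq_0:
  assumes "f \<in> chains K 1" "\<tau> \<notin> {{a, b}, {a, c}, {a, d}, {b, c}, {b, d}, {c, d}}"
  shows "f \<tau> = 0"
proof (rule ccontr)
  assume "f \<tau> \<noteq> 0"
  with assms(1) have "\<tau> \<in> K" "card \<tau> = 2" by (simp_all add: chains_def)
  then have "\<tau> \<subseteq> {a, b, c, d}" using K by blast
  from subset_four_card_2[OF this \<open>card \<tau> = 2\<close>] assms(2) show False by contradiction
qed

text \<open>\<open>e1\<close> to \<open>e4\<close> are the coefficients of a filling on the
  triangles \<open>abc\<close>, \<open>abd\<close>, \<open>acd\<close>, \<open>bcd\<close>; the six
  equations are its boundary, edge by edge.\<close>

lemma boundariesI:
  fixes f :: "'a set \<Rightarrow> 'f::field"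
  assumes "f \<in> chains K 1"
    and "e1 \<noteq> 0 \<Longrightarrow> {a, b, c} \<in> K" "e2 \<noteq> 0 \<Longrightarrow> {a, b, d} \<in> K"
        "e3 \<noteq> 0 \<Longrightarrow> {a, c, d} \<in> K" "e4 \<noteq> 0 \<Longrightarrow> {b, c, d} \<in> K"
    and "f {a, b} = e1 + e2" "f {a, c} = e3 - e1" "f {a, d} = - e2 - e3"
        "f {b, c} = e1 + e4" "f {b, d} = e2 - e4" "f {c, d} = e3 + e4"
  shows "f \<in> boundaries K 1"
proof -
  define e where "e = (\<lambda>\<sigma>. if \<sigma> = {a, b, c} then e1 else if \<sigma> = {a, b, d} then e2
    else if \<sigma> = {a, c, d} then e3 else if \<sigma> = {b, c, d} then e4 else 0)"
  have e: "e \<in> chains K 2"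
    using assms(2-5) by (auto simp: chains_def e_def)
  have ev: "e {a, b, c} = e1" "e {a, b, d} = e2" "e {a, c, d} = e3" "e {b, c, d} = e4"
    by (simp_all add: e_def)
  have "f = boundary K e"
  proof
    fix \<tau>
    show "f \<tau> = boundary K e \<tau>"
      unfolding boundary_triangles[OF e] ev
      using assms(6-11) chain1_eq_0[OF assms(1), of \<tau>]
      by (cases "\<tau> = {a, b}", simp, cases "\<tau> = {a, c}", simp, cases "\<tau> = {a, d}", simp,
        cases "\<tau> = {b, c}", simp, cases "\<tau> = {b, d}", simp, cases "\<tau> = {c, d}", simp, simp)
  qed
  with e show ?thesis unfolding boundaries_def by (auto simp: numeral_2_eq_2)
qed

lemma cycle_eqs:
  assumes "f \<in> cycles K 1"
  shows "- f {a, b} - f {a, c} - f {a, d} = 0" "f {a, b} - f {b, c} - f {b, d} = 0"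
    "f {a, c} + f {b, c} - f {c, d} = 0" "f {a, d} + f {b, d} + f {c, d} = 0"
proof -
  have "f \<in> chains K 1" "\<And>\<tau>. boundary K f \<tau> = 0"
    using assms by (auto simp: cycles_def)
  from this(2)[of "{a}"] this(2)[of "{b}"] this(2)[of "{c}"] this(2)[of "{d}"]
  show "- f {a, b} - f {a, c} - f {a, d} = 0" "f {a, b} - f {b, c} - f {b, d} = 0"
    "f {a, c} + f {b, c} - f {c, d} = 0" "f {a, d} + f {b, d} + f {c, d} = 0"
    unfolding boundary_edges[OF \<open>f \<in> chains K 1\<close>] by auto
qed

text \<open>The clique condition is recorded for triangles, the only simplices that can bound a
  1-cycle.\<close>

definition flag :: bool where
  "flag \<longleftrightarrow> ({a, b} \<in> K \<and> {a, c} \<in> K \<and> {b, c} \<in> K \<longrightarrow> {a, b, c} \<in> K)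
    \<and> ({a, b} \<in> K \<and> {a, d} \<in> K \<and> {b, d} \<in> K \<longrightarrow> {a, b, d} \<in> K)
    \<and> ({a, c} \<in> K \<and> {a, d} \<in> K \<and> {c, d} \<in> K \<longrightarrow> {a, c, d} \<in> K)
    \<and> ({b, c} \<in> K \<and> {b, d} \<in> K \<and> {c, d} \<in> K \<longrightarrow> {b, c, d} \<in> K)"

text \<open>
  If some vertex is joined to both endpoints of every edge that avoids it, coning from that vertex
  bounds every cycle.  The only other flag complexes with a nonzero cycle are the four-cycles.
\<close>

lemma cycles_subset_boundaries:
  fixes f :: "'a set \<Rightarrow> 'f::field"
  assumes "flag"
    and n1: "\<not> ({a, b} \<in> K \<and> {b, c} \<in> K \<and> {c, d} \<in> K \<and> {a, d} \<in> K \<and> {a, c} \<notin> K \<and> {b, d} \<notin> K)"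
    and n2: "\<not> ({a, c} \<in> K \<and> {b, c} \<in> K \<and> {b, d} \<in> K \<and> {a, d} \<in> K \<and> {a, b} \<notin> K \<and> {c, d} \<notin> K)"
    and n3: "\<not> ({a, b} \<in> K \<and> {b, d} \<in> K \<and> {c, d} \<in> K \<and> {a, c} \<in> K \<and> {a, d} \<notin> K \<and> {b, c} \<notin> K)"
    and f: "f \<in> cycles K 1"
  shows "f \<in> boundaries K 1"
proof -
  have ch: "f \<in> chains K 1" using f by (simp add: cycles_def)
  note eqs = cycle_eqs[OF f]
  have z: "f \<sigma> = 0" if "\<sigma> \<notin> K" for \<sigma>
    using ch that by (auto simp: chains_def)
  let ?coneA = "({b, c} \<in> K \<longrightarrow> {a, b} \<in> K \<and> {a, c} \<in> K) \<and> ({b, d} \<in> K \<longrightarrow> {a, b} \<in> K \<and> {a, d} \<in> K)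
    \<and> ({c, d} \<in> K \<longrightarrow> {a, c} \<in> K \<and> {a, d} \<in> K)"
  let ?coneB = "({a, c} \<in> K \<longrightarrow> {a, b} \<in> K \<and> {b, c} \<in> K) \<and> ({a, d} \<in> K \<longrightarrow> {a, b} \<in> K \<and> {b, d} \<in> K)
    \<and> ({c, d} \<in> K \<longrightarrow> {b, c} \<in> K \<and> {b, d} \<in> K)"
  let ?coneC = "({a, b} \<in> K \<longrightarrow> {a, c} \<in> K \<and> {b, c} \<in> K) \<and> ({a, d} \<in> K \<longrightarrow> {a, c} \<in> K \<and> {c, d} \<in> K)
    \<and> ({b, d} \<in> K \<longrightarrow> {b, c} \<in> K \<and> {c, d} \<in> K)"
  let ?coneD = "({a, b} \<in> K \<longrightarrow> {a, d} \<in> K \<and> {b, d} \<in> K) \<and> ({a, c} \<in> K \<longrightarrow> {a, d} \<in> K \<and> {c, d} \<in> K)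
    \<and> ({b, c} \<in> K \<longrightarrow> {b, d} \<in> K \<and> {c, d} \<in> K)"
  have K_if: "\<sigma> \<in> K" if "f \<sigma> \<noteq> 0" for \<sigma>
    using z that by blast
  \<comment> \<open>Each bracket is the cycle condition at the far endpoint of an edge at
    \<open>a\<close>; removing it expresses the three edges at \<open>a\<close> by the other
    three.\<close>
  have "f {a, b} = (f {a, b} - f {b, c} - f {b, d}) + (f {b, c} + f {b, d})"
    "f {a, c} = (f {a, c} + f {b, c} - f {c, d}) + (f {c, d} - f {b, c})"
    "f {a, d} = (f {a, d} + f {b, d} + f {c, d}) + (- f {b, d} - f {c, d})"
    by simp_all
  then have q: "f {a, b} = f {b, c} + f {b, d}" "f {a, c} = f {c, d} - f {b, c}"
    "f {a, d} = - f {b, d} - f {c, d}"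
    unfolding eqs by simp_all
  note I = boundariesI[OF ch]
  show ?thesis
  proof (cases "?coneA \<or> ?coneB \<or> ?coneC \<or> ?coneD")
    case True
    then show ?thesis
    proof (elim disjE)
      \<comment> \<open>In all four cones the coefficient of a triangle is that of the edge opposite
        the apex, with the sign this edge has in the boundary of the triangle.\<close>
      assume *: ?coneA
      show ?thesis
      proof (rule I[of "f {b, c}" "f {b, d}" "f {c, d}" "0"])
        show "{a, b, c} \<in> K" if "f {b, c} \<noteq> 0" using that K_if[of "{b, c}"] * assms(1) by (simp add: flag_def)
        show "{a, b, d} \<in> K" if "f {b, d} \<noteq> 0" using that K_if[of "{b, d}"] * assms(1) by (simp add: flag_def)
        show "{a, c, d} \<in> K" if "f {c, d} \<noteq> 0" using that K_if[of "{c, d}"] * assms(1) by (simp add: flag_def)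
        show "{b, c, d} \<in> K" if "(0::'f) \<noteq> 0" using that by simp
        show "f {a, b} = f {b, c} + f {b, d}" by (simp add: q)
        show "f {a, c} = f {c, d} - f {b, c}" by (simp add: q)
        show "f {a, d} = - f {b, d} - f {c, d}" by (simp add: q)
        show "f {b, c} = f {b, c} + 0" by (simp add: q)
        show "f {b, d} = f {b, d} - 0" by (simp add: q)
        show "f {c, d} = f {c, d} + 0" by (simp add: q)
      qed
    next
      assume *: ?coneB
      show ?thesis
      proof (rule I[of "- f {a, c}" "- f {a, d}" "0" "f {c, d}"])
        show "{a, b, c} \<in> K" if "- f {a, c} \<noteq> 0" using that K_if[of "{a, c}"] * assms(1) by (simp add: flag_def)
        show "{a, b, d} \<in> K" if "- f {a, d} \<noteq> 0" using that K_if[of "{a, d}"] * assms(1) by (simp add: flag_def)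
        show "{a, c, d} \<in> K" if "(0::'f) \<noteq> 0" using that by simp
        show "{b, c, d} \<in> K" if "f {c, d} \<noteq> 0" using that K_if[of "{c, d}"] * assms(1) by (simp add: flag_def)
        show "f {a, b} = - f {a, c} + (- f {a, d})" by (simp add: q)
        show "f {a, c} = 0 - (- f {a, c})" by (simp add: q)
        show "f {a, d} = - (- f {a, d}) - 0" by (simp add: q)
        show "f {b, c} = - f {a, c} + f {c, d}" by (simp add: q)
        show "f {b, d} = - f {a, d} - f {c, d}" by (simp add: q)
        show "f {c, d} = 0 + f {c, d}" by (simp add: q)
      qed
    next
      assume *: ?coneC
      show ?thesis
      proof (rule I[of "f {a, b}" "0" "- f {a, d}" "- f {b, d}"])
        show "{a, b, c} \<in> K" if "f {a, b} \<noteq> 0" using that K_if[of "{a, b}"] * assms(1) by (simp add: flag_def)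
        show "{a, b, d} \<in> K" if "(0::'f) \<noteq> 0" using that by simp
        show "{a, c, d} \<in> K" if "- f {a, d} \<noteq> 0" using that K_if[of "{a, d}"] * assms(1) by (simp add: flag_def)
        show "{b, c, d} \<in> K" if "- f {b, d} \<noteq> 0" using that K_if[of "{b, d}"] * assms(1) by (simp add: flag_def)
        show "f {a, b} = f {a, b} + 0" by (simp add: q)
        show "f {a, c} = - f {a, d} - f {a, b}" by (simp add: q)
        show "f {a, d} = - 0 - (- f {a, d})" by (simp add: q)
        show "f {b, c} = f {a, b} + (- f {b, d})" by (simp add: q)
        show "f {b, d} = 0 - (- f {b, d})" by (simp add: q)
        show "f {c, d} = - f {a, d} + (- f {b, d})" by (simp add: q)
      qed
    next
      assume *: ?coneD
      show ?thesis
      proof (rule I[of "0" "f {a, b}" "f {a, c}" "f {b, c}"])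
        show "{a, b, c} \<in> K" if "(0::'f) \<noteq> 0" using that by simp
        show "{a, b, d} \<in> K" if "f {a, b} \<noteq> 0" using that K_if[of "{a, b}"] * assms(1) by (simp add: flag_def)
        show "{a, c, d} \<in> K" if "f {a, c} \<noteq> 0" using that K_if[of "{a, c}"] * assms(1) by (simp add: flag_def)
        show "{b, c, d} \<in> K" if "f {b, c} \<noteq> 0" using that K_if[of "{b, c}"] * assms(1) by (simp add: flag_def)
        show "f {a, b} = 0 + f {a, b}" by (simp add: q)
        show "f {a, c} = f {a, c} - 0" by (simp add: q)
        show "f {a, d} = - f {a, b} - f {a, c}" by (simp add: q)
        show "f {b, c} = 0 + f {b, c}" by (simp add: q)
        show "f {b, d} = f {a, b} - f {b, c}" by (simp add: q)
        show "f {c, d} = f {a, c} + f {b, c}" by (simp add: q)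
      qed
    qed
  next
    \<comment> \<open>A triangle among the edges always provides an apex, so here the graph has no
      triangle and is not a four-cycle. It is a forest, and a cycle on a forest vanishes.\<close>
    case False
    have "f {a, b} = 0 \<and> f {a, c} = 0 \<and> f {a, d} = 0 \<and> f {b, c} = 0 \<and> f {b, d} = 0 \<and> f {c, d} = 0"
      using False n1 n2 n3 eqs z[of "{a, b}"] z[of "{a, c}"] z[of "{a, d}"] z[of "{b, c}"] z[of "{b, d}"] z[of "{c, d}"]
      by (cases "{a, b} \<in> K"; cases "{a, c} \<in> K"; cases "{a, d} \<in> K";
          cases "{b, c} \<in> K"; cases "{b, d} \<in> K"; cases "{c, d} \<in> K"; simp)
    then show ?thesis by (intro I[of 0 0 0 0]) auto
  qed
qed

text \<open>Without triangles 0 is the only 1-boundary, so homology classes are single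
  cycles.\<close>

lemma four_cycle_homologous:
  fixes f g :: "'a set \<Rightarrow> 'f::field"
  assumes "\<And>\<sigma>. \<sigma> \<in> K \<Longrightarrow> card \<sigma> \<noteq> 3"
  shows "(f, g) \<in> homologous K 1 \<longleftrightarrow> f \<in> cycles K 1 \<and> f = g"
proof -
  have "chains K 2 = {\<lambda>_. 0 :: 'f}"
    using assms by (fastforce simp: chains_def numeral_3_eq_3)
  then have "boundaries K 1 = {\<lambda>_. 0 :: 'f}"
    by (simp add: boundaries_def numeral_2_eq_2 boundary_zero)
  moreover have "(\<lambda>\<sigma>. f \<sigma> - g \<sigma>) = (\<lambda>_. 0) \<longleftrightarrow> f = g"
    by (simp add: fun_eq_iff)
  ultimately show ?thesis
    by (auto simp: homologous_def)
qed

lemma four_cycle_cycles: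
  assumes K: "{a, b} \<in> K" "{b, c} \<in> K" "{c, d} \<in> K" "{a, d} \<in> K" "{a, c} \<notin> K" "{b, d} \<notin> K"
  shows "bij_betw (\<lambda>f. f {a, b}) (cycles K 1) (UNIV :: 'f::field set)"
proof -
  \<comment> \<open>\<open>z t\<close> runs once around \<open>a, b, c, d\<close> with weight
    \<open>t\<close>. The closing edge is traversed from \<open>d\<close> to \<open>a\<close>,
    against its orientation, hence \<open>- t\<close>.\<close>
  define z where "z t = (\<lambda>\<sigma>. if \<sigma> = {a, b} then t else if \<sigma> = {b, c} then t
    else if \<sigma> = {c, d} then t else if \<sigma> = {a, d} then - t else 0)" for t :: 'f
  have "z (f {a, b}) = f" if f: "f \<in> cycles K 1" for f
  proof
    fix \<tau>
    have ch: "f \<in> chains K 1" using f by (simp add: cycles_def)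
    have 0: "f {a, c} = 0" "f {b, d} = 0"
      using ch K(5,6) by (auto simp: chains_def)
    have 1: "f {b, c} = f {a, b}"
      using cycle_eqs(2)[OF f] 0 by simp
    have 2: "f {c, d} = f {a, b}"
      using cycle_eqs(3)[OF f] 0 1 by simp
    have 3: "f {a, d} = - f {a, b}"
      using cycle_eqs(1)[OF f] 0 by (simp add: minus_diff_commute eq_neg_iff_add_eq_0 add.commute neg_eq_iff_add_eq_0)
    show "z (f {a, b}) \<tau> = f \<tau>"
      using chain1_eq_0[OF ch, of \<tau>] 0 1 2 3 unfolding z_def
      by (cases "\<tau> = {a, b}", simp, cases "\<tau> = {a, c}", simp, cases "\<tau> = {a, d}", simp,
        cases "\<tau> = {b, c}", simp, cases "\<tau> = {b, d}", simp, cases "\<tau> = {c, d}", simp, simp)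
  qed
  moreover have "z t \<in> cycles K 1" for t
  proof -
    have ch: "z t \<in> chains K 1" using K(1-4) by (auto simp: chains_def z_def)
    have "boundary K (z t) = (\<lambda>_. 0)"
      unfolding boundary_edges[OF ch] by (rule ext) (simp add: z_def)
    with ch show ?thesis by (simp add: cycles_def)
  qed
  moreover have "z t {a, b} = t" for t
    by (simp add: z_def)
  ultimately show ?thesis
    by (intro bij_betwI[where g = z]) auto
qed

end

section \<open>Uniqueness of barcodes with at most one bar\<close>

definition bars :: "(real \<times> real) list \<Rightarrow> ('f::field, nat \<Rightarrow> 'f) persistence_module" where
  "bars J = direct_sum (map (\<lambda>(b, d). interval_module b d) J)"

definition bar :: "(real \<times> real) list \<Rightarrow> nat \<Rightarrow> real set" where
  "bar J i = {fst (J ! i)..<snd (J ! i)}"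

lemma carrier_bars:
  "carrier (fiber (bars J) r) = (\<Pi>\<^sub>E i\<in>{..<length J}. if r \<in> bar J i then UNIV else {0})"
  unfolding bars_def direct_sum_def bar_def
  by (auto intro!: PiE_cong simp: interval_module_def split: prod.splits)

lemma add_bars: "x \<oplus>\<^bsub>fiber (bars J) r\<^esub> y = (\<lambda>i\<in>{..<length J}. x i + y i)"
  unfolding bars_def direct_sum_def
  by (auto intro!: restrict_ext simp: interval_module_def split: prod.splits)

lemma smult_bars: "a \<odot>\<^bsub>fiber (bars J) r\<^esub> x = (\<lambda>i\<in>{..<length J}. a * x i)"
  unfolding bars_def direct_sum_def
  by (auto intro!: restrict_ext simp: interval_module_def split: prod.splits)

lemma transition_bars:
  "transition (bars J) r s x = (\<lambda>i\<in>{..<length J}. if r \<in> bar J i \<and> s \<in> bar J i then x i else 0)"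
  unfolding bars_def direct_sum_def bar_def
  by (auto intro!: restrict_ext simp: interval_module_def split: prod.splits)

text \<open>The record \<open>persistence_module\<close> carries no axioms. This closure is what
  allows an isomorphism out of \<open>M\<close> to be inverted as a homomorphism.\<close>

definition pm_closed :: "('f, 'v) persistence_module \<Rightarrow> bool" where
  "pm_closed M \<longleftrightarrow> (\<forall>r\<ge>0.
     (\<forall>x\<in>carrier (fiber M r). \<forall>y\<in>carrier (fiber M r). x \<oplus>\<^bsub>fiber M r\<^esub> y \<in> carrier (fiber M r)) \<and>
     (\<forall>a. \<forall>x\<in>carrier (fiber M r). a \<odot>\<^bsub>fiber M r\<^esub> x \<in> carrier (fiber M r)) \<and>
     (\<forall>s\<ge>r. \<forall>x\<in>carrier (fiber M r). transition M r s x \<in> carrier (fiber M s)))"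

definition pm_iso_by ::
    "(real \<Rightarrow> 'v \<Rightarrow> 'w) \<Rightarrow> ('f, 'v) persistence_module \<Rightarrow> ('f, 'w) persistence_module \<Rightarrow> bool" where
  "pm_iso_by h M N \<longleftrightarrow>
     (\<forall>r\<ge>0. bij_betw (h r) (carrier (fiber M r)) (carrier (fiber N r)) \<and>
        (\<forall>x\<in>carrier (fiber M r). \<forall>y\<in>carrier (fiber M r).
           h r (x \<oplus>\<^bsub>fiber M r\<^esub> y) = h r x \<oplus>\<^bsub>fiber N r\<^esub> h r y) \<and>
        (\<forall>a. \<forall>x\<in>carrier (fiber M r).
           h r (a \<odot>\<^bsub>fiber M r\<^esub> x) = a \<odot>\<^bsub>fiber N r\<^esub> h r x)) \<and>
     (\<forall>r\<ge>0. \<forall>s\<ge>r. \<forall>x\<in>carrier (fiber M r).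
        h s (transition M r s x) = transition N r s (h r x))"

lemma pm_isomorphic_iff: "pm_isomorphic M N \<longleftrightarrow> (\<exists>h. pm_iso_by h M N)"
  unfolding pm_isomorphic_def pm_iso_by_def ..

lemma pm_iso_byD:
  assumes "pm_iso_by h M N" "0 \<le> r"
  shows "bij_betw (h r) (carrier (fiber M r)) (carrier (fiber N r))"
    "\<And>x y. x \<in> carrier (fiber M r) \<Longrightarrow> y \<in> carrier (fiber M r) \<Longrightarrow>
       h r (x \<oplus>\<^bsub>fiber M r\<^esub> y) = h r x \<oplus>\<^bsub>fiber N r\<^esub> h r y"
    "\<And>a x. x \<in> carrier (fiber M r) \<Longrightarrow> h r (a \<odot>\<^bsub>fiber M r\<^esub> x) = a \<odot>\<^bsub>fiber N r\<^esub> h r x"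
    "\<And>s x. r \<le> s \<Longrightarrow> x \<in> carrier (fiber M r) \<Longrightarrow>
       h s (transition M r s x) = transition N r s (h r x)"
  using assms unfolding pm_iso_by_def by auto

lemma pm_iso_by_surj:
  assumes "pm_iso_by h M N" "0 \<le> r" "y \<in> carrier (fiber N r)"
  obtains x where "x \<in> carrier (fiber M r)" "y = h r x"
  using pm_iso_byD(1)[OF assms(1,2)] assms(3) unfolding bij_betw_def by blast

lemma pm_iso_by_inj:
  assumes "pm_iso_by h M N" "0 \<le> r" "x \<in> carrier (fiber M r)" "y \<in> carrier (fiber M r)" "h r x = h r y"
  shows "x = y"
  using pm_iso_byD(1)[OF assms(1,2)] assms(3-5) unfolding bij_betw_def by (blast dest: inj_onD)

text \<open>The composite of \<open>g\<close> with the inverse of \<open>h\<close> is the required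
  map. Each operation in \<open>N1\<close> is pulled back to \<open>M\<close>, where closure keeps
  the result in the domain on which \<open>h\<close> is injective.\<close>

lemma pm_isomorphic_common:
  assumes M: "pm_closed M" and "pm_isomorphic M N1" "pm_isomorphic M N2"
  shows "pm_isomorphic N1 N2"
proof -
  obtain h g where h: "pm_iso_by h M N1" and g: "pm_iso_by g M N2"
    using assms(2,3) by (auto simp: pm_isomorphic_iff)
  define i where "i r = inv_into (carrier (fiber M r)) (h r)" for r
  have i_mem: "i r u \<in> carrier (fiber M r)" "h r (i r u) = u" if "0 \<le> r" "u \<in> carrier (fiber N1 r)" for r u
    using bij_betw_inv_into_right[OF pm_iso_byD(1)[OF h that(1)] that(2)]
      bij_betw_apply[OF bij_betw_inv_into[OF pm_iso_byD(1)[OF h that(1)]] that(2)]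
    by (simp_all add: i_def)
  have i_h: "i r (h r x) = x" if "0 \<le> r" "x \<in> carrier (fiber M r)" for r x
    using bij_betw_inv_into_left[OF pm_iso_byD(1)[OF h that(1)] that(2)] by (simp add: i_def)
  have "pm_iso_by (\<lambda>r. g r \<circ> i r) N1 N2"
    unfolding pm_iso_by_def
  proof (intro conjI allI impI ballI)
    fix r :: real assume r: "0 \<le> r"
    show "bij_betw (g r \<circ> i r) (carrier (fiber N1 r)) (carrier (fiber N2 r))"
      unfolding i_def
      by (rule bij_betw_trans[OF bij_betw_inv_into pm_iso_byD(1)[OF g r]]) (rule pm_iso_byD(1)[OF h r])
    fix u assume u: "u \<in> carrier (fiber N1 r)"
    note iu = i_mem[OF r u]
    {
      fix v assume v: "v \<in> carrier (fiber N1 r)"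
      note iv = i_mem[OF r v]
      have "u \<oplus>\<^bsub>fiber N1 r\<^esub> v = h r (i r u \<oplus>\<^bsub>fiber M r\<^esub> i r v)"
        using pm_iso_byD(2)[OF h r iu(1) iv(1)] iu iv by simp
      moreover have "i r u \<oplus>\<^bsub>fiber M r\<^esub> i r v \<in> carrier (fiber M r)"
        using M r iu(1) iv(1) by (simp add: pm_closed_def)
      ultimately show "(g r \<circ> i r) (u \<oplus>\<^bsub>fiber N1 r\<^esub> v) = (g r \<circ> i r) u \<oplus>\<^bsub>fiber N2 r\<^esub> (g r \<circ> i r) v"
        using i_h[OF r] pm_iso_byD(2)[OF g r iu(1) iv(1)] by simp
    }
    {
      fix a
      have "a \<odot>\<^bsub>fiber N1 r\<^esub> u = h r (a \<odot>\<^bsub>fiber M r\<^esub> i r u)"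
        using pm_iso_byD(3)[OF h r iu(1)] iu by simp
      moreover have "a \<odot>\<^bsub>fiber M r\<^esub> i r u \<in> carrier (fiber M r)"
        using M r iu(1) by (simp add: pm_closed_def)
      ultimately show "(g r \<circ> i r) (a \<odot>\<^bsub>fiber N1 r\<^esub> u) = a \<odot>\<^bsub>fiber N2 r\<^esub> (g r \<circ> i r) u"
        using i_h[OF r] pm_iso_byD(3)[OF g r iu(1)] by simp
    }
    {
      fix s assume s: "r \<le> s"
      have "transition N1 r s u = h s (transition M r s (i r u))"
        using pm_iso_byD(4)[OF h r s iu(1)] iu by simp
      moreover have "transition M r s (i r u) \<in> carrier (fiber M s)"
        using M r s iu(1) by (simp add: pm_closed_def)
      ultimately show "(g s \<circ> i s) (transition N1 r s u) = transition N2 r s ((g r \<circ> i r) u)"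
        using i_h[of s] r s pm_iso_byD(4)[OF g r s iu(1)] by simp
    }
  qed
  then show ?thesis by (auto simp: pm_isomorphic_iff)
qed

section \<open>Comparing barcodes through their fibers and transitions\<close>

definition unit_vector :: "(real \<times> real) list \<Rightarrow> nat \<Rightarrow> nat \<Rightarrow> 'f::field" where
  "unit_vector J j = (\<lambda>i\<in>{..<length J}. if i = j then 1 else 0)"

definition zero_vector :: "(real \<times> real) list \<Rightarrow> nat \<Rightarrow> 'f::field" where
  "zero_vector J = (\<lambda>i\<in>{..<length J}. 0)"

lemma unit_vector_mem: "r \<in> bar J j \<Longrightarrow> unit_vector J j \<in> carrier (fiber (bars J) r)"
  by (auto simp: carrier_bars unit_vector_def)

lemma zero_vector_mem: "zero_vector J \<in> carrier (fiber (bars J) r)"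
  by (auto simp: carrier_bars zero_vector_def)

lemma unit_neq_zero: "j < length J \<Longrightarrow> unit_vector J j \<noteq> (zero_vector J :: nat \<Rightarrow> 'f::field)"
proof
  assume "j < length J" "unit_vector J j = (zero_vector J :: nat \<Rightarrow> 'f)"
  from fun_cong[OF this(2), of j] this(1) show False
    by (simp add: unit_vector_def zero_vector_def)
qed

lemma carrier_bars_trivial:
  assumes "\<And>i. i < length J \<Longrightarrow> r \<notin> bar J i" "x \<in> carrier (fiber (bars J) r)"
  shows "x = zero_vector J"
  using assms by (auto simp: carrier_bars zero_vector_def PiE_iff fun_eq_iff extensional_def)

text \<open>A fiber met by no bar has one element, whereas a fiber met by bar \<open>j\<close>
  contains both the unit vector of \<open>j\<close> and zero. \<open>pm_iso_by\<close> has a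
  direction, so the converse gets its own proof below: there injectivity takes the place of
  surjectivity.\<close>

lemma iso_bars_contains:
  assumes iso: "pm_iso_by k (bars I :: ('f::field, nat \<Rightarrow> 'f) persistence_module) (bars J)" and r: "0 \<le> r"
    and j: "j < length J" "r \<in> bar J j"
  shows "\<exists>i<length I. r \<in> bar I i"
proof (rule ccontr)
  assume "\<not> ?thesis"
  then have *: "x = zero_vector I" if "x \<in> carrier (fiber (bars I) r)" for x :: "nat \<Rightarrow> 'f"
    using carrier_bars_trivial that by blast
  obtain x where x: "x \<in> carrier (fiber (bars I) r)" "unit_vector J j = k r x"
    by (rule pm_iso_by_surj[OF iso r unit_vector_mem[OF j(2)]])
  obtain y where y: "y \<in> carrier (fiber (bars I) r)" "zero_vector J = k r y"
    by (rule pm_iso_by_surj[OF iso r zero_vector_mem])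
  from x y *[of x] *[of y] have "unit_vector J j = (zero_vector J :: nat \<Rightarrow> 'f)" by simp
  with unit_neq_zero[OF j(1)] show False by blast
qed

lemma iso_bars_contains':
  assumes iso: "pm_iso_by k (bars I :: ('f::field, nat \<Rightarrow> 'f) persistence_module) (bars J)" and r: "0 \<le> r"
    and j: "j < length I" "r \<in> bar I j"
  shows "\<exists>i<length J. r \<in> bar J i"
proof (rule ccontr)
  assume "\<not> ?thesis"
  then have *: "x = zero_vector J" if "x \<in> carrier (fiber (bars J) r)" for x :: "nat \<Rightarrow> 'f"
    using carrier_bars_trivial that by blast
  have bij: "bij_betw (k r) (carrier (fiber (bars I) r)) (carrier (fiber (bars J) r))"
    by (rule pm_iso_byD(1)[OF iso r])
  have "k r (unit_vector I j) = k r (zero_vector I)"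
    using *[OF bij_betw_apply[OF bij unit_vector_mem[OF j(2)]]] *[OF bij_betw_apply[OF bij zero_vector_mem]]
    by simp
  then have "unit_vector I j = (zero_vector I :: nat \<Rightarrow> 'f)"
    by (rule pm_iso_by_inj[OF iso r unit_vector_mem[OF j(2)] zero_vector_mem])
  with unit_neq_zero[OF j(1)] show False by blast
qed

lemma iso_no_bars:
  assumes iso: "pm_iso_by k (bars [] :: ('f::field, nat \<Rightarrow> 'f) persistence_module) (bars J)"
    and J: "\<forall>(b, d)\<in>set J. 0 \<le> b \<and> b < d"
  shows "J = []"
proof (rule ccontr)
  assume "J \<noteq> []"
  then have "J ! 0 \<in> set J" by simp
  with J have "0 \<le> fst (J ! 0)" "fst (J ! 0) \<in> bar J 0"
    by (auto simp: bar_def case_prod_beta)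
  from iso_bars_contains[OF iso this(1) _ this(2)] \<open>J \<noteq> []\<close> show False by simp
qed

text \<open>Four observations determine \<open>J\<close>. Its bars lie inside \<open>[b, d)\<close>;
  none of them ends before \<open>d\<close>, because the transitions within \<open>[b, d)\<close>
  are injective; there are no two of them, because the fibers are one-dimensional; and one of them
  contains \<open>b\<close>.\<close>

lemma iso_single_bar:
  assumes iso: "pm_iso_by k (bars [(b, d)] :: ('f::field, nat \<Rightarrow> 'f) persistence_module) (bars J)"
    and bd: "0 \<le> b" "b < d"
    and J: "\<forall>(b, d)\<in>set J. 0 \<le> b \<and> b < d"
  shows "J = [(b, d)]"
proof -
  let ?I = "[(b, d)]"
  have pos: "0 \<le> fst (J ! j)" "fst (J ! j) < snd (J ! j)" if "j < length J" for j
    using J nth_mem[OF that] by (auto simp: case_prod_beta)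
  have bar_I: "r \<in> bar ?I i \<longleftrightarrow> b \<le> r \<and> r < d" if "i < length ?I" for r i
    using that by (simp add: bar_def)
  have sub: "b \<le> r \<and> r < d" if "j < length J" "r \<in> bar J j" for j r
    using iso_bars_contains[OF iso _ that] pos[OF that(1)] that(2) bar_I by (fastforce simp: bar_def)
  have inj: "y = z" if rs: "b \<le> r" "r \<le> s" "s < d"
    and yz: "y \<in> carrier (fiber (bars J) r)" "z \<in> carrier (fiber (bars J) r)"
      "transition (bars J) r s y = transition (bars J) r s z"
    for r s and y z :: "nat \<Rightarrow> 'f"
  proof -
    have r: "0 \<le> r" "0 \<le> s" using rs bd by auto
    obtain u where u: "u \<in> carrier (fiber (bars ?I) r)" "y = k r u"
      by (rule pm_iso_by_surj[OF iso r(1) yz(1)])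
    obtain v where v: "v \<in> carrier (fiber (bars ?I) r)" "z = k r v"
      by (rule pm_iso_by_surj[OF iso r(1) yz(2)])
    note uv = u(1) v(1) u(2) v(2)
    have tr: "transition (bars ?I) r s w = w" "w \<in> carrier (fiber (bars ?I) s)"
      if "w \<in> carrier (fiber (bars ?I) r)" for w :: "nat \<Rightarrow> 'f"
      using that rs bar_I[of 0]
      by (auto simp: transition_bars carrier_bars PiE_iff fun_eq_iff extensional_def)
    have "k s u = k s v"
      using pm_iso_byD(4)[OF iso r(1) rs(2) uv(1)] pm_iso_byD(4)[OF iso r(1) rs(2) uv(2)] tr uv yz(3) by simp
    then have "u = v"
      by (rule pm_iso_by_inj[OF iso r(2) tr(2)[OF uv(1)] tr(2)[OF uv(2)]])
    then show ?thesis using uv by simp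
  qed
  have ends: "snd (J ! j) = d" if j: "j < length J" for j
  proof (rule antisym)
    show "snd (J ! j) \<le> d"
    proof (rule ccontr)
      assume "\<not> ?thesis"
      \<comment> \<open>This point lies in the bar but not below \<open>d\<close>, contrary to
        \<open>sub\<close>.\<close>
      then have "max d (fst (J ! j)) \<in> bar J j" using pos[OF j] by (auto simp: bar_def)
      from sub[OF j this] show False by auto
    qed
    show "d \<le> snd (J ! j)"
    proof (rule ccontr)
      assume less: "\<not> ?thesis"
      have mem: "fst (J ! j) \<in> bar J j" using pos[OF j] by (auto simp: bar_def)
      \<comment> \<open>The bar is half-open, so going to its endpoint kills the unit vector,
        although that endpoint comes before \<open>d\<close>.\<close>
      have "transition (bars J) (fst (J ! j)) (snd (J ! j)) (unit_vector J j)
          = transition (bars J) (fst (J ! j)) (snd (J ! j)) (zero_vector J :: nat \<Rightarrow> 'f)"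
        by (auto simp: transition_bars unit_vector_def zero_vector_def fun_eq_iff bar_def)
      from inj[OF _ _ _ unit_vector_mem[OF mem] zero_vector_mem this] less sub[OF j mem] pos[OF j]
        unit_neq_zero[OF j, where 'f = 'f]
      show False by simp
    qed
  qed
  have unique: "i = j" if ij: "i < length J" "j < length J" for i j
  proof (rule ccontr)
    assume "i \<noteq> j"
    \<comment> \<open>Both bars end at \<open>d\<close>, so the later of the two starting points
      lies in both. The fiber there would contain two independent vectors.\<close>
    define r where "r = max (fst (J ! i)) (fst (J ! j))"
    have mem: "r \<in> bar J i" "r \<in> bar J j"
      using pos[OF ij(1)] pos[OF ij(2)] ends[OF ij(1)] ends[OF ij(2)] by (auto simp: r_def bar_def)
    have r: "0 \<le> r" using pos[OF ij(1)] by (auto simp: r_def)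
    have mult: "\<exists>a. y = a \<odot>\<^bsub>fiber (bars J) r\<^esub> k r (unit_vector ?I 0)"
      if y: "y \<in> carrier (fiber (bars J) r)" for y :: "nat \<Rightarrow> 'f"
    proof -
      obtain u where u: "u \<in> carrier (fiber (bars ?I) r)" "y = k r u"
        by (rule pm_iso_by_surj[OF iso r y])
      then have eq: "u = u 0 \<odot>\<^bsub>fiber (bars ?I) r\<^esub> unit_vector ?I 0"
        by (auto simp: smult_bars unit_vector_def carrier_bars PiE_iff fun_eq_iff extensional_def)
      have "unit_vector ?I 0 \<in> carrier (fiber (bars ?I) r)"
        using sub[OF ij(1) mem(1)] bar_I[of 0] by (intro unit_vector_mem) simp
      from pm_iso_byD(3)[OF iso r this, of "u 0"] show ?thesis
        unfolding u(2) by (subst eq) auto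
    qed
    obtain x y where "unit_vector J i = x \<odot>\<^bsub>fiber (bars J) r\<^esub> k r (unit_vector ?I 0)"
      "unit_vector J j = y \<odot>\<^bsub>fiber (bars J) r\<^esub> k r (unit_vector ?I 0)"
      using mult[OF unit_vector_mem[OF mem(1)]] mult[OF unit_vector_mem[OF mem(2)]] by blast
    from fun_cong[OF this(1), of i] fun_cong[OF this(1), of j] fun_cong[OF this(2), of j] \<open>i \<noteq> j\<close> ij
    show False by (auto simp: unit_vector_def smult_bars)
  qed
  obtain j where j: "j < length J" "b \<in> bar J j"
    using iso_bars_contains'[OF iso bd(1), of 0] bar_I[of 0] bd by auto
  have "length J = 1"
  proof (rule ccontr)
    assume "length J \<noteq> 1"
    with j(1) have "0 < length J" "1 < length J" by auto
    from unique[OF this] show False by simp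
  qed
  then obtain p where p: "J = [p]" by (auto simp: length_Suc_conv)
  have "fst p \<in> bar J 0" using pos[of 0] p by (auto simp: bar_def)
  with sub[of 0] p have "b \<le> fst p" by auto
  moreover have "fst p \<le> b" using j p by (auto simp: bar_def)
  moreover have "snd p = d" using ends[of 0] p by simp
  ultimately show ?thesis using p by (simp add: prod_eq_iff)
qed

text \<open>This discharges the definite description: any competing barcode \<open>J\<close> of
  \<open>M\<close> is isomorphic to \<open>bars I\<close> through \<open>M\<close>, and the two
  preceding lemmas give \<open>J = I\<close>.\<close>

lemma persistence_diagram_unique:
  fixes M :: "('f::field, 'v) persistence_module"
  assumes M: "pm_closed M" and iso: "pm_isomorphic M (bars I)"
    and I: "\<forall>(b, d)\<in>set I. 0 \<le> b \<and> b < d" and "length I \<le> 1"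
  shows "persistence_diagram M = mset I"
  unfolding persistence_diagram_def
proof (rule the_equality)
  show "\<exists>I'. mset I = mset I' \<and> (\<forall>(b, d)\<in>set I'. 0 \<le> b \<and> b < d) \<and>
     pm_isomorphic M (direct_sum (map (\<lambda>(b, d). interval_module b d) I'))"
    using iso I unfolding bars_def by blast
  fix D assume "\<exists>J. D = mset J \<and> (\<forall>(b, d)\<in>set J. 0 \<le> b \<and> b < d) \<and>
     pm_isomorphic M (direct_sum (map (\<lambda>(b, d). interval_module b d) J))"
  then obtain J where J: "D = mset J" "\<forall>(b, d)\<in>set J. 0 \<le> b \<and> b < d" "pm_isomorphic M (bars J)"
    unfolding bars_def by blast
  obtain k where k: "pm_iso_by k (bars I :: ('f, nat \<Rightarrow> 'f) persistence_module) (bars J)"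
    using pm_isomorphic_common[OF M iso J(3)] by (auto simp: pm_isomorphic_iff)
  consider "I = []" | b d where "I = [(b, d)]"
    using assms(4) by (cases I) auto
  then show "D = mset I"
  proof cases
    case 1
    then show ?thesis using iso_no_bars k J by blast
  next
    case 2
    then show ?thesis using iso_single_bar[of k b d J] k J I by simp
  qed
qed

section \<open>Diagrams of at most four points\<close>

lemma mem_vietoris_rips:
  assumes "finite Y"
  shows "\<sigma> \<in> vietoris_rips \<delta> Y r \<longleftrightarrow> \<sigma> \<subseteq> Y \<and> \<sigma> \<noteq> {} \<and> (\<forall>x\<in>\<sigma>. \<forall>y\<in>\<sigma>. \<delta> x y \<le> r)"
proof -
  have "simplex_diam \<delta> \<sigma> \<le> r \<longleftrightarrow> (\<forall>x\<in>\<sigma>. \<forall>y\<in>\<sigma>. \<delta> x y \<le> r)" if "\<sigma> \<subseteq> Y" "\<sigma> \<noteq> {}"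
  proof -
    have "finite \<sigma>" using that(1) assms by (rule finite_subset)
    then have "bdd_above ((\<lambda>(x, y). \<delta> x y) ` (\<sigma> \<times> \<sigma>))" by (intro bdd_above_finite) simp
    with that(2) show ?thesis
      unfolding simplex_diam_def by (subst cSUP_le_iff) auto
  qed
  then show ?thesis by (auto simp: vietoris_rips_def)
qed

lemma finite_vietoris_rips: "finite Y \<Longrightarrow> finite (vietoris_rips \<delta> Y r)"
  by (rule finite_subset[of _ "Pow Y"]) (auto simp: vietoris_rips_def)

lemma vietoris_rips_mono: "r \<le> s \<Longrightarrow> vietoris_rips \<delta> Y r \<subseteq> vietoris_rips \<delta> Y s"
  by (auto simp: vietoris_rips_def)

lemma vr_fiber:
  "fiber (vr_persistence_module \<delta> Y n) r = reduced_homology (vietoris_rips \<delta> Y r) n"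
  by (simp add: vr_persistence_module_def)

lemma vr_transition:
  assumes "finite Y" "r \<le> s" "c \<in> cycles (vietoris_rips \<delta> Y r) n"
  shows "transition (vr_persistence_module \<delta> Y n) r s (homology_class (vietoris_rips \<delta> Y r) n c)
       = homology_class (vietoris_rips \<delta> Y s) n c"
  using transition_homology_class[OF finite_vietoris_rips[OF assms(1)] vietoris_rips_mono[OF assms(2)] assms(3)]
  by (simp add: vr_persistence_module_def)

lemma vr_cycles_mono:
  assumes "finite Y" "r \<le> s" "c \<in> cycles (vietoris_rips \<delta> Y r) n"
  shows "c \<in> cycles (vietoris_rips \<delta> Y s) n"
  using cycles_mono[OF finite_vietoris_rips[OF assms(1)] vietoris_rips_mono[OF assms(2)]] assms(3) by blast

lemma pm_closed_vr:
  assumes "finite Y"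
  shows "pm_closed (vr_persistence_module \<delta> Y n)"
  unfolding pm_closed_def vr_fiber carrier_reduced_homology
  by (auto simp: add_homology_class smult_homology_class vr_transition[OF assms]
      intro!: imageI cycles_add cycles_scale intro: vr_cycles_mono[OF assms])

lemma vr_diagram_trivial:
  fixes F :: "'f::field itself"
  assumes "finite Y"
    and "\<And>r f. 0 \<le> r \<Longrightarrow> (f :: 'a::linorder set \<Rightarrow> 'f) \<in> cycles (vietoris_rips \<delta> Y r) n \<Longrightarrow>
      f \<in> boundaries (vietoris_rips \<delta> Y r) n"
  shows "vr_diagram F n \<delta> Y = {#}"
proof -
  let ?M = "vr_persistence_module \<delta> Y n :: ('f, ('a set \<Rightarrow> 'f) set) persistence_module"
  have "homology_class (vietoris_rips \<delta> Y r) n f = homology_class (vietoris_rips \<delta> Y r) n (\<lambda>_. 0)"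
    if "0 \<le> r" "f \<in> cycles (vietoris_rips \<delta> Y r) n" for r and f :: "'a set \<Rightarrow> 'f"
    using that assms(2)[OF that] cycles_zero[of "vietoris_rips \<delta> Y r" n]
    by (intro homology_class_eqI) (simp add: homologous_def)
  then have carrier: "carrier (fiber ?M r) = {homology_class (vietoris_rips \<delta> Y r) n (\<lambda>_. 0)}" if "0 \<le> r" for r
    using that cycles_zero[of "vietoris_rips \<delta> Y r" n]
    unfolding vr_fiber carrier_reduced_homology by fast
  \<comment> \<open>The direct sum over an empty list has one element, the function that is
    \<open>undefined\<close> everywhere.\<close>
  have "pm_iso_by (\<lambda>_ _. \<lambda>_. undefined) ?M (bars [])"
    by (simp add: pm_iso_by_def carrier carrier_bars add_bars smult_bars transition_bars bij_betw_def restrict_def)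
  then have "pm_isomorphic ?M (bars [])" by (auto simp: pm_isomorphic_iff)
  from persistence_diagram_unique[OF pm_closed_vr[OF assms(1)] this]
  show ?thesis by (simp add: vr_diagram_def)
qed

lemma carrier_single_bar:
  "carrier (fiber (bars [(s, t)] :: ('f::field, nat \<Rightarrow> 'f) persistence_module) r)
    = (\<lambda>u. \<lambda>i\<in>{..<1}. u) ` (if s \<le> r \<and> r < t then UNIV else {0})"
proof -
  have "{..<length [(s, t)]} = {0}" "{..<1::nat} = {0}" by auto
  moreover have "(r \<in> bar [(s, t)] 0) = (s \<le> r \<and> r < t)" by (simp add: bar_def)
  ultimately show ?thesis
    unfolding carrier_bars by (simp only: PiE_over_singleton_iff UNION_singleton_eq_range)
qed

text \<open>The names \<open>a < b < c < d\<close> are kept even if \<open>Y\<close> has fewer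
  points, so that degenerate sets fall under the same homology computation.\<close>

locale four_points =
  fixes a b c d :: "'a::linorder" and \<delta> :: "'a \<Rightarrow> 'a \<Rightarrow> real" and Y :: "'a set"
  assumes ab: "a < b" and bc: "b < c" and cd: "c < d"
    and Y: "Y \<subseteq> {a, b, c, d}"
    and sym: "\<And>x y. x \<in> Y \<Longrightarrow> y \<in> Y \<Longrightarrow> \<delta> x y = \<delta> y x"
    and self: "\<And>x. x \<in> Y \<Longrightarrow> \<delta> x x = 0"
begin

lemma finite_Y: "finite Y"
  using Y by (rule finite_subset) simp

lemma pair_mem:
  assumes "0 \<le> r"
  shows "{x, y} \<in> vietoris_rips \<delta> Y r \<longleftrightarrow> x \<in> Y \<and> y \<in> Y \<and> \<delta> x y \<le> r"
  unfolding mem_vietoris_rips[OF finite_Y] using assms sym[of x y] self[of x] self[of y] by auto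

lemma triple_mem:
  assumes "0 \<le> r"
  shows "{x, y, z} \<in> vietoris_rips \<delta> Y r \<longleftrightarrow>
    x \<in> Y \<and> y \<in> Y \<and> z \<in> Y \<and> \<delta> x y \<le> r \<and> \<delta> y z \<le> r \<and> \<delta> x z \<le> r"
  unfolding mem_vietoris_rips[OF finite_Y]
  using assms sym[of x y] sym[of y z] sym[of x z] self[of x] self[of y] self[of z] by auto

lemma four_vertices: "four_vertices a b c d (vietoris_rips \<delta> Y r)"
  using ab bc cd Y by unfold_locales (auto simp: vietoris_rips_def)

lemma flag: "0 \<le> r \<Longrightarrow> four_vertices.flag a b c d (vietoris_rips \<delta> Y r)"
  unfolding four_vertices.flag_def[OF four_vertices] pair_mem triple_mem by blast

definition t_birth :: real where
  "t_birth = max (max (\<delta> a b) (\<delta> b c)) (max (\<delta> c d) (\<delta> a d))"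

definition t_death :: real where
  "t_death = min (\<delta> a c) (\<delta> b d)"

text \<open>Every four-cycle uses all four vertices, so a missing vertex excludes all three and
  every 1-cycle bounds.\<close>

lemma vr_diagram_few:
  fixes F :: "'f::field itself"
  assumes "Y \<noteq> {a, b, c, d}"
  shows "vr_diagram F 1 \<delta> Y = {#}"
proof (rule vr_diagram_trivial[OF finite_Y])
  fix r :: real and f :: "'a set \<Rightarrow> 'f"
  assume r: "0 \<le> r" and f: "f \<in> cycles (vietoris_rips \<delta> Y r) 1"
  from assms Y have "\<not> (a \<in> Y \<and> b \<in> Y \<and> c \<in> Y \<and> d \<in> Y)" by blast
  then show "f \<in> boundaries (vietoris_rips \<delta> Y r) 1"
    by (intro four_vertices.cycles_subset_boundaries[OF four_vertices flag[OF r] _ _ _ f])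
       (auto simp: pair_mem[OF r])
qed

text \<open>\<open>cross1\<close> and \<open>cross2\<close> say that the four-cycles
  \<open>a c b d\<close> and \<open>a b d c\<close> occur at no scale. Only \<open>a b c d\<close>
  is left to produce homology.\<close>

context
  assumes Y_eq: "Y = {a, b, c, d}"
    and nonneg: "0 \<le> \<delta> a b"
    and cross1: "\<not> (max (max (\<delta> a c) (\<delta> b c)) (max (\<delta> b d) (\<delta> a d)) < min (\<delta> a b) (\<delta> c d))"
    and cross2: "\<not> (max (max (\<delta> a b) (\<delta> b d)) (max (\<delta> c d) (\<delta> a c)) < min (\<delta> a d) (\<delta> b c))"
begin

lemma cycles_bound_outside:
  fixes f :: "'a set \<Rightarrow> 'f::field"
  assumes r: "0 \<le> r" "\<not> (t_birth \<le> r \<and> r < t_death)" and f: "f \<in> cycles (vietoris_rips \<delta> Y r) 1"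
  shows "f \<in> boundaries (vietoris_rips \<delta> Y r) 1"
proof (rule four_vertices.cycles_subset_boundaries[OF four_vertices flag[OF r(1)] _ _ _ f])
  show "\<not> ({a, b} \<in> vietoris_rips \<delta> Y r \<and> {b, c} \<in> vietoris_rips \<delta> Y r \<and> {c, d} \<in> vietoris_rips \<delta> Y r \<and>
       {a, d} \<in> vietoris_rips \<delta> Y r \<and> {a, c} \<notin> vietoris_rips \<delta> Y r \<and> {b, d} \<notin> vietoris_rips \<delta> Y r)"
    using r(2) Y_eq unfolding pair_mem[OF r(1)] t_birth_def t_death_def by auto
  show "\<not> ({a, c} \<in> vietoris_rips \<delta> Y r \<and> {b, c} \<in> vietoris_rips \<delta> Y r \<and> {b, d} \<in> vietoris_rips \<delta> Y r \<and>
       {a, d} \<in> vietoris_rips \<delta> Y r \<and> {a, b} \<notin> vietoris_rips \<delta> Y r \<and> {c, d} \<notin> vietoris_rips \<delta> Y r)"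
    using cross1 Y_eq unfolding pair_mem[OF r(1)] by auto
  show "\<not> ({a, b} \<in> vietoris_rips \<delta> Y r \<and> {b, d} \<in> vietoris_rips \<delta> Y r \<and> {c, d} \<in> vietoris_rips \<delta> Y r \<and>
       {a, c} \<in> vietoris_rips \<delta> Y r \<and> {a, d} \<notin> vietoris_rips \<delta> Y r \<and> {b, c} \<notin> vietoris_rips \<delta> Y r)"
    using cross2 Y_eq unfolding pair_mem[OF r(1)] by auto
qed

lemma inside:
  assumes "t_birth \<le> r" "r < t_death"
  shows "0 \<le> r" "{a, b} \<in> vietoris_rips \<delta> Y r" "{b, c} \<in> vietoris_rips \<delta> Y r"
    "{c, d} \<in> vietoris_rips \<delta> Y r" "{a, d} \<in> vietoris_rips \<delta> Y r"
    "{a, c} \<notin> vietoris_rips \<delta> Y r" "{b, d} \<notin> vietoris_rips \<delta> Y r"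
proof -
  show r: "0 \<le> r" using assms nonneg by (simp add: t_birth_def)
  show "{a, b} \<in> vietoris_rips \<delta> Y r" "{b, c} \<in> vietoris_rips \<delta> Y r"
    "{c, d} \<in> vietoris_rips \<delta> Y r" "{a, d} \<in> vietoris_rips \<delta> Y r"
    "{a, c} \<notin> vietoris_rips \<delta> Y r" "{b, d} \<notin> vietoris_rips \<delta> Y r"
    unfolding pair_mem[OF r] using assms Y_eq by (auto simp: t_birth_def t_death_def)
qed

lemma homology_class_inside:
  fixes f :: "'a set \<Rightarrow> 'f::field"
  assumes r: "t_birth \<le> r" "r < t_death" and f: "f \<in> cycles (vietoris_rips \<delta> Y r) 1"
  shows "homology_class (vietoris_rips \<delta> Y r) 1 f = {f}"
proof -
  note i = inside[OF r]
  have "card \<sigma> \<noteq> 3" if "\<sigma> \<in> vietoris_rips \<delta> Y r" for \<sigma>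
  proof
    assume 3: "card \<sigma> = 3"
    have "\<sigma> \<subseteq> {a, b, c, d}" using that Y by (auto simp: vietoris_rips_def)
    from subset_four_card_3[OF this 3] that i(6,7) show False
      by (auto simp: pair_mem[OF i(1)] triple_mem[OF i(1)])
  qed
  from four_vertices.four_cycle_homologous[OF four_vertices this] f show ?thesis
    by (auto simp: homology_class_def)
qed

text \<open>The isomorphism reads off the coefficient on the edge \<open>{a, b}\<close>. Inside the
  range classes are single cycles and this coefficient parametrizes them; outside it homology
  vanishes.\<close>

lemma vr_diagram_four:
  fixes F :: "'f::field itself"
  shows "vr_diagram F 1 \<delta> Y = (if t_birth < t_death then {#(t_birth, t_death)#} else {#})"
proof (cases "t_birth < t_death")
  case False
  then have "vr_diagram F 1 \<delta> Y = {#}"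
    by (intro vr_diagram_trivial[OF finite_Y] cycles_bound_outside) auto
  with False show ?thesis by simp
next
  case True
  let ?M = "vr_persistence_module \<delta> Y 1 :: ('f, ('a set \<Rightarrow> 'f) set) persistence_module"
  let ?K = "vietoris_rips \<delta> Y"
  let ?I = "[(t_birth, t_death)]"
  \<comment> \<open>\<open>the_elem\<close> is meaningful only inside the range, where classes are
    singletons; outside it the value is forced to be 0.\<close>
  define h :: "real \<Rightarrow> ('a set \<Rightarrow> 'f) set \<Rightarrow> nat \<Rightarrow> 'f" where
    "h r X = (\<lambda>i\<in>{..<1}. if t_birth \<le> r \<and> r < t_death then the_elem X {a, b} else 0)" for r X
  have h_in: "h r (homology_class (?K r) 1 f) = (\<lambda>i\<in>{..<1}. f {a, b})"
    if "t_birth \<le> r" "r < t_death" "f \<in> cycles (?K r) 1" for r f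
    using homology_class_inside[OF that] that by (simp add: h_def)
  have h_out: "h r X = (\<lambda>i\<in>{..<1}. 0)" if "\<not> (t_birth \<le> r \<and> r < t_death)" for r X
    using that by (auto simp: h_def)
  have bar: "r \<in> bar ?I i \<longleftrightarrow> t_birth \<le> r \<and> r < t_death" if "i < 1" for r i
    using that by (simp add: bar_def)
  note h_in' = h_in[unfolded One_nat_def] and h_out' = h_out[unfolded One_nat_def]
  have "pm_iso_by h ?M (bars ?I)"
    unfolding pm_iso_by_def vr_fiber carrier_reduced_homology
  proof (intro conjI allI impI ballI)
    fix r :: real assume r: "0 \<le> r"
    show "bij_betw (h r) (homology_class (?K r) 1 ` cycles (?K r) 1) (carrier (fiber (bars ?I) r))"
    proof (cases "t_birth \<le> r \<and> r < t_death")
      case in_range: True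
      then have rr: "t_birth \<le> r" "r < t_death" by auto
      have bij: "bij_betw (\<lambda>f. f {a, b}) (cycles (?K r) 1) (UNIV :: 'f set)"
        by (rule four_vertices.four_cycle_cycles[OF four_vertices inside(2-7)[OF rr]])
      have carrier: "carrier (fiber (bars ?I) r) = (\<lambda>t. \<lambda>i\<in>{..<1}. t) ` (UNIV :: 'f set)"
        using rr by (simp add: carrier_single_bar)
      show ?thesis
        unfolding bij_betw_def
      proof
        show "inj_on (h r) (homology_class (?K r) 1 ` cycles (?K r) 1)"
        proof (rule inj_onI, elim imageE)
          fix X X' f g assume *: "h r X = h r X'" "X = homology_class (?K r) 1 f" "f \<in> cycles (?K r) 1"
            "X' = homology_class (?K r) 1 g" "g \<in> cycles (?K r) 1"
          then have "(\<lambda>i\<in>{..<1}. f {a, b}) = (\<lambda>i\<in>{..<1::nat}. g {a, b})"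
            using h_in[OF rr] by simp
          from fun_cong[OF this, of 0] have "f {a, b} = g {a, b}" by simp
          then have "f = g"
            using inj_onD[OF bij_betw_imp_inj_on[OF bij], of f g] *(3,5) by blast
          then show "X = X'" using * by simp
        qed
        have "h r ` homology_class (?K r) 1 ` cycles (?K r) 1 = (\<lambda>f. \<lambda>i\<in>{..<1}. f {a, b}) ` cycles (?K r) 1"
          unfolding image_image using h_in[OF rr] by (rule image_cong[OF refl])
        also have "\<dots> = (\<lambda>t. \<lambda>i\<in>{..<1}. t) ` ((\<lambda>f. f {a, b}) ` cycles (?K r) 1)"
          by (simp only: image_image)
        also have "\<dots> = carrier (fiber (bars ?I) r)"
          unfolding carrier bij_betw_imp_surj_on[OF bij] ..
        finally show "h r ` homology_class (?K r) 1 ` cycles (?K r) 1 = carrier (fiber (bars ?I) r)" .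
      qed
    next
      case out: False
      have "homology_class (?K r) 1 f = homology_class (?K r) 1 (\<lambda>_. 0)"
        if "f \<in> cycles (?K r) 1" for f :: "'a set \<Rightarrow> 'f"
        using that cycles_bound_outside[OF r out that] cycles_zero[of "?K r" 1]
        by (intro homology_class_eqI) (simp add: homologous_def)
      then have 1: "homology_class (?K r) 1 ` cycles (?K r) 1 = {homology_class (?K r) 1 (\<lambda>_. 0 :: 'f)}"
        using cycles_zero[of "?K r" 1] by fast
      have "carrier (fiber (bars ?I) r) = {\<lambda>i\<in>{..<1}. 0 :: 'f}"
        using out by (simp only: carrier_single_bar if_False image_insert image_empty)
      then show ?thesis unfolding 1 using h_out[OF out] by (simp add: bij_betw_def)
    qed
    fix X :: "('a set \<Rightarrow> 'f) set" assume "X \<in> homology_class (?K r) 1 ` cycles (?K r) 1"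
    then obtain f where f: "f \<in> cycles (?K r) 1" "X = homology_class (?K r) 1 f" by blast
    note f' = f(1)[unfolded One_nat_def]
    {
      fix X' :: "('a set \<Rightarrow> 'f) set" assume "X' \<in> homology_class (?K r) 1 ` cycles (?K r) 1"
      then obtain g where g: "g \<in> cycles (?K r) 1" "X' = homology_class (?K r) 1 g" by blast
      show "h r (X \<oplus>\<^bsub>reduced_homology (?K r) 1\<^esub> X') = h r X \<oplus>\<^bsub>fiber (bars ?I) r\<^esub> h r X'"
        unfolding f(2) g(2) add_homology_class[OF f(1) g(1)] add_bars
        by (cases "t_birth \<le> r \<and> r < t_death")
           (auto simp: h_in' h_out' f' g(1)[unfolded One_nat_def] cycles_add intro!: restrict_ext)
    }
    {
      fix t :: 'f
      show "h r (t \<odot>\<^bsub>reduced_homology (?K r) 1\<^esub> X) = t \<odot>\<^bsub>fiber (bars ?I) r\<^esub> h r X"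
        unfolding f(2) smult_homology_class[OF f(1)] smult_bars
        by (cases "t_birth \<le> r \<and> r < t_death")
           (auto simp: h_in' h_out' f' cycles_scale intro!: restrict_ext)
    }
    {
      fix s assume s: "r \<le> s"
      have fs: "f \<in> cycles (?K s) 1" by (rule vr_cycles_mono[OF finite_Y s f(1)])
      show "h s (transition ?M r s X) = transition (bars ?I) r s (h r X)"
      proof (cases "t_birth \<le> s \<and> s < t_death")
        case out: False
        show ?thesis unfolding h_out[OF out] transition_bars
          using out bar by (auto simp del: One_nat_def intro!: restrict_ext)
      next
        case s_in: True
        show ?thesis
        proof (cases "t_birth \<le> r")
          case True
          then have "t_birth \<le> r \<and> r < t_death" using s s_in by simp
          then show ?thesis
            unfolding f(2) vr_transition[OF finite_Y s f(1)] transition_bars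
            using bar s_in by (auto simp: h_in' f' fs[unfolded One_nat_def] intro!: restrict_ext)
        next
          \<comment> \<open>Entering the range from below: the cycle already bounds at
            \<open>r\<close>, hence also at \<open>s\<close>, and both sides are 0.\<close>
          case below: False
          then have out: "\<not> (t_birth \<le> r \<and> r < t_death)" by simp
          have "f \<in> boundaries (?K r) 1" by (rule cycles_bound_outside[OF r out f(1)])
          then have bs: "f \<in> boundaries (?K s) 1"
            using boundaries_mono[OF finite_vietoris_rips[OF finite_Y] vietoris_rips_mono[OF s]] by blast
          have "(\<lambda>_. 0, f) \<in> homologous (?K s) 1"
            using bs fs cycles_zero[of "?K s" 1] boundaries_scale[OF bs, of "-1"] by (simp add: homologous_def)
          then have "homology_class (?K s) 1 f = homology_class (?K s) 1 (\<lambda>_. 0)"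
            by (rule homology_class_eqI[symmetric])
          then show ?thesis
            unfolding f(2) vr_transition[OF finite_Y s f(1)] transition_bars
            using bar s_in below by (auto simp: h_in' cycles_zero intro!: restrict_ext)
        qed
      qed
    }
  qed
  then have "pm_isomorphic ?M (bars ?I)" by (auto simp: pm_isomorphic_iff)
  moreover have "0 \<le> t_birth" using nonneg by (simp add: t_birth_def)
  ultimately have "persistence_diagram ?M = mset ?I"
    using True by (intro persistence_diagram_unique pm_closed_vr[OF finite_Y]) auto
  with True show ?thesis by (simp add: vr_diagram_def)
qed

end

end

section \<open>Diagrams of four points on the circle\<close>

lemma plane_class_eq_iff:
  "plane_class p = plane_class q \<longleftrightarrow> p = q \<or> (fst p = snd p \<and> fst q = snd q)"
  unfolding plane_mod_diagonal.abs_eq_iff diagonal_collapse_def ..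

lemma plane_class_diagonal_iff: "plane_class p = diagonal_point \<longleftrightarrow> fst p = snd p"
  unfolding diagonal_point_def plane_class_eq_iff by (cases p) auto

lemma diagram_class_empty: "diagram_class {#} = diagonal_point"
  by (simp add: diagram_class_def)

lemma diagram_class_single: "diagram_class {#p#} = plane_class p"
  by (simp add: diagram_class_def)

lemma circle_dist_commute: "circle_dist x y = circle_dist y x"
  by (simp add: circle_dist_def abs_minus_commute)

lemma circle_dist_self: "circle_dist x x = 0"
  by (simp add: circle_dist_def)

lemma circle_dist_nonneg: "x \<in> circle \<Longrightarrow> y \<in> circle \<Longrightarrow> 0 \<le> circle_dist x y"
  by (auto simp: circle_dist_def circle_def)

definition cycle_birth :: "real \<Rightarrow> real \<Rightarrow> real \<Rightarrow> real \<Rightarrow> real" where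
  "cycle_birth p q r s =
     max (max (circle_dist p q) (circle_dist q r)) (max (circle_dist r s) (circle_dist s p))"

definition cycle_death :: "real \<Rightarrow> real \<Rightarrow> real \<Rightarrow> real \<Rightarrow> real" where
  "cycle_death p q r s = min (circle_dist p r) (circle_dist q s)"

text \<open>The default \<open>(0, 0)\<close> serves twice: it is neutral for the addition in
  \<open>four_point_bar\<close>, and it represents the collapsed diagonal.\<close>

definition cycle_bar :: "real \<Rightarrow> real \<Rightarrow> real \<Rightarrow> real \<Rightarrow> real \<times> real" where
  "cycle_bar p q r s = (if cycle_birth p q r s < cycle_death p q r s
     then (cycle_birth p q r s, cycle_death p q r s) else (0, 0))"

text \<open>
  At most one of the three four-cycles through four points has a nonzero bar, so this sum is just
  a permutation invariant way to select it.
\<close>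

definition four_point_bar :: "real \<Rightarrow> real \<Rightarrow> real \<Rightarrow> real \<Rightarrow> real \<times> real" where
  "four_point_bar p q r s = cycle_bar p q r s + cycle_bar p r q s + cycle_bar p q s r"

lemmas cycle_bar_dihedral = cycle_bar_def cycle_birth_def cycle_death_def circle_dist_commute
  max.assoc max.commute max.left_commute min.commute

text \<open>\<open>cycle_bar\<close> depends only on the four-cycle, not on its starting point or
  direction, and a transposition of points permutes the three four-cycles. The same reason serves
  the next two lemmas.\<close>

lemma four_point_bar_swap12: "four_point_bar q p r s = four_point_bar p q r s"
proof -
  have "cycle_bar q p r s = cycle_bar p q s r" "cycle_bar q r p s = cycle_bar p r q s"
    "cycle_bar q p s r = cycle_bar p q r s"
    by (simp_all add: cycle_bar_dihedral)
  then show ?thesis by (simp add: four_point_bar_def add_ac)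
qed

lemma four_point_bar_swap23: "four_point_bar p r q s = four_point_bar p q r s"
proof -
  have "cycle_bar p r s q = cycle_bar p q s r" by (simp add: cycle_bar_dihedral)
  then show ?thesis by (simp add: four_point_bar_def add_ac)
qed

lemma four_point_bar_swap34: "four_point_bar p q s r = four_point_bar p q r s"
proof -
  have "cycle_bar p s q r = cycle_bar p r q s" by (simp add: cycle_bar_dihedral)
  then show ?thesis by (simp add: four_point_bar_def add_ac)
qed

text \<open>Insertion sort by adjacent transpositions: \<open>sorted3\<close> inserts the fourth
  point into three sorted ones, \<open>sorted2\<close> the third into two.\<close>

lemma sort_four_wlog:
  fixes P :: "'a::linorder \<Rightarrow> 'a \<Rightarrow> 'a \<Rightarrow> 'a \<Rightarrow> bool"
  assumes s12: "\<And>p q r s. P q p r s \<Longrightarrow> P p q r s"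
    and s23: "\<And>p q r s. P p r q s \<Longrightarrow> P p q r s"
    and s34: "\<And>p q r s. P p q s r \<Longrightarrow> P p q r s"
    and sorted: "\<And>p q r s. p < q \<Longrightarrow> q < r \<Longrightarrow> r < s \<Longrightarrow> P p q r s"
    and distinct: "distinct [p, q, r, s]"
  shows "P p q r s"
proof -
  have sorted3: "P p q r s" if h: "p < q" "q < r" "distinct [p, q, r, s]" for p q r s
  proof -
    consider "r < s" | "q < s" "s < r" | "p < s" "s < q" | "s < p"
      using h(3) by (force simp: neq_iff)
    then show ?thesis
    proof cases
      case 1 then show ?thesis using h by (intro sorted) auto
    next
      case 2 then show ?thesis using h by (intro s34[OF sorted]) auto
    next
      case 3 then show ?thesis using h by (intro s34[OF s23[OF sorted]]) auto
    next
      case 4 then show ?thesis using h by (intro s34[OF s23[OF s12[OF sorted]]]) auto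
    qed
  qed
  have sorted2: "P p q r s" if h: "p < q" "distinct [p, q, r, s]" for p q r s
  proof -
    consider "q < r" | "p < r" "r < q" | "r < p"
      using h(2) by (force simp: neq_iff)
    then show ?thesis
    proof cases
      case 1 then show ?thesis using h by (intro sorted3) auto
    next
      case 2 then show ?thesis using h by (intro s23[OF sorted3]) auto
    next
      case 3 then show ?thesis using h by (intro s23[OF s12[OF sorted3]]) auto
    qed
  qed
  show ?thesis
  proof (cases "p < q")
    case True then show ?thesis using distinct by (rule sorted2)
  next
    case False
    with distinct have "q < p" by auto
    then show ?thesis using distinct by (intro s12[OF sorted2]) auto
  qed
qed

text \<open>Small sets are padded with arbitrary reals, on the circle or not, to supply the four
  names that \<open>four_points\<close> asks for.\<close>

lemma ex_four_superset:
  fixes Y :: "real set"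
  assumes "finite Y" "card Y \<le> 4"
  obtains a b c d where "a < b" "b < c" "c < d" "Y \<subseteq> {a, b, c, d}"
proof -
  obtain Z where Z: "Y \<subseteq> Z" "finite Z" "card Z = 4"
  proof -
    have "infinite (UNIV - Y)" using assms(1) infinite_UNIV_char_0 by (rule Diff_infinite_finite)
    then obtain W where W: "W \<subseteq> UNIV - Y" "finite W" "card W = 4 - card Y"
      using infinite_arbitrarily_large by blast
    then have "card (Y \<union> W) = 4"
      using assms by (subst card_Un_disjoint) auto
    with that[of "Y \<union> W"] assms W show thesis by auto
  qed
  have "\<exists>a b c d. xs = [a, b, c, d]" if "length xs = 4" for xs :: "real list"
    using that by (auto simp: numeral_eq_Suc length_Suc_conv)
  from this[of "sorted_list_of_set Z"] obtain a b c d where l: "sorted_list_of_set Z = [a, b, c, d]"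
    using Z by auto
  have "sorted_wrt (<) [a, b, c, d]"
    using strict_sorted_list_of_set[of Z] unfolding l .
  moreover have "Z = {a, b, c, d}"
    using set_sorted_list_of_set[OF Z(2)] unfolding l by simp
  ultimately show thesis using that[of a b c d] Z(1) by auto
qed

lemma four_points_circle:
  assumes "a < b" "b < c" "c < d" "Y \<subseteq> {a, b, c, d}"
  shows "four_points a b c d circle_dist Y"
  using assms by unfold_locales (auto simp: circle_dist_commute circle_dist_self)

lemma circle_vr_class_few:
  assumes "finite Y" "card Y < 4"
  shows "circle_vr_class F Y = diagonal_point"
proof -
  obtain a b c d where abcd: "a < b" "b < c" "c < d" "Y \<subseteq> {a, b, c, d}"
    by (rule ex_four_superset[OF assms(1) less_imp_le[OF assms(2)]])
  from abcd(1-3) have "card {a, b, c, d} = 4" by auto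
  with assms(2) have "Y \<noteq> {a, b, c, d}" by auto
  from four_points.vr_diagram_few[OF four_points_circle[OF abcd] this, of F]
  show ?thesis by (simp add: circle_vr_class_def diagram_class_empty)
qed

text \<open>One arc between \<open>a\<close> and \<open>c\<close> contains the arcs
  \<open>ab\<close> and \<open>bc\<close>, the other contains \<open>cd\<close> and
  \<open>da\<close>. So the edge \<open>ac\<close> is at least as long as the shorter of
  \<open>ab\<close>, \<open>cd\<close> and the shorter of \<open>bc\<close>, \<open>ad\<close>,
  which are the death values of the two crossed cycles.\<close>

lemma cycle_bar_cross:
  assumes "a < b" "b < c" "c < d" "a \<in> circle" "d \<in> circle"
  shows "cycle_bar a c b d = (0, 0)" "cycle_bar a b d c = (0, 0)"
proof -
  have "\<not> cycle_birth a c b d < cycle_death a c b d" "\<not> cycle_birth a b d c < cycle_death a b d c"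
    using assms by (auto simp: cycle_birth_def cycle_death_def circle_dist_def circle_def min_def split: if_splits)
  then show "cycle_bar a c b d = (0, 0)" "cycle_bar a b d c = (0, 0)"
    by (simp_all add: cycle_bar_def)
qed

lemma circle_vr_class_sorted:
  assumes "a < b" "b < c" "c < d" "a \<in> circle" "d \<in> circle"
  shows "circle_vr_class F {a, b, c, d} = plane_class (cycle_bar a b c d)"
proof -
  have circ: "b \<in> circle" using assms by (auto simp: circle_def)
  interpret four_points a b c d circle_dist "{a, b, c, d}"
    using assms(1-3) by (rule four_points_circle) simp
  have "\<not> cycle_birth a c b d < cycle_death a c b d" "\<not> cycle_birth a b d c < cycle_death a b d c"
    using assms by (auto simp: cycle_birth_def cycle_death_def circle_dist_def circle_def min_def split: if_splits)
  then have "vr_diagram F 1 circle_dist {a, b, c, d} = (if t_birth < t_death then {#(t_birth, t_death)#} else {#})"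
    using circ assms(4)
    by (intro vr_diagram_four refl circle_dist_nonneg)
       (simp_all add: cycle_birth_def cycle_death_def circle_dist_commute max.commute max.left_commute max.assoc)
  moreover have "t_birth = cycle_birth a b c d" "t_death = cycle_death a b c d"
    by (simp_all add: t_birth_def t_death_def cycle_birth_def cycle_death_def circle_dist_commute)
  ultimately show ?thesis
    by (simp add: circle_vr_class_def cycle_bar_def diagram_class_empty diagram_class_single diagonal_point_def)
qed

text \<open>If neighbours coincide, a diagonal has the same length as an edge; if opposite points
  coincide, a diagonal has length 0. In both cases death does not exceed birth.\<close>

lemma cycle_bar_not_distinct:
  assumes "p \<in> circle" "q \<in> circle" "r \<in> circle" "s \<in> circle" "\<not> distinct [p, q, r, s]"
  shows "cycle_bar p q r s = (0, 0)"
proof -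
  have "0 \<le> circle_dist p q" using assms by (intro circle_dist_nonneg)
  moreover have "p = q \<or> p = r \<or> p = s \<or> q = r \<or> q = s \<or> r = s" using assms(5) by auto
  ultimately have "\<not> cycle_birth p q r s < cycle_death p q r s"
    by (elim disjE) (auto simp: cycle_birth_def cycle_death_def circle_dist_self circle_dist_commute)
  then show ?thesis by (simp add: cycle_bar_def)
qed

lemma circle_vr_class_eq:
  assumes "p \<in> circle" "q \<in> circle" "r \<in> circle" "s \<in> circle"
  shows "circle_vr_class F {p, q, r, s} = plane_class (four_point_bar p q r s)"
proof (cases "distinct [p, q, r, s]")
  case False
  have "card {p, q, r, s} < 4"
    using False card_length[of "[p, q, r, s]"] card_distinct[of "[p, q, r, s]"] by fastforce
  then have "circle_vr_class F {p, q, r, s} = diagonal_point"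
    by (intro circle_vr_class_few) auto
  moreover have "four_point_bar p q r s = (0, 0)"
    unfolding four_point_bar_def using assms False
    by (subst (1 2 3) cycle_bar_not_distinct) auto
  ultimately show ?thesis by (simp add: diagonal_point_def)
next
  case True
  define P where "P p q r s \<longleftrightarrow> p \<in> circle \<and> q \<in> circle \<and> r \<in> circle \<and> s \<in> circle \<longrightarrow>
    circle_vr_class F {p, q, r, s} = plane_class (four_point_bar p q r s)" for p q r s
  have "P p q r s"
  proof (rule sort_four_wlog[of P, OF _ _ _ _ True])
    fix p q r s
    show "P p q r s" if "P q p r s"
      using that four_point_bar_swap12[of p q r s] by (simp add: P_def insert_commute)
    show "P p q r s" if "P p r q s"
      using that four_point_bar_swap23[of p q r s] by (simp add: P_def insert_commute)
    show "P p q r s" if "P p q s r"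
      using that four_point_bar_swap34[of p q r s] by (simp add: P_def insert_commute)
    show "P p q r s" if "p < q" "q < r" "r < s"
      using circle_vr_class_sorted[OF that] cycle_bar_cross[OF that]
      by (auto simp: P_def four_point_bar_def simp flip: zero_prod_def)
  qed
  with assms show ?thesis by (simp add: P_def)
qed

text \<open>The complement of the arc of an edge contains an arc spanned by a diagonal, so it is
  longer than the birth value; hence the four arcs themselves are at most
  \<open>cycle_birth\<close>. The death value is the length of an arc spanned by a diagonal, and the
  complement of that arc consists of two of the four.\<close>

lemma sorted_cycle_bounds:
  assumes ord: "a < b" "b < c" "c < d" "0 \<le> a" "d < 2 * pi"
    and less: "cycle_birth a b c d < cycle_death a b c d"
  shows "cycle_death a b c d \<le> pi" "2 * pi \<le> 2 * cycle_birth a b c d + cycle_death a b c d"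
proof -
  have edges: "circle_dist a b \<le> cycle_birth a b c d" "circle_dist b c \<le> cycle_birth a b c d"
    "circle_dist c d \<le> cycle_birth a b c d" "circle_dist d a \<le> cycle_birth a b c d"
    by (auto simp: cycle_birth_def)
  have diags: "cycle_death a b c d \<le> circle_dist a c" "cycle_death a b c d \<le> circle_dist b d"
    by (auto simp: cycle_death_def)
  have ac: "circle_dist a c \<le> c - a" "circle_dist a c \<le> 2 * pi - (c - a)"
    and bd: "circle_dist b d \<le> d - b" "circle_dist b d \<le> 2 * pi - (d - b)"
    using ord by (auto simp: circle_dist_def)
  show "cycle_death a b c d \<le> pi" using diags(1) ac by linarith
  have ab: "circle_dist a b = min (b - a) (2 * pi - (b - a))"
    and bc: "circle_dist b c = min (c - b) (2 * pi - (c - b))"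
    and cd: "circle_dist c d = min (d - c) (2 * pi - (d - c))"
    and da: "circle_dist d a = min (d - a) (2 * pi - (d - a))"
    using ord by (auto simp: circle_dist_def)
  have "b - a \<le> cycle_birth a b c d"
    using ab edges(1) diags(1) ac(2) less ord by linarith
  moreover have "c - b \<le> cycle_birth a b c d"
    using bc edges(2) diags(2) bd(2) less ord by linarith
  moreover have "d - c \<le> cycle_birth a b c d"
    using cd edges(3) diags(1) ac(1) less ord by linarith
  moreover have "2 * pi - (d - a) \<le> cycle_birth a b c d"
    using da edges(4) diags(1) ac(1) less ord by linarith
  moreover have "cycle_death a b c d \<in> {c - a, 2 * pi - (c - a), d - b, 2 * pi - (d - b)}"
    using ord by (auto simp: cycle_death_def circle_dist_def min_def)
  ultimately show "2 * pi \<le> 2 * cycle_birth a b c d + cycle_death a b c d"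
    by auto
qed

text \<open>The triangle with corners (2 * pi / 3, 2 * pi / 3), (pi / 2, pi) and (pi, pi), without
  its side on the diagonal.\<close>

definition bar_region :: "(real \<times> real) set" where
  "bar_region = {(t\<^sub>b, t\<^sub>d). t\<^sub>b < t\<^sub>d \<and> t\<^sub>d \<le> pi \<and> 2 * pi \<le> 2 * t\<^sub>b + t\<^sub>d}"

lemma circle_D41_off_diagonal:
  fixes F :: "'f::field itself"
  shows "circle_D41 F - {diagonal_point} = plane_class ` bar_region"
proof (intro equalityI subsetI)
  fix x assume x: "x \<in> circle_D41 F - {diagonal_point}"
  then obtain X where X: "x = circle_vr_class F X" "X \<subseteq> circle" "finite X" "card X \<le> 4"
    by (auto simp: circle_D41_def)
  with x circle_vr_class_few[OF X(3)] have "card X = 4" by fastforce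
  obtain a b c d where abcd: "a < b" "b < c" "c < d" "X \<subseteq> {a, b, c, d}"
    by (rule ex_four_superset[OF X(3,4)])
  then have "X = {a, b, c, d}" using \<open>card X = 4\<close> by (intro card_subset_eq) auto
  with X have circ: "a \<in> circle" "d \<in> circle" and "x = circle_vr_class F {a, b, c, d}" by auto
  with circle_vr_class_sorted[OF abcd(1-3) circ, of F] have x_eq: "x = plane_class (cycle_bar a b c d)" by simp
  with x have less: "cycle_birth a b c d < cycle_death a b c d"
    by (auto simp: plane_class_diagonal_iff cycle_bar_def split: if_splits)
  then have "cycle_death a b c d \<le> pi \<and> 2 * pi \<le> 2 * cycle_birth a b c d + cycle_death a b c d"
    using sorted_cycle_bounds[OF abcd(1-3)] circ by (simp add: circle_def)
  with less have "cycle_bar a b c d \<in> bar_region" by (simp add: bar_region_def cycle_bar_def)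
  with x_eq show "x \<in> plane_class ` bar_region" by blast
next
  fix x assume "x \<in> plane_class ` bar_region"
  then obtain u v where x: "x = plane_class (u, v)" and uv: "u < v" "v \<le> pi" "2 * pi \<le> 2 * u + v"
    by (auto simp: bar_region_def)
  \<comment> \<open>The arcs are \<open>u\<close>, \<open>v - u\<close>, \<open>u\<close> and
    \<open>2 * pi - u - v\<close>. Both diagonals have length \<open>v\<close>, and the inequalities
    of the region say that no arc exceeds \<open>u\<close>.\<close>
  let ?X = "{0, u, v, v + u}"
  have pos: "0 < u" "u < v" "v < v + u" "v + u < 2 * pi" using uv by linarith+
  then have circ: "?X \<subseteq> circle" "0 \<in> circle" "v + u \<in> circle" by (auto simp: circle_def)
  have "cycle_birth 0 u v (v + u) = u" "cycle_death 0 u v (v + u) = v"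
    using uv pos by (auto simp: cycle_birth_def cycle_death_def circle_dist_def min_def max_def)
  then have "cycle_bar 0 u v (v + u) = (u, v)" using uv by (simp add: cycle_bar_def)
  with circle_vr_class_sorted[OF pos(1-3) circ(2,3), of F] x
  have "x = circle_vr_class F ?X" by simp
  moreover have "card ?X \<le> 4" "finite ?X" using card_length[of "[0, u, v, v + u]"] by auto
  ultimately have "x \<in> circle_D41 F" using circ(1) unfolding circle_D41_def by blast
  moreover have "x \<noteq> diagonal_point" using x uv by (simp add: plane_class_diagonal_iff)
  ultimately show "x \<in> circle_D41 F - {diagonal_point}" by blast
qed

section \<open>Four independent uniform points on the circle\<close>

text \<open>The law of \<open>circle_measure\<close>, regarded as a measure on all Borel sets of the
  line, so that Fubini and translations apply without restricted spaces.\<close>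

definition uniform_circle :: "real measure" where
  "uniform_circle = density lborel (\<lambda>x. indicator circle x / ennreal (2 * pi))"

lemma sets_uniform_circle [simp, measurable_cong]: "sets uniform_circle = sets borel"
  by (simp add: uniform_circle_def)

lemma space_uniform_circle [simp]: "space uniform_circle = UNIV"
  by (simp add: uniform_circle_def)

lemma circle_borel [measurable]: "circle \<in> sets borel"
  by (simp add: circle_def)

lemma nn_integral_uniform_circle:
  assumes [measurable]: "f \<in> borel_measurable borel"
  shows "(\<integral>\<^sup>+x. f x \<partial>uniform_circle) = (\<integral>\<^sup>+x. f x * indicator circle x \<partial>lborel) / ennreal (2 * pi)"
proof -
  have "(\<integral>\<^sup>+x. f x \<partial>uniform_circle) = (\<integral>\<^sup>+x. indicator circle x / ennreal (2 * pi) * f x \<partial>lborel)"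
    unfolding uniform_circle_def by (rule nn_integral_density) auto
  also have "\<dots> = (\<integral>\<^sup>+x. (f x * indicator circle x) / ennreal (2 * pi) \<partial>lborel)"
    by (intro nn_integral_cong) (simp add: divide_ennreal_def mult_ac)
  also have "\<dots> = (\<integral>\<^sup>+x. f x * indicator circle x \<partial>lborel) / ennreal (2 * pi)"
    by (rule nn_integral_divide) auto
  finally show ?thesis .
qed

lemma emeasure_circle: "emeasure lborel circle = ennreal (2 * pi)"
  by (simp add: circle_def)

lemma prob_space_uniform_circle: "prob_space uniform_circle"
proof
  have "emeasure uniform_circle (space uniform_circle) = (\<integral>\<^sup>+x. 1 \<partial>uniform_circle)"
    by simp
  also have "\<dots> = 1"
    by (subst nn_integral_uniform_circle) (simp_all add: emeasure_circle ennreal_divide_self)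
  finally show "emeasure uniform_circle (space uniform_circle) = 1" .
qed

lemma AE_uniform_circle: "AE x in uniform_circle. x \<in> circle"
  unfolding uniform_circle_def by (subst AE_density) (auto simp: indicator_def)

lemma AE_uniform_circle_neq:
  assumes "finite X"
  shows "AE x in uniform_circle. x \<notin> X"
proof -
  have "AE x in lborel. x \<notin> X"
    using assms by (intro AE_not_in finite_imp_null_set_lborel)
  then show ?thesis
    unfolding uniform_circle_def by (subst AE_density) auto
qed

lemma sets_circle_measure: "sets circle_measure = sets (restrict_space borel circle)"
  by (simp add: circle_measure_def uniform_measure_def sets_restrict_space)

lemma space_circle_measure: "space circle_measure = circle"
  by (simp add: circle_measure_def space_restrict_space)

lemma measurable_circle_measure: "f \<in> borel_measurable borel \<Longrightarrow> f \<in> measurable circle_measure borel"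
  by (subst measurable_cong_sets[OF sets_circle_measure refl]) (rule measurable_restrict_space1)

lemma nn_integral_circle_measure:
  assumes [measurable]: "f \<in> borel_measurable borel"
  shows "(\<integral>\<^sup>+x. f x \<partial>circle_measure) = (\<integral>\<^sup>+x. f x \<partial>uniform_circle)"
proof -
  let ?R = "restrict_space lborel circle"
  have circle: "emeasure ?R circle = ennreal (2 * pi)"
    by (subst emeasure_restrict_space) (simp_all add: emeasure_circle)
  have f: "f \<in> borel_measurable ?R" by (intro measurable_restrict_space1) simp
  have "(\<integral>\<^sup>+x. f x \<partial>circle_measure) = (\<integral>\<^sup>+x. indicator circle x / emeasure ?R circle * f x \<partial>?R)"
    unfolding circle_measure_def uniform_measure_def
    using f by (intro nn_integral_density) (auto intro!: measurable_restrict_space1)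
  also have "\<dots> = (\<integral>\<^sup>+x. (indicator circle x / ennreal (2 * pi) * f x) * indicator circle x \<partial>lborel)"
    unfolding circle by (rule nn_integral_restrict_space) simp
  also have "\<dots> = (\<integral>\<^sup>+x. indicator circle x / ennreal (2 * pi) * f x \<partial>lborel)"
    by (intro nn_integral_cong) (auto simp: indicator_def)
  also have "\<dots> = (\<integral>\<^sup>+x. f x \<partial>uniform_circle)"
    unfolding uniform_circle_def by (rule nn_integral_density[symmetric]) auto
  finally show ?thesis .
qed

lemma prob_space_circle_measure: "prob_space circle_measure"
proof
  have "emeasure circle_measure (space circle_measure) = (\<integral>\<^sup>+x. 1 \<partial>circle_measure)"
    by simp
  also have "\<dots> = (\<integral>\<^sup>+x. 1 \<partial>uniform_circle)" by (rule nn_integral_circle_measure) simp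
  also have "\<dots> = 1" using prob_space.emeasure_space_1[OF prob_space_uniform_circle] by simp
  finally show "emeasure circle_measure (space circle_measure) = 1" .
qed

section \<open>Iterated integrals over four points and their symmetries\<close>

definition measurable4 :: "(real \<Rightarrow> real \<Rightarrow> real \<Rightarrow> real \<Rightarrow> 'b::topological_space) \<Rightarrow> bool" where
  "measurable4 F \<longleftrightarrow> (\<lambda>(p, q, r, s). F p q r s) \<in> borel_measurable (borel \<Otimes>\<^sub>M borel \<Otimes>\<^sub>M borel \<Otimes>\<^sub>M borel)"

lemma measurable4D:
  assumes F: "measurable4 F"
    and [measurable]: "f \<in> borel_measurable M" "g \<in> borel_measurable M" "h \<in> borel_measurable M" "k \<in> borel_measurable M"
  shows "(\<lambda>x. F (f x) (g x) (h x) (k x)) \<in> borel_measurable M"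
proof -
  have "(\<lambda>x. (f x, g x, h x, k x)) \<in> measurable M (borel \<Otimes>\<^sub>M borel \<Otimes>\<^sub>M borel \<Otimes>\<^sub>M borel)"
    by measurable
  from measurable_compose[OF this F[unfolded measurable4_def]] show ?thesis by simp
qed

definition integral4 :: "(real \<Rightarrow> real \<Rightarrow> real \<Rightarrow> real \<Rightarrow> ennreal) \<Rightarrow> ennreal" where
  "integral4 F = (\<integral>\<^sup>+p. \<integral>\<^sup>+q. \<integral>\<^sup>+r. \<integral>\<^sup>+s. F p q r s
     \<partial>uniform_circle \<partial>uniform_circle \<partial>uniform_circle \<partial>uniform_circle)"

interpretation uniform_circle: prob_space uniform_circle
  by (rule prob_space_uniform_circle)

interpretation uniform_circle_pair: pair_sigma_finite uniform_circle uniform_circle ..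

lemma nn_integral_swap:
  assumes "(\<lambda>(x, y). f x y) \<in> borel_measurable (borel \<Otimes>\<^sub>M borel)"
  shows "(\<integral>\<^sup>+x. \<integral>\<^sup>+y. f x y \<partial>uniform_circle \<partial>uniform_circle)
       = (\<integral>\<^sup>+y. \<integral>\<^sup>+x. f x y \<partial>uniform_circle \<partial>uniform_circle)"
  by (rule uniform_circle_pair.Fubini'[symmetric])
     (use assms in \<open>simp cong: measurable_cong_sets sets_pair_measure_cong\<close>)

lemma integral4_swap12:
  assumes "measurable4 F"
  shows "integral4 (\<lambda>p q r s. F q p r s) = integral4 F"
proof -
  note [measurable] = measurable4D[OF assms]
  show ?thesis unfolding integral4_def
    by (rule nn_integral_swap) measurable
qed

lemma integral4_swap23:
  assumes "measurable4 F"
  shows "integral4 (\<lambda>p q r s. F p r q s) = integral4 F"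
proof -
  note [measurable] = measurable4D[OF assms]
  show ?thesis unfolding integral4_def
    by (intro nn_integral_cong nn_integral_swap) measurable
qed

lemma integral4_swap34:
  assumes "measurable4 F"
  shows "integral4 (\<lambda>p q r s. F p q s r) = integral4 F"
proof -
  note [measurable] = measurable4D[OF assms]
  show ?thesis unfolding integral4_def
    by (intro nn_integral_cong nn_integral_swap) measurable
qed

lemma integral4_add:
  assumes "measurable4 F" "measurable4 G"
  shows "integral4 (\<lambda>p q r s. F p q r s + G p q r s) = integral4 F + integral4 G"
proof -
  note [measurable] = measurable4D[OF assms(1)] measurable4D[OF assms(2)]
  show ?thesis unfolding integral4_def
    by (simp add: nn_integral_add)
qed

text \<open>Exceptions are removed one variable at a time: \<open>r\<close> avoids a finite set
  depending on \<open>p\<close> and \<open>q\<close>, then \<open>s\<close> avoids a null set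
  depending on all three. This is the shape in which ties between distances arise.\<close>

lemma integral4_cong_AE:
  assumes "\<And>p q r. p \<in> circle \<Longrightarrow> q \<in> circle \<Longrightarrow> r \<in> circle \<Longrightarrow> r \<notin> X p q \<Longrightarrow>
      AE s in uniform_circle. F p q r s = G p q r s"
    and "\<And>p q. finite (X p q)"
  shows "integral4 F = integral4 G"
  unfolding integral4_def
proof (rule nn_integral_cong_AE, use AE_uniform_circle in eventually_elim)
  case p: (elim p)
  show ?case
  proof (rule nn_integral_cong_AE, use AE_uniform_circle in eventually_elim)
    case q: (elim q)
    show ?case
    proof (rule nn_integral_cong_AE, use AE_uniform_circle AE_uniform_circle_neq[OF assms(2)[of p q]] in eventually_elim)
      case (elim r)
      show ?case by (rule nn_integral_cong_AE) (rule assms(1)[OF p q elim])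
    qed
  qed
qed

lemma nn_integral_circle_measure4:
  assumes F: "measurable4 F"
  shows "(\<integral>\<^sup>+x. F (x 1) (x 2) (x 3) (x 4) \<partial>circle_measure4) = integral4 F"
proof -
  interpret product_sigma_finite "\<lambda>_::nat. circle_measure"
    using prob_space_circle_measure by (simp add: product_sigma_finite_def prob_space_imp_sigma_finite)
  let ?C = circle_measure
  have [measurable]: "(\<lambda>x. x) \<in> borel_measurable ?C" by (rule measurable_circle_measure) simp
  have m: "f \<in> measurable M borel" if "f \<in> measurable M ?C" for f :: "_ \<Rightarrow> real" and M
    using measurable_compose[OF that, of "\<lambda>x. x" borel] by simp
  note F4 = measurable4D[OF F]
  have set: "{1..4::nat} = insert 1 (insert 2 (insert 3 (insert 4 {})))" by auto
  have mF: "(\<lambda>x. F (x 1) (x 2) (x 3) (x 4)) \<in> borel_measurable (\<Pi>\<^sub>M i\<in>insert (1::nat) (insert 2 (insert 3 (insert 4 {}))). ?C)"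
    by (intro F4 m measurable_component_singleton) auto
  have "(\<integral>\<^sup>+x. F (x 1) (x 2) (x 3) (x 4) \<partial>circle_measure4)
      = (\<integral>\<^sup>+p. \<integral>\<^sup>+x. F p (x 2) (x 3) (x 4) \<partial>(\<Pi>\<^sub>M i\<in>insert (2::nat) (insert 3 (insert 4 {})). ?C) \<partial>?C)"
    unfolding circle_measure4_def set
    by (subst product_nn_integral_insert_rev) (use mF in \<open>simp_all del: One_nat_def\<close>)
  also have "\<dots> = (\<integral>\<^sup>+p. \<integral>\<^sup>+q. \<integral>\<^sup>+x. F p q (x 3) (x 4) \<partial>(\<Pi>\<^sub>M i\<in>insert (3::nat) (insert 4 {}). ?C) \<partial>?C \<partial>?C)"
    by (intro nn_integral_cong, subst product_nn_integral_insert_rev)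
       (auto intro!: F4 m measurable_component_singleton)
  also have "\<dots> = (\<integral>\<^sup>+p. \<integral>\<^sup>+q. \<integral>\<^sup>+r. \<integral>\<^sup>+x. F p q r (x 4) \<partial>(\<Pi>\<^sub>M i\<in>insert (4::nat) {}. ?C) \<partial>?C \<partial>?C \<partial>?C)"
    by (intro nn_integral_cong, subst product_nn_integral_insert_rev)
       (auto intro!: F4 m measurable_component_singleton)
  also have "\<dots> = (\<integral>\<^sup>+p. \<integral>\<^sup>+q. \<integral>\<^sup>+r. \<integral>\<^sup>+s. F p q r s \<partial>?C \<partial>?C \<partial>?C \<partial>?C)"
    by (intro nn_integral_cong product_nn_integral_singleton) (auto intro!: F4 measurable_circle_measure)
  also have "\<dots> = integral4 F"
  proof -
    note [measurable] = F4
    \<comment> \<open>The measure is exchanged from the inside out, since each exchange asks for an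
      inner integral that is Borel on the whole line.\<close>
    have 1: "(\<integral>\<^sup>+s. F p q r s \<partial>?C) = (\<integral>\<^sup>+s. F p q r s \<partial>uniform_circle)" for p q r
      by (rule nn_integral_circle_measure) measurable
    have 2: "(\<integral>\<^sup>+r. \<integral>\<^sup>+s. F p q r s \<partial>uniform_circle \<partial>?C) = (\<integral>\<^sup>+r. \<integral>\<^sup>+s. F p q r s \<partial>uniform_circle \<partial>uniform_circle)" for p q
      by (rule nn_integral_circle_measure) measurable
    have 3: "(\<integral>\<^sup>+q. \<integral>\<^sup>+r. \<integral>\<^sup>+s. F p q r s \<partial>uniform_circle \<partial>uniform_circle \<partial>?C)
        = (\<integral>\<^sup>+q. \<integral>\<^sup>+r. \<integral>\<^sup>+s. F p q r s \<partial>uniform_circle \<partial>uniform_circle \<partial>uniform_circle)" for p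
      by (rule nn_integral_circle_measure) measurable
    show ?thesis unfolding 1 2 3 integral4_def
      by (rule nn_integral_circle_measure) measurable
  qed
  finally show ?thesis .
qed

lemma measurable4_comp:
  assumes "measurable4 F" "measurable4 f" "measurable4 g" "measurable4 h" "measurable4 k"
  shows "measurable4 (\<lambda>p q r s. F (f p q r s) (g p q r s) (h p q r s) (k p q r s))"
  using assms(2-5) unfolding measurable4_def case_prod_beta by (rule measurable4D[OF assms(1)])

lemma measurable4_proj:
  "measurable4 (\<lambda>p q r s. p)" "measurable4 (\<lambda>p q r s. q)" "measurable4 (\<lambda>p q r s. r)" "measurable4 (\<lambda>p q r s. s)"
  unfolding measurable4_def case_prod_beta by measurable

lemma measurable4_add:
  fixes F G :: "real \<Rightarrow> real \<Rightarrow> real \<Rightarrow> real \<Rightarrow> ennreal"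
  shows "measurable4 F \<Longrightarrow> measurable4 G \<Longrightarrow> measurable4 (\<lambda>p q r s. F p q r s + G p q r s)"
  unfolding measurable4_def case_prod_beta by (rule borel_measurable_add)

lemma integral4_rotate:
  assumes F: "measurable4 F"
  shows "integral4 (\<lambda>p q r s. F q r s p) = integral4 F"
proof -
  note m = measurable4_comp[OF F] measurable4_proj
  have "integral4 (\<lambda>p q r s. F q r s p) = integral4 (\<lambda>p q r s. F p r s q)"
    by (rule integral4_swap12) (intro m)
  also have "\<dots> = integral4 (\<lambda>p q r s. F p q s r)"
    by (rule integral4_swap23) (intro m)
  also have "\<dots> = integral4 F"
    by (rule integral4_swap34[OF F])
  finally show ?thesis .
qed

lemma integral4_reflect:
  assumes F: "measurable4 F"
  shows "integral4 (\<lambda>p q r s. F s r q p) = integral4 F"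
proof -
  note m = measurable4_comp[OF F] measurable4_proj
  have "integral4 (\<lambda>p q r s. F s r q p) = integral4 (\<lambda>p q r s. F s r p q)"
    by (rule integral4_swap12) (intro m)
  also have "\<dots> = integral4 (\<lambda>p q r s. F r s p q)"
    by (rule integral4_swap34) (intro m)
  also have "\<dots> = integral4 (\<lambda>p q r s. F q r s p)"
    by (rule integral4_rotate) (intro m)
  also have "\<dots> = integral4 F"
    by (rule integral4_rotate[OF F])
  finally show ?thesis .
qed

text \<open>The eight argument orders are the symmetries of the square \<open>p q r s\<close>; as
  the points are independent and equally distributed, all terms have the same integral.\<close>

lemma integral4_dihedral:
  assumes F: "measurable4 F"
  shows "integral4 (\<lambda>p q r s. F p q r s + F q r s p + F r s p q + F s p q r
      + F s r q p + F r q p s + F q p s r + F p s r q) = 8 * integral4 F"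
proof -
  note m = measurable4_comp[OF F] measurable4_proj
  have "integral4 (\<lambda>p q r s. F q r s p) = integral4 F"
    by (rule integral4_rotate[OF F])
  moreover have "integral4 (\<lambda>p q r s. F r s p q) = integral4 (\<lambda>p q r s. F q r s p)"
    by (rule integral4_rotate) (intro m)
  moreover have "integral4 (\<lambda>p q r s. F s p q r) = integral4 (\<lambda>p q r s. F r s p q)"
    by (rule integral4_rotate) (intro m)
  moreover have "integral4 (\<lambda>p q r s. F s r q p) = integral4 F"
    by (rule integral4_reflect[OF F])
  moreover have "integral4 (\<lambda>p q r s. F r q p s) = integral4 (\<lambda>p q r s. F q r s p)"
    by (rule integral4_reflect) (intro m)
  moreover have "integral4 (\<lambda>p q r s. F q p s r) = integral4 (\<lambda>p q r s. F r s p q)"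
    by (rule integral4_reflect) (intro m)
  moreover have "integral4 (\<lambda>p q r s. F p s r q) = integral4 (\<lambda>p q r s. F s p q r)"
    by (rule integral4_reflect) (intro m)
  moreover have "integral4 (\<lambda>p q r s. F p q r s + F q r s p + F r s p q + F s p q r
      + F s r q p + F r q p s + F q p s r + F p s r q)
    = integral4 (\<lambda>p q r s. F p q r s) + integral4 (\<lambda>p q r s. F q r s p) + integral4 (\<lambda>p q r s. F r s p q)
      + integral4 (\<lambda>p q r s. F s p q r) + integral4 (\<lambda>p q r s. F s r q p) + integral4 (\<lambda>p q r s. F r q p s)
      + integral4 (\<lambda>p q r s. F q p s r) + integral4 (\<lambda>p q r s. F p s r q)"
    by (subst integral4_add, (intro measurable4_add m)+)+ (rule refl)
  moreover have "8 * x = x + x + x + x + x + x + x + x" for x :: ennreal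
  proof -
    have "(8 :: ennreal) = 1 + 1 + 1 + 1 + 1 + 1 + 1 + 1" by simp
    then show ?thesis by (simp only: distrib_right mult_1)
  qed
  ultimately show ?thesis by simp
qed

section \<open>Ties between distances and the decomposition into chambers\<close>

lemma circle_dist_measurable [measurable]:
  assumes [measurable]: "f \<in> borel_measurable M" "g \<in> borel_measurable M"
  shows "(\<lambda>x. circle_dist (f x) (g x)) \<in> borel_measurable M"
  unfolding circle_dist_def by measurable

lemma finite_circle_dist_eq: "finite {x. circle_dist a x = t}"
proof (rule finite_subset)
  show "{x. circle_dist a x = t} \<subseteq> {a + t, a - t, a + (2 * pi - t), a - (2 * pi - t)}"
    by (auto simp: circle_dist_def min_def split: if_splits)
qed simp

text \<open>The points equidistant from \<open>a\<close> and \<open>b\<close> are the midpoints of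
  the two arcs between them. For \<open>a = b\<close> every point would qualify, which is why ties
  between adjacent edges require care.\<close>

lemma finite_circle_dist_eq':
  assumes "a \<in> circle" "b \<in> circle" "a \<noteq> b"
  shows "finite {x \<in> circle. circle_dist a x = circle_dist x b}"
proof (rule finite_subset)
  show "{x \<in> circle. circle_dist a x = circle_dist x b}
      \<subseteq> {(a + b) / 2, (a + b) / 2 + pi, (a + b) / 2 - pi}"
  proof safe
    fix x assume x: "x \<in> circle" "circle_dist a x = circle_dist x b" "x \<noteq> (a + b) / 2" "x \<noteq> (a + b) / 2 + pi"
    have "circle_dist y z = y - z \<or> circle_dist y z = z - y \<or> circle_dist y z = 2 * pi - (y - z)
        \<or> circle_dist y z = 2 * pi - (z - y)" for y z
      by (auto simp: circle_dist_def min_def)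
    from this[of a x] this[of x b] x assms
    have "x = (a + b) / 2 \<or> x = (a + b) / 2 + pi \<or> x = (a + b) / 2 - pi"
      unfolding circle_def atLeastLessThan_iff by argo
    with x show "x = (a + b) / 2 - pi" by blast
  qed
qed simp

text \<open>\<open>h\<close> is a test function on the plane, in the end the indicator of a set of
  bars; this is the contribution of one four-cycle to its expectation.\<close>

definition cycle_term :: "(real \<times> real \<Rightarrow> ennreal) \<Rightarrow> real \<Rightarrow> real \<Rightarrow> real \<Rightarrow> real \<Rightarrow> ennreal" where
  "cycle_term h p q r s = (if cycle_birth p q r s < cycle_death p q r s
     then h (cycle_birth p q r s, cycle_death p q r s) else 0)"

definition chamber_term :: "(real \<times> real \<Rightarrow> ennreal) \<Rightarrow> real \<Rightarrow> real \<Rightarrow> real \<Rightarrow> real \<Rightarrow> real \<Rightarrow> real \<Rightarrow> ennreal" where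
  "chamber_term h e a b c f g = (if a < e \<and> b < e \<and> c < e \<and> e < f \<and> f < g then h (e, f) else 0)"

text \<open>The part of \<open>cycle_term\<close> on which \<open>pq\<close> is the longest edge and \<open>qs\<close> the shorter diagonal.\<close>

definition cycle_chamber :: "(real \<times> real \<Rightarrow> ennreal) \<Rightarrow> real \<Rightarrow> real \<Rightarrow> real \<Rightarrow> real \<Rightarrow> ennreal" where
  "cycle_chamber h p q r s = chamber_term h (circle_dist p q) (circle_dist q r) (circle_dist r s)
     (circle_dist s p) (circle_dist q s) (circle_dist p r)"

lemma measurable4_cycle_term:
  assumes [measurable]: "h \<in> borel_measurable (borel \<Otimes>\<^sub>M borel)"
  shows "measurable4 (cycle_term h)"
  unfolding measurable4_def case_prod_beta cycle_term_def cycle_birth_def cycle_death_def by measurable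

lemma measurable4_cycle_chamber:
  assumes [measurable]: "h \<in> borel_measurable (borel \<Otimes>\<^sub>M borel)"
  shows "measurable4 (cycle_chamber h)"
  unfolding measurable4_def case_prod_beta cycle_chamber_def chamber_term_def by measurable

text \<open>With all ties excluded, the longest edge (four choices) and the shorter diagonal (two
  choices) are determined, so at most one of the eight terms survives, and it agrees with the left
  side.\<close>

lemma sum_chambers:
  fixes e1 e2 e3 e4 f1 f2 :: real and h :: "real \<times> real \<Rightarrow> ennreal"
  assumes "e1 \<noteq> e2" "e1 \<noteq> e3" "e1 \<noteq> e4" "e2 \<noteq> e3" "e2 \<noteq> e4" "e3 \<noteq> e4" "f1 \<noteq> f2"
  shows "(if max (max e1 e2) (max e3 e4) < min f1 f2 then h (max (max e1 e2) (max e3 e4), min f1 f2) else 0)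
    = chamber_term h e1 e2 e3 e4 f2 f1 + chamber_term h e2 e3 e4 e1 f1 f2 + chamber_term h e3 e4 e1 e2 f2 f1 + chamber_term h e4 e1 e2 e3 f1 f2
      + chamber_term h e3 e2 e1 e4 f1 f2 + chamber_term h e2 e1 e4 e3 f2 f1 + chamber_term h e1 e4 e3 e2 f1 f2 + chamber_term h e4 e3 e2 e1 f2 f1"
proof -
  have f: "f1 < f2 \<or> f2 < f1" using assms(7) by auto
  consider "e2 < e1" "e3 < e1" "e4 < e1" | "e1 < e2" "e3 < e2" "e4 < e2"
    | "e1 < e3" "e2 < e3" "e4 < e3" | "e1 < e4" "e2 < e4" "e3 < e4"
    using assms(1-6) by linarith
  then show ?thesis
  proof cases
    case 1
    then have "max (max e1 e2) (max e3 e4) = e1" by auto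
    with f 1 show ?thesis unfolding chamber_term_def by (elim disjE) simp_all
  next
    case 2
    then have "max (max e1 e2) (max e3 e4) = e2" by auto
    with f 2 show ?thesis unfolding chamber_term_def by (elim disjE) simp_all
  next
    case 3
    then have "max (max e1 e2) (max e3 e4) = e3" by auto
    with f 3 show ?thesis unfolding chamber_term_def by (elim disjE) simp_all
  next
    case 4
    then have "max (max e1 e2) (max e3 e4) = e4" by auto
    with f 4 show ?thesis unfolding chamber_term_def by (elim disjE) simp_all
  qed
qed

lemma integral4_cycle_term:
  assumes h: "h \<in> borel_measurable (borel \<Otimes>\<^sub>M borel)"
  shows "integral4 (cycle_term h) = 8 * integral4 (cycle_chamber h)"
proof -
  let ?A = "cycle_chamber h"
  have "integral4 (cycle_term h) = integral4 (\<lambda>p q r s. ?A p q r s + ?A q r s p + ?A r s p q + ?A s p q r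
      + ?A s r q p + ?A r q p s + ?A q p s r + ?A p s r q)"
  proof (rule integral4_cong_AE)
    fix p q
    \<comment> \<open>The tie between \<open>pq\<close> and \<open>qr\<close> does not involve
      \<open>s\<close> and is excluded when \<open>r\<close> is chosen. The condition that
      \<open>r\<close> differs from \<open>p\<close> makes the tie between \<open>rs\<close> and
      \<open>sp\<close> a finite set of \<open>s\<close>.\<close>
    show "finite (insert p {r. circle_dist q r = circle_dist p q})"
      using finite_circle_dist_eq by simp
    fix r
    assume pqr: "p \<in> circle" "q \<in> circle" "r \<in> circle" "r \<notin> insert p {r. circle_dist q r = circle_dist p q}"
    have "finite ({s. circle_dist r s = circle_dist p q} \<union> {s. circle_dist r s = circle_dist q r}
      \<union> {s. circle_dist p s = circle_dist p q} \<union> {s. circle_dist p s = circle_dist q r}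
      \<union> {s \<in> circle. circle_dist r s = circle_dist s p} \<union> {s. circle_dist q s = circle_dist p r})" (is "finite ?X")
      using finite_circle_dist_eq finite_circle_dist_eq'[of r p] pqr by auto
    from AE_uniform_circle_neq[OF this] AE_uniform_circle
    show "AE s in uniform_circle. cycle_term h p q r s = ?A p q r s + ?A q r s p + ?A r s p q + ?A s p q r
      + ?A s r q p + ?A r q p s + ?A q p s r + ?A p s r q"
    proof eventually_elim
      case (elim s)
      have "circle_dist p q \<noteq> circle_dist q r" using pqr(4) by auto
      moreover have "circle_dist p q \<noteq> circle_dist r s" "circle_dist p q \<noteq> circle_dist s p"
        "circle_dist q r \<noteq> circle_dist r s" "circle_dist q r \<noteq> circle_dist s p"
        "circle_dist r s \<noteq> circle_dist s p" "circle_dist p r \<noteq> circle_dist q s"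
        using elim circle_dist_commute[of p s] by auto
      ultimately show ?case
        unfolding cycle_term_def cycle_birth_def cycle_death_def cycle_chamber_def
        by (subst sum_chambers) (simp_all only: circle_dist_commute not_False_eq_True)
    qed
  qed
  also have "\<dots> = 8 * integral4 ?A"
    by (rule integral4_dihedral[OF measurable4_cycle_chamber[OF h]])
  finally show ?thesis .
qed

lemma integral4_three_cycles:
  assumes h: "h \<in> borel_measurable (borel \<Otimes>\<^sub>M borel)"
  shows "integral4 (\<lambda>p q r s. cycle_term h p q r s + cycle_term h p r q s + cycle_term h p q s r)
    = 24 * integral4 (cycle_chamber h)"
proof -
  note H = measurable4_cycle_term[OF h]
  note m = measurable4_add measurable4_comp[OF H] measurable4_proj
  have "integral4 (\<lambda>p q r s. cycle_term h p q r s + cycle_term h p r q s + cycle_term h p q s r)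
    = integral4 (\<lambda>p q r s. cycle_term h p q r s) + integral4 (\<lambda>p q r s. cycle_term h p r q s)
      + integral4 (\<lambda>p q r s. cycle_term h p q s r)"
    by (subst integral4_add, (intro m)+)+ (rule refl)
  also have "\<dots> = integral4 (cycle_term h) + integral4 (cycle_term h) + integral4 (cycle_term h)"
    unfolding integral4_swap23[OF H] integral4_swap34[OF H] ..
  also have "\<dots> = 24 * integral4 (cycle_chamber h)"
    unfolding integral4_cycle_term[OF h] by (simp only: distrib_right[symmetric]) simp
  finally show ?thesis .
qed

section \<open>The density of the bar\<close>

text \<open>The distance from \<open>t\<close> to the nearest multiple of \<open>2 * pi\<close>.
  Unlike the formula of \<open>circle_dist\<close> it is periodic, so it may be applied to arbitrary
  differences of angles.\<close>

definition circle_norm :: "real \<Rightarrow> real" where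
  "circle_norm t = arccos (cos t)"

lemma circle_norm_small: "\<bar>t\<bar> \<le> pi \<Longrightarrow> circle_norm t = \<bar>t\<bar>"
  using arccos_cos[of "\<bar>t\<bar>"] by (simp add: circle_norm_def)

lemma circle_norm_minus: "circle_norm (- t) = circle_norm t"
  by (simp add: circle_norm_def)

lemma circle_norm_minus_commute: "circle_norm (x - y) = circle_norm (y - x)"
  using circle_norm_minus[of "x - y"] by simp

lemma circle_norm_periodic: "circle_norm (t + 2 * pi) = circle_norm t"
  by (simp add: circle_norm_def)

lemma circle_norm_eq:
  assumes "\<bar>t\<bar> \<le> 2 * pi"
  shows "circle_norm t = min \<bar>t\<bar> (2 * pi - \<bar>t\<bar>)"
proof (cases "\<bar>t\<bar> \<le> pi")
  case True
  then show ?thesis by (simp add: circle_norm_small)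
next
  case False
  have "circle_norm t = circle_norm \<bar>t\<bar>" by (simp add: abs_if circle_norm_minus)
  also have "\<dots> = circle_norm (\<bar>t\<bar> - 2 * pi)" using circle_norm_periodic[of "\<bar>t\<bar> - 2 * pi"] by simp
  also have "\<dots> = 2 * pi - \<bar>t\<bar>" using False assms by (subst circle_norm_small) auto
  finally show ?thesis using False by simp
qed

lemma circle_dist_eq_norm: "x \<in> circle \<Longrightarrow> y \<in> circle \<Longrightarrow> circle_dist x y = circle_norm (x - y)"
  by (subst circle_norm_eq) (auto simp: circle_def circle_dist_def)

lemma circle_norm_measurable [measurable]: "circle_norm \<in> borel_measurable borel"
  unfolding circle_norm_def by (intro borel_measurable_continuous_onI continuous_intros) auto

text \<open>The piece over \<open>[a, 0)\<close> is moved by one period. The bounds on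
  \<open>a\<close> admit both starting points used below, \<open>-q\<close> and
  \<open>-pi\<close>.\<close>

lemma nn_integral_periodic:
  assumes F[measurable]: "F \<in> borel_measurable borel" and per: "\<And>x. F (x + 2 * pi) = F x"
    and a: "- (2 * pi) \<le> a" "a \<le> 0"
  shows "(\<integral>\<^sup>+x. F x * indicator {a..<a + 2 * pi} x \<partial>lborel) = (\<integral>\<^sup>+x. F x * indicator {0..<2 * pi} x \<partial>lborel)"
proof -
  have "(\<integral>\<^sup>+x. F x * indicator {a..<a + 2 * pi} x \<partial>lborel)
      = (\<integral>\<^sup>+x. F x * indicator {a..<0} x + F x * indicator {0..<a + 2 * pi} x \<partial>lborel)"
    using a by (intro nn_integral_cong) (auto simp: indicator_def)
  also have "\<dots> = (\<integral>\<^sup>+x. F x * indicator {a..<0} x \<partial>lborel) + (\<integral>\<^sup>+x. F x * indicator {0..<a + 2 * pi} x \<partial>lborel)"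
    by (rule nn_integral_add) auto
  also have "(\<integral>\<^sup>+x. F x * indicator {a..<0} x \<partial>lborel) = (\<integral>\<^sup>+x. F x * indicator {a + 2 * pi..<2 * pi} x \<partial>lborel)"
  proof -
    have "F (x - 2 * pi) = F x" for x using per[of "x - 2 * pi"] by simp
    then show ?thesis
      by (subst nn_integral_real_affine[where c = 1 and t = "- 2 * pi"])
         (auto intro!: nn_integral_cong simp: indicator_def)
  qed
  also have "\<dots> + (\<integral>\<^sup>+x. F x * indicator {0..<a + 2 * pi} x \<partial>lborel)
      = (\<integral>\<^sup>+x. F x * indicator {a + 2 * pi..<2 * pi} x + F x * indicator {0..<a + 2 * pi} x \<partial>lborel)"
    by (rule nn_integral_add[symmetric]) auto
  also have "\<dots> = (\<integral>\<^sup>+x. F x * indicator {0..<2 * pi} x \<partial>lborel)"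
    using a by (intro nn_integral_cong) (auto simp: indicator_def)
  finally show ?thesis .
qed

text \<open>Rotation invariance of the uniform law. The window \<open>[-pi, pi)\<close> is chosen
  because \<open>circle_norm\<close> is the absolute value there.\<close>

lemma nn_integral_uniform_circle_shift:
  assumes F[measurable]: "F \<in> borel_measurable borel" and per: "\<And>x. F (x + 2 * pi) = F x"
    and q: "q \<in> circle"
  shows "(\<integral>\<^sup>+x. F (x - q) \<partial>uniform_circle)
    = (\<integral>\<^sup>+x. F x * indicator {-pi..<pi} x \<partial>lborel) / ennreal (2 * pi)"
proof -
  have "(\<integral>\<^sup>+x. F (x - q) * indicator circle x \<partial>lborel) = (\<integral>\<^sup>+x. F x * indicator {-q..<-q + 2 * pi} x \<partial>lborel)"
    by (subst nn_integral_real_affine[where c = 1 and t = q])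
       (auto intro!: nn_integral_cong simp: indicator_def circle_def)
  also have "\<dots> = (\<integral>\<^sup>+x. F x * indicator {0..<2 * pi} x \<partial>lborel)"
    using q by (intro nn_integral_periodic F per) (auto simp: circle_def)
  also have "\<dots> = (\<integral>\<^sup>+x. F x * indicator {-pi..<-pi + 2 * pi} x \<partial>lborel)"
    by (intro nn_integral_periodic[symmetric] F per) auto
  finally show ?thesis
    by (subst nn_integral_uniform_circle) simp_all
qed

text \<open>The positions of \<open>p\<close>, \<open>s\<close>, \<open>r\<close> relative to
  \<open>q\<close>. \<open>R\<close> comes last because it is integrated first, while
  \<open>P\<close> and \<open>S\<close>, and with them birth and death, stay fixed.\<close>

definition angle_chamber :: "(real \<times> real \<Rightarrow> ennreal) \<Rightarrow> real \<Rightarrow> real \<Rightarrow> real \<Rightarrow> ennreal" where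
  "angle_chamber h P S R =
     chamber_term h (circle_norm P) (circle_norm R) (circle_norm (R - S)) (circle_norm (S - P)) (circle_norm S) (circle_norm (P - R))"

lemma cycle_chamber_angles:
  assumes "p \<in> circle" "q \<in> circle" "r \<in> circle" "s \<in> circle"
  shows "cycle_chamber h p q r s = angle_chamber h (p - q) (s - q) (r - q)"
  unfolding cycle_chamber_def angle_chamber_def using assms
  by (simp add: circle_dist_eq_norm circle_norm_minus_commute[of q r] circle_norm_minus_commute[of q s])

lemma angle_chamber_measurable:
  assumes [measurable]: "h \<in> borel_measurable (borel \<Otimes>\<^sub>M borel)"
    "f \<in> borel_measurable M" "g \<in> borel_measurable M" "k \<in> borel_measurable M"
  shows "(\<lambda>x. angle_chamber h (f x) (g x) (k x)) \<in> borel_measurable M"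
  unfolding angle_chamber_def chamber_term_def by measurable

lemma angle_chamber_periodic:
  "angle_chamber h (P + 2 * pi) S R = angle_chamber h P S R"
  "angle_chamber h P (S + 2 * pi) R = angle_chamber h P S R"
  "angle_chamber h P S (R + 2 * pi) = angle_chamber h P S R"
proof -
  have "circle_norm (x + 2 * pi - y) = circle_norm (x - y)" "circle_norm (x - (y + 2 * pi)) = circle_norm (x - y)" for x y
    using circle_norm_periodic[of "x - y"] circle_norm_periodic[of "x - y - 2 * pi"] by (simp_all add: algebra_simps)
  then show "angle_chamber h (P + 2 * pi) S R = angle_chamber h P S R"
    "angle_chamber h P (S + 2 * pi) R = angle_chamber h P S R"
    "angle_chamber h P S (R + 2 * pi) = angle_chamber h P S R"
    by (simp_all add: angle_chamber_def circle_norm_periodic)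
qed

lemma integral4_angle_chamber:
  assumes h: "h \<in> borel_measurable (borel \<Otimes>\<^sub>M borel)"
  shows "integral4 (cycle_chamber h) =
    (\<integral>\<^sup>+P. (\<integral>\<^sup>+S. (\<integral>\<^sup>+R. angle_chamber h P S R * indicator {-pi..<pi} R \<partial>lborel)
        * indicator {-pi..<pi} S \<partial>lborel) * indicator {-pi..<pi} P \<partial>lborel)
      / ennreal (2 * pi) / ennreal (2 * pi) / ennreal (2 * pi)"
proof -
  note F = measurable4_cycle_chamber[OF h]
  note [measurable] = angle_chamber_measurable[OF h]
  let ?c = "ennreal (2 * pi)"
  define G where "G P S = (\<integral>\<^sup>+R. angle_chamber h P S R * indicator {-pi..<pi} R \<partial>lborel)" for P S
  define H where "H P = (\<integral>\<^sup>+S. G P S * indicator {-pi..<pi} S \<partial>lborel)" for P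
  define I where "I = (\<integral>\<^sup>+P. H P * indicator {-pi..<pi} P \<partial>lborel)"
  have G[measurable]: "(\<lambda>x. G (f x) (g x)) \<in> borel_measurable M"
    if [measurable]: "f \<in> borel_measurable M" "g \<in> borel_measurable M" for f g and M :: "'z measure"
    unfolding G_def by measurable
  have H[measurable]: "H \<in> borel_measurable borel"
    unfolding H_def by measurable
  have per: "G (P + 2 * pi) S = G P S" "G P (S + 2 * pi) = G P S" "H (P + 2 * pi) = H P" for P S
    by (simp_all add: G_def H_def angle_chamber_periodic)
  \<comment> \<open>The variables are reordered to \<open>q, p, s, r\<close>: \<open>q\<close>
    outermost, to be rotated away, and \<open>r\<close> innermost.\<close>
  have "integral4 (cycle_chamber h) = integral4 (\<lambda>p q r s. cycle_chamber h p q s r)"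
    by (rule integral4_swap34[symmetric, OF F])
  also have "\<dots> = integral4 (\<lambda>p q r s. cycle_chamber h q p s r)"
    by (rule integral4_swap12[symmetric]) (intro measurable4_comp[OF F] measurable4_proj)
  also have "\<dots> = integral4 (\<lambda>q p s r. angle_chamber h (p - q) (s - q) (r - q))"
  proof (rule integral4_cong_AE[where X = "\<lambda>_ _. {}"])
    fix q p s assume "q \<in> circle" "p \<in> circle" "s \<in> circle"
    then show "AE r in uniform_circle. cycle_chamber h p q r s = angle_chamber h (p - q) (s - q) (r - q)"
      using AE_uniform_circle by (auto elim!: eventually_mono simp: cycle_chamber_angles)
  qed simp
  also have "\<dots> = (\<integral>\<^sup>+q. I / ?c / ?c / ?c \<partial>uniform_circle)"
    unfolding integral4_def
  proof (rule nn_integral_cong_AE, use AE_uniform_circle in eventually_elim)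
    case (elim q)
    have 1: "(\<integral>\<^sup>+r. angle_chamber h P S (r - q) \<partial>uniform_circle) = G P S / ?c" for P S
      unfolding G_def by (rule nn_integral_uniform_circle_shift[OF _ _ elim]) (simp_all add: angle_chamber_periodic)
    have "(\<integral>\<^sup>+s. G P (s - q) \<partial>uniform_circle) = H P / ?c" for P
      unfolding H_def by (rule nn_integral_uniform_circle_shift[OF _ _ elim]) (simp_all add: per)
    then have 2: "(\<integral>\<^sup>+s. G P (s - q) / ?c \<partial>uniform_circle) = H P / ?c / ?c" for P
      by (subst nn_integral_divide) simp_all
    have "(\<integral>\<^sup>+p. H (p - q) \<partial>uniform_circle) = I / ?c"
      unfolding I_def by (rule nn_integral_uniform_circle_shift[OF _ _ elim]) (simp_all add: per)
    then have "(\<integral>\<^sup>+p. H (p - q) / ?c / ?c \<partial>uniform_circle) = I / ?c / ?c / ?c"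
      by (subst nn_integral_divide, simp, subst nn_integral_divide) simp_all
    then show ?case unfolding 1 2 .
  qed
  also have "\<dots> = I / ?c / ?c / ?c"
    using uniform_circle.emeasure_space_1 by simp
  finally show ?thesis by (simp only: I_def H_def G_def)
qed

text \<open>Suppose \<open>P\<close> and \<open>S\<close> had the same sign, so that
  \<open>p\<close> lies on the short arc \<open>qs\<close>. If \<open>r\<close> lies there too,
  \<open>pr\<close> is at most \<open>qs\<close>; if not, \<open>pr\<close> longer than
  \<open>qs\<close> makes \<open>rs\<close> at least as long as \<open>pq\<close>. So
  \<open>p\<close> and \<open>s\<close> lie on opposite sides of \<open>q\<close>.

  For positive \<open>S\<close>, the lower bound on \<open>R\<close> says that \<open>rs\<close> is
  shorter than \<open>pq\<close>, and the upper bound that the arc from \<open>r\<close> to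
  \<open>p\<close> through \<open>s\<close> is longer than \<open>qs\<close>. The condition
  \<open>2 * pi < 2 * |P| + |S|\<close> says that \<open>sp\<close> is shorter than
  \<open>pq\<close>; the other inequalities follow. Negative \<open>S\<close> is the mirror
  image.\<close>

lemma angle_slice_iff:
  assumes "-pi \<le> P" "P < pi" "-pi \<le> S" "S < pi" "-pi \<le> R" "R < pi"
  shows "(circle_norm R < circle_norm P \<and> circle_norm (R - S) < circle_norm P \<and> circle_norm (S - P) < circle_norm P \<and> circle_norm P < circle_norm S \<and> circle_norm S < circle_norm (P - R))
    \<longleftrightarrow> (P * S < 0 \<and> \<bar>P\<bar> < \<bar>S\<bar> \<and> 2 * pi < 2 * \<bar>P\<bar> + \<bar>S\<bar>) \<and>
      (if 0 < S then \<bar>S\<bar> - \<bar>P\<bar> < R \<and> R < 2 * pi - \<bar>S\<bar> - \<bar>P\<bar>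
       else \<bar>S\<bar> - \<bar>P\<bar> < - R \<and> - R < 2 * pi - \<bar>S\<bar> - \<bar>P\<bar>)"
proof -
  have 1: "circle_norm P = \<bar>P\<bar>" "circle_norm S = \<bar>S\<bar>" "circle_norm R = \<bar>R\<bar>"
    "circle_norm (R - S) = min \<bar>R - S\<bar> (2 * pi - \<bar>R - S\<bar>)"
    "circle_norm (S - P) = min \<bar>S - P\<bar> (2 * pi - \<bar>S - P\<bar>)"
    "circle_norm (P - R) = min \<bar>P - R\<bar> (2 * pi - \<bar>P - R\<bar>)"
    using assms by (auto intro!: circle_norm_small circle_norm_eq)
  have 2: "\<bar>y\<bar> < x \<longleftrightarrow> y < x \<and> - y < x" "x < \<bar>y\<bar> \<longleftrightarrow> x < y \<or> x < - y"
    "2 * pi - \<bar>y\<bar> < x \<longleftrightarrow> 2 * pi - x < y \<or> 2 * pi - x < - y"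
    "x < 2 * pi - \<bar>y\<bar> \<longleftrightarrow> y < 2 * pi - x \<and> - y < 2 * pi - x" for x y :: real
    by auto
  note 3 = 1(4-6) min_less_iff_conj min_less_iff_disj 2
  consider "P = 0 \<or> S = 0" | "0 < P" "0 < S" | "P < 0" "S < 0" | "0 < P" "S < 0" | "P < 0" "0 < S"
    by linarith
  then show ?thesis
  proof cases
    case 1
    with assms show ?thesis unfolding \<open>circle_norm P = _\<close> \<open>circle_norm S = _\<close> \<open>circle_norm R = _\<close> by auto
  next
    case signs: 2
    then have *: "\<not> P * S < 0" by (simp add: mult_less_0_iff)
    have abs: "\<bar>P\<bar> = P" "\<bar>S\<bar> = S" using signs by auto
    show ?thesis unfolding 1(1-3) abs 3
      using * signs assms by argo
  next
    case signs: 3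
    then have *: "\<not> P * S < 0" by (simp add: mult_less_0_iff)
    have abs: "\<bar>P\<bar> = - P" "\<bar>S\<bar> = - S" using signs by auto
    show ?thesis unfolding 1(1-3) abs 3
      using * signs assms by argo
  next
    case signs: 4
    then have *: "P * S < 0" by (simp add: mult_less_0_iff)
    have abs: "\<bar>P\<bar> = P" "\<bar>S\<bar> = - S" using signs by auto
    show ?thesis unfolding 1(1-3) abs 3
      using * signs assms by argo
  next
    case signs: 5
    then have *: "P * S < 0" by (simp add: mult_less_0_iff)
    have abs: "\<bar>P\<bar> = - P" "\<bar>S\<bar> = S" using signs by auto
    show ?thesis unfolding 1(1-3) abs 3
      using * signs assms by argo
  qed
qed

lemma angle_slice:
  assumes P: "-pi \<le> P" "P < pi" and S: "-pi \<le> S" "S < pi"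
  shows "(\<integral>\<^sup>+R. angle_chamber h P S R * indicator {-pi..<pi} R \<partial>lborel) =
    (if P * S < 0 \<and> \<bar>P\<bar> < \<bar>S\<bar> \<and> 2 * pi < 2 * \<bar>P\<bar> + \<bar>S\<bar> then ennreal (2 * (pi - \<bar>S\<bar>)) * h (\<bar>P\<bar>, \<bar>S\<bar>) else 0)"
proof -
  define J where "J = (if 0 < S then {\<bar>S\<bar> - \<bar>P\<bar><..<2 * pi - \<bar>S\<bar> - \<bar>P\<bar>}
    else {- (2 * pi - \<bar>S\<bar> - \<bar>P\<bar>)<..<- (\<bar>S\<bar> - \<bar>P\<bar>)})"
  let ?good = "P * S < 0 \<and> \<bar>P\<bar> < \<bar>S\<bar> \<and> 2 * pi < 2 * \<bar>P\<bar> + \<bar>S\<bar>"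
  have norms: "circle_norm P = \<bar>P\<bar>" "circle_norm S = \<bar>S\<bar>"
    using P S by (auto intro!: circle_norm_small)
  have J: "R \<in> J \<longleftrightarrow> (if 0 < S then \<bar>S\<bar> - \<bar>P\<bar> < R \<and> R < 2 * pi - \<bar>S\<bar> - \<bar>P\<bar>
       else \<bar>S\<bar> - \<bar>P\<bar> < - R \<and> - R < 2 * pi - \<bar>S\<bar> - \<bar>P\<bar>)" for R
    by (auto simp: J_def)
  \<comment> \<open>The admissible arc stays inside the window, so its full length counts.\<close>
  have J_sub: "-pi \<le> R \<and> R < pi" if "?good" "R \<in> J" for R
    using that P S unfolding J_def by (auto split: if_splits)
  have eq: "angle_chamber h P S R * indicator {-pi..<pi} R = (if ?good then h (\<bar>P\<bar>, \<bar>S\<bar>) * indicator J R else 0)" for R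
  proof (cases "-pi \<le> R \<and> R < pi")
    case True
    with angle_slice_iff[OF P S, of R, folded J] show ?thesis
      unfolding angle_chamber_def chamber_term_def by (simp add: norms indicator_def)
  next
    case False
    then show ?thesis using J_sub[of R] by (auto simp: indicator_def)
  qed
  \<comment> \<open>\<open>(2 * pi - |S| - |P|) - (|S| - |P|) = 2 * (pi - |S|)\<close>: the position
    of \<open>p\<close> cancels.\<close>
  have emeasure_J: "emeasure lborel J = ennreal (2 * (pi - \<bar>S\<bar>))"
    using P S by (auto simp: J_def intro!: arg_cong[where f = ennreal])
  have sets_J: "J \<in> sets lborel" by (simp add: J_def)
  show ?thesis
  proof (cases "?good")
    case True
    show ?thesis
      unfolding eq if_P[OF True] nn_integral_cmult_indicator[OF sets_J] emeasure_J by (rule mult.commute)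
  next
    case False
    show ?thesis unfolding eq if_not_P[OF False] by simp
  qed
qed

section \<open>From angles to birth and death\<close>

definition bar_weight :: "(real \<times> real \<Rightarrow> ennreal) \<Rightarrow> real \<Rightarrow> real \<Rightarrow> ennreal" where
  "bar_weight h u v = (if u < v \<and> 2 * pi < 2 * u + v \<and> v \<le> pi then ennreal (2 * (pi - v)) * h (u, v) else 0)"

lemma bar_weight_measurable:
  assumes [measurable]: "h \<in> borel_measurable (borel \<Otimes>\<^sub>M borel)"
    "f \<in> borel_measurable M" "g \<in> borel_measurable M"
  shows "(\<lambda>x. bar_weight h (f x) (g x)) \<in> borel_measurable M"
  unfolding bar_weight_def by measurable

lemma nn_integral_reflect:
  fixes f :: "real \<Rightarrow> ennreal"
  assumes "f \<in> borel_measurable borel"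
  shows "(\<integral>\<^sup>+x. f (- x) \<partial>lborel) = (\<integral>\<^sup>+x. f x \<partial>lborel)"
  using nn_integral_real_affine[OF assms, of "-1" 0] by simp

text \<open>The sign of \<open>P\<close> forces the opposite sign of \<open>S\<close>. The two
  resulting configurations are mirror images with equal integrals, hence the factor 2.\<close>

lemma angle_integral:
  assumes h: "h \<in> borel_measurable (borel \<Otimes>\<^sub>M borel)"
  shows "(\<integral>\<^sup>+P. (\<integral>\<^sup>+S. (\<integral>\<^sup>+R. angle_chamber h P S R * indicator {-pi..<pi} R \<partial>lborel)
        * indicator {-pi..<pi} S \<partial>lborel) * indicator {-pi..<pi} P \<partial>lborel)
    = 2 * (\<integral>\<^sup>+u. \<integral>\<^sup>+v. bar_weight h u v \<partial>lborel \<partial>lborel)"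
proof -
  note [measurable] = bar_weight_measurable[OF h]
  define \<gamma> where "\<gamma> u = (\<integral>\<^sup>+v. bar_weight h u v \<partial>lborel)" for u
  have [measurable]: "\<gamma> \<in> borel_measurable borel" unfolding \<gamma>_def by measurable
  have \<gamma>0: "\<gamma> u = 0" if "u \<le> 0 \<or> pi \<le> u" for u
  proof -
    have "bar_weight h u v = 0" for v
      using that by (auto simp: bar_weight_def)
    then show ?thesis by (simp add: \<gamma>_def)
  qed
  have slice: "(\<integral>\<^sup>+R. angle_chamber h P S R * indicator {-pi..<pi} R \<partial>lborel) * indicator {-pi..<pi} S
      = (if P = 0 then 0 else if 0 < P then bar_weight h P (- S) else bar_weight h (- P) S)"
    if P: "-pi \<le> P" "P < pi" for P S
  proof (cases "-pi \<le> S \<and> S < pi")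
    case True
    then show ?thesis
      using P by (subst angle_slice) (auto simp: bar_weight_def mult_less_0_iff abs_if)
  next
    case False
    \<comment> \<open>The endpoint \<open>S = pi\<close> lies outside the half-open window, but the
      weight vanishes there through its factor \<open>pi - v\<close>.\<close>
    then have "S < -pi \<or> S = pi \<or> pi < S" by auto
    with P show ?thesis by (auto simp: bar_weight_def)
  qed
  have inner: "(\<integral>\<^sup>+S. (\<integral>\<^sup>+R. angle_chamber h P S R * indicator {-pi..<pi} R \<partial>lborel)
        * indicator {-pi..<pi} S \<partial>lborel) * indicator {-pi..<pi} P = \<gamma> P + \<gamma> (- P)" for P
  proof (cases "-pi \<le> P \<and> P < pi")
    case True
    consider "P = 0" | "0 < P" | "P < 0" by linarith
    then show ?thesis
    proof cases
      case 1
      then show ?thesis using True by (simp add: slice \<gamma>0)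
    next
      case 2
      have "(\<integral>\<^sup>+S. bar_weight h P (- S) \<partial>lborel) = \<gamma> P"
        unfolding \<gamma>_def by (rule nn_integral_reflect) measurable
      with 2 True show ?thesis by (simp add: slice \<gamma>0)
    next
      case 3
      then have "(\<integral>\<^sup>+S. bar_weight h (- P) S \<partial>lborel) = \<gamma> (- P)"
        unfolding \<gamma>_def by simp
      with 3 True show ?thesis by (simp add: slice \<gamma>0)
    qed
  next
    case False
    then show ?thesis by (subst (1 2) \<gamma>0) auto
  qed
  have "(\<integral>\<^sup>+P. \<gamma> P + \<gamma> (- P) \<partial>lborel) = (\<integral>\<^sup>+P. \<gamma> P \<partial>lborel) + (\<integral>\<^sup>+P. \<gamma> (- P) \<partial>lborel)"
    by (rule nn_integral_add) measurable
  also have "(\<integral>\<^sup>+P. \<gamma> (- P) \<partial>lborel) = (\<integral>\<^sup>+P. \<gamma> P \<partial>lborel)"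
    by (rule nn_integral_reflect) measurable
  finally show ?thesis unfolding inner by (simp add: \<gamma>_def mult_2)
qed

lemma indicator_bar_region:
  "indicator bar_region (u, v) = (if u < v \<and> v \<le> pi \<and> 2 * pi \<le> 2 * u + v then 1 else 0)"
  by (simp add: bar_region_def indicator_def)

lemma bar_region_measurable [measurable]: "bar_region \<in> sets (borel \<Otimes>\<^sub>M borel)"
proof -
  have "{z \<in> space (borel \<Otimes>\<^sub>M borel). fst z < snd z \<and> snd z \<le> pi \<and> 2 * pi \<le> 2 * fst z + snd z} \<in> sets (borel \<Otimes>\<^sub>M borel)"
    by measurable
  also have "{z \<in> space (borel \<Otimes>\<^sub>M borel). fst z < snd z \<and> snd z \<le> pi \<and> 2 * pi \<le> 2 * fst z + snd z} = bar_region"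
    by (auto simp: bar_region_def space_pair_measure)
  finally show ?thesis .
qed

lemma integral4_cycle_chamber:
  assumes h: "h \<in> borel_measurable (borel \<Otimes>\<^sub>M borel)"
  shows "24 * integral4 (cycle_chamber h) =
    (\<integral>\<^sup>+z. ennreal (12 / pi ^ 3 * (pi - snd z)) * indicator bar_region z * h z \<partial>lborel)"
proof -
  note [measurable] = bar_weight_measurable[OF h] h
  \<comment> \<open>\<open>24 * 2 / (2 * pi) ^ 3 = 6 / pi ^ 3\<close>; the factor
    \<open>2 * (pi - v)\<close> in \<open>bar_weight\<close> turns 6 into 12.\<close>
  let ?k = "ennreal (6 / pi ^ 3)"
  have "24 * integral4 (cycle_chamber h) =
      24 * (2 * (\<integral>\<^sup>+u. \<integral>\<^sup>+v. bar_weight h u v \<partial>lborel \<partial>lborel) / ennreal (2 * pi) / ennreal (2 * pi) / ennreal (2 * pi))"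
    unfolding integral4_angle_chamber[OF h] angle_integral[OF h] ..
  also have "\<dots> = ?k * (\<integral>\<^sup>+u. \<integral>\<^sup>+v. bar_weight h u v \<partial>lborel \<partial>lborel)"
  proof -
    have "24 * (2 * x / ennreal (2 * pi) / ennreal (2 * pi) / ennreal (2 * pi)) = ?k * x" for x
    proof -
      have inv: "inverse (ennreal (2 * pi)) = ennreal (inverse (2 * pi))"
        by (rule inverse_ennreal) simp
      have "24 * (2 * x / ennreal (2 * pi) / ennreal (2 * pi) / ennreal (2 * pi))
          = (ennreal 24 * ennreal 2 * ennreal (inverse (2 * pi)) * ennreal (inverse (2 * pi)) * ennreal (inverse (2 * pi))) * x"
        unfolding divide_ennreal_def inv by (simp add: mult_ac)
      also have "ennreal 24 * ennreal 2 * ennreal (inverse (2 * pi)) * ennreal (inverse (2 * pi)) * ennreal (inverse (2 * pi)) = ?k"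
        by (simp add: ennreal_mult[symmetric] field_simps power3_eq_cube del: ennreal_numeral)
      finally show ?thesis .
    qed
    then show ?thesis .
  qed
  also have "\<dots> = (\<integral>\<^sup>+u. \<integral>\<^sup>+v. ?k * bar_weight h u v \<partial>lborel \<partial>lborel)"
    by (simp add: nn_integral_cmult)
  also have "\<dots> = (\<integral>\<^sup>+u. \<integral>\<^sup>+v. ennreal (12 / pi ^ 3 * (pi - v)) * indicator bar_region (u, v) * h (u, v) \<partial>lborel \<partial>lborel)"
  proof (rule nn_integral_cong, rule nn_integral_cong_AE)
    fix u :: real
    \<comment> \<open>\<open>bar_region\<close> contains the line \<open>2 * u + v = 2 * pi\<close>
      and the chambers do not; for each \<open>u\<close> this concerns a single
      \<open>v\<close>.\<close>
    have "AE v in lborel. v \<noteq> 2 * pi - 2 * u" by (rule AE_lborel_singleton)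
    then show "AE v in lborel. ?k * bar_weight h u v = ennreal (12 / pi ^ 3 * (pi - v)) * indicator bar_region (u, v) * h (u, v)"
    proof eventually_elim
      case (elim v)
      have "?k * (ennreal (2 * (pi - v)) * y) = ennreal (12 / pi ^ 3 * (pi - v)) * y" if "v \<le> pi" for y
        using that by (simp add: mult.assoc[symmetric] ennreal_mult[symmetric])
      with elim show ?case by (auto simp: bar_weight_def indicator_bar_region)
    qed
  qed
  also have "\<dots> = (\<integral>\<^sup>+z. ennreal (12 / pi ^ 3 * (pi - snd z)) * indicator bar_region z * h z \<partial>(lborel \<Otimes>\<^sub>M lborel))"
    by (subst lborel.nn_integral_fst[symmetric]) simp_all
  finally show ?thesis by (simp add: lborel_prod)
qed

section \<open>Borel sets of the quotient plane\<close>

lemma plane_class_measurable [measurable]: "plane_class \<in> borel_measurable borel"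
proof (rule borel_measurable_continuous_onI)
  show "continuous_on UNIV plane_class"
    by (subst continuous_on_open_vimage) (simp_all add: open_plane_mod_diagonal_def)
qed

text \<open>At the collapsed point \<open>rep_plane_class\<close> picks some unspecified diagonal
  point. Fixing \<open>(0, 0)\<close> instead gives a section whose preimages can be described, and
  hence a way to define Borel functions on the quotient.\<close>

definition plane_rep :: "plane_mod_diagonal \<Rightarrow> real \<times> real" where
  "plane_rep x = (if x = diagonal_point then (0, 0) else rep_plane_class x)"

lemma plane_class_plane_rep: "plane_class (plane_rep x) = x"
  using Quotient_abs_rep[OF Quotient_plane_mod_diagonal, of x]
  by (simp add: plane_rep_def diagonal_point_def)

lemma plane_rep_plane_class: "plane_rep (plane_class z) = (if fst z = snd z then (0, 0) else z)"
proof (cases "fst z = snd z")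
  case True
  then have "plane_class z = diagonal_point" by (simp add: plane_class_diagonal_iff)
  with True show ?thesis by (simp add: plane_rep_def)
next
  case False
  with plane_class_plane_rep[of "plane_class z"] show ?thesis
    by (auto simp: plane_class_eq_iff)
qed

lemma open_off_diagonal: "open {z :: real \<times> real. fst z \<noteq> snd z}"
  by (intro open_Collect_neq continuous_intros)

lemma diagonal_point_borel [measurable]: "{diagonal_point} \<in> sets borel"
proof -
  have "plane_class -` (- {diagonal_point}) = {z. fst z \<noteq> snd z}"
    by (auto simp: plane_class_diagonal_iff)
  then have "open (- {diagonal_point})"
    using open_off_diagonal by (simp add: open_plane_mod_diagonal_def)
  then have "closed {diagonal_point}" by (simp add: closed_def)
  then show ?thesis by (rule borel_closed)
qed

text \<open>The off-diagonal part of an open set is open and saturated, so its image is open in the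
  quotient; the diagonal contributes at most one point, and that point is closed.\<close>

lemma plane_rep_measurable [measurable]: "plane_rep \<in> borel_measurable borel"
proof (rule borel_measurableI)
  fix S :: "(real \<times> real) set" assume S: "open S"
  let ?V = "plane_class ` (S \<inter> {z. fst z \<noteq> snd z})"
  have "plane_class -` ?V = S \<inter> {z. fst z \<noteq> snd z}"
    by (auto simp: plane_class_eq_iff)
  with S have "open ?V"
    using open_off_diagonal by (simp add: open_plane_mod_diagonal_def open_Int)
  moreover have "plane_rep -` S = ?V \<union> (if (0, 0) \<in> S then {diagonal_point} else {})"
  proof (intro equalityI subsetI)
    fix x assume x: "x \<in> plane_rep -` S"
    show "x \<in> ?V \<union> (if (0, 0) \<in> S then {diagonal_point} else {})"
    proof (cases "x = diagonal_point")
      case True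
      with x show ?thesis by (simp add: plane_rep_def)
    next
      case False
      with x plane_class_plane_rep[of x] plane_class_diagonal_iff[of "plane_rep x"]
      have "plane_rep x \<in> S \<inter> {z. fst z \<noteq> snd z}" by auto
      then have "plane_class (plane_rep x) \<in> ?V" by (rule imageI)
      then show ?thesis by (simp add: plane_class_plane_rep)
    qed
  next
    fix x assume "x \<in> ?V \<union> (if (0, 0) \<in> S then {diagonal_point} else {})"
    then show "x \<in> plane_rep -` S"
      using plane_rep_plane_class[of "(0, 0)"]
      by (auto simp: plane_rep_plane_class diagonal_point_def[symmetric] split: if_splits)
  qed
  ultimately have "plane_rep -` S \<in> sets borel"
    using sets.Un[OF borel_open diagonal_point_borel] by (simp only: borel_open Un_empty_right split: if_split) simp
  then show "plane_rep -` S \<inter> space borel \<in> sets borel" by simp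
qed

lemma emeasure_lebesgue_diagonal_point: "emeasure plane_mod_lebesgue {diagonal_point} = 0"
proof -
  have eq: "plane_class -` {diagonal_point} = {z. fst z = snd z}"
    by (auto simp: plane_class_diagonal_iff)
  have meas: "{z :: real \<times> real. fst z = snd z} \<in> sets (lborel \<Otimes>\<^sub>M lborel)"
  proof -
    have "{z :: real \<times> real. fst z = snd z} \<in> sets borel"
      by (intro borel_closed closed_Collect_eq continuous_intros)
    then show ?thesis unfolding lborel_prod by simp
  qed
  have "emeasure plane_mod_lebesgue {diagonal_point} = emeasure lborel {z :: real \<times> real. fst z = snd z}"
    unfolding plane_mod_lebesgue_def by (subst emeasure_distr) (simp_all add: eq)
  also have "\<dots> = (\<integral>\<^sup>+x. emeasure lborel (Pair x -` {z :: real \<times> real. fst z = snd z}) \<partial>lborel)"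
    using lborel.emeasure_pair_measure_alt[OF meas] by (simp add: lborel_prod)
  also have "\<dots> = 0"
  proof -
    have "Pair x -` {z :: real \<times> real. fst z = snd z} = {x}" for x by auto
    then show ?thesis by simp
  qed
  finally show ?thesis .
qed

section \<open>The persistence measure\<close>

lemma space_circle_measure4: "space circle_measure4 = (\<Pi>\<^sub>E i\<in>{1..4}. circle)"
  by (simp add: circle_measure4_def space_PiM space_circle_measure)

lemma cycle_bar_measurable [measurable]:
  assumes [measurable]: "f \<in> borel_measurable M" "g \<in> borel_measurable M" "h \<in> borel_measurable M" "k \<in> borel_measurable M"
  shows "(\<lambda>x. cycle_bar (f x) (g x) (h x) (k x)) \<in> borel_measurable M"
  unfolding cycle_bar_def cycle_birth_def cycle_death_def borel_prod[symmetric] by measurable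

lemma four_point_bar_measurable [measurable]:
  assumes [measurable]: "f \<in> borel_measurable M" "g \<in> borel_measurable M" "h \<in> borel_measurable M" "k \<in> borel_measurable M"
  shows "(\<lambda>x. four_point_bar (f x) (g x) (h x) (k x)) \<in> borel_measurable M"
  unfolding four_point_bar_def by measurable

lemma coordinate_measurable:
  assumes "i \<in> {1..4}"
  shows "(\<lambda>x. x i) \<in> borel_measurable circle_measure4"
proof -
  have "(\<lambda>x. x i) \<in> measurable circle_measure4 circle_measure"
    unfolding circle_measure4_def using assms by (rule measurable_component_singleton)
  from measurable_compose[OF this measurable_circle_measure[of "\<lambda>t. t"]] show ?thesis by simp
qed

lemma circle_vr_class_image:
  assumes "x \<in> space circle_measure4"
  shows "circle_vr_class F (x ` {1..4}) = plane_class (four_point_bar (x 1) (x 2) (x 3) (x 4))"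
proof -
  have "{1..4::nat} = {1, 2, 3, 4}" by auto
  then have "x ` {1..4} = {x 1, x 2, x 3, x 4}" by simp
  with assms show ?thesis
    by (auto simp: space_circle_measure4 PiE_iff intro!: circle_vr_class_eq)
qed

text \<open>Homology shows no measurability by itself; it becomes visible after the class is
  replaced by the explicit bar on the space of the product measure.\<close>

lemma circle_vr_class_measurable:
  "(\<lambda>x. circle_vr_class F (x ` {1..4})) \<in> measurable circle_measure4 borel"
proof -
  have [measurable]: "(\<lambda>x. x 1) \<in> borel_measurable circle_measure4" "(\<lambda>x. x 2) \<in> borel_measurable circle_measure4"
    "(\<lambda>x. x 3) \<in> borel_measurable circle_measure4" "(\<lambda>x. x 4) \<in> borel_measurable circle_measure4"
    by (auto intro!: coordinate_measurable)
  show ?thesis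
    by (subst measurable_cong[OF circle_vr_class_image]) measurable
qed

text \<open>The diagonals of one four-cycle are edges of any other. Two nonzero bars would give
  birth < death <= other birth < other death <= first birth. So at most one summand is nonzero, and
  \<open>h (0, 0) = 0\<close> turns the sum of bars into a sum of values of
  \<open>h\<close>.\<close>

lemma four_point_bar_cases:
  assumes "h (0, 0) = (0 :: ennreal)"
  shows "h (four_point_bar p q r s) = cycle_term h p q r s + cycle_term h p r q s + cycle_term h p q s r"
proof -
  have term_eq: "cycle_term h p q r s = h (cycle_bar p q r s)" for p q r s
    using assms by (simp add: cycle_term_def cycle_bar_def)
  have excl: "cycle_bar p q r s = (0, 0) \<or> cycle_bar p r q s = (0, 0)" for p q r s
    by (auto simp: cycle_bar_def cycle_birth_def cycle_death_def)
  have "cycle_bar p s r q = cycle_bar p q r s" "cycle_bar p r s q = cycle_bar p q s r"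
    "cycle_bar p s q r = cycle_bar p r q s"
    by (simp_all add: cycle_bar_dihedral)
  then have "cycle_bar p q r s = (0, 0) \<or> cycle_bar p r q s = (0, 0)"
    "cycle_bar p q r s = (0, 0) \<or> cycle_bar p q s r = (0, 0)"
    "cycle_bar p r q s = (0, 0) \<or> cycle_bar p q s r = (0, 0)"
    using excl[of p q r s] excl[of p s r q] excl[of p q s r] by auto
  then show ?thesis
    unfolding term_eq four_point_bar_def using assms by (auto simp flip: zero_prod_def)
qed

definition bar_density :: "plane_mod_diagonal \<Rightarrow> ennreal" where
  "bar_density x = ennreal (12 / pi ^ 3 * (pi - snd (plane_rep x))) * indicator bar_region (plane_rep x)"

lemma bar_density_measurable [measurable]: "bar_density \<in> borel_measurable borel"
proof -
  have "(\<lambda>z :: real \<times> real. ennreal (12 / pi ^ 3 * (pi - snd z)) * indicator bar_region z)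
      \<in> borel_measurable (borel \<Otimes>\<^sub>M borel)"
    by measurable
  from measurable_compose[OF plane_rep_measurable this[unfolded borel_prod]]
  show ?thesis unfolding bar_density_def .
qed

lemma bar_density_plane_class:
  "bar_density (plane_class z) = ennreal (12 / pi ^ 3 * (pi - snd z)) * indicator bar_region z"
  by (cases z) (auto simp: bar_density_def plane_rep_plane_class bar_region_def)

lemma emeasure_bar_density:
  assumes [measurable]: "A \<in> sets borel"
  shows "emeasure (density plane_mod_lebesgue bar_density) A
    = (\<integral>\<^sup>+z. ennreal (12 / pi ^ 3 * (pi - snd z)) * indicator bar_region z * indicator A (plane_class z) \<partial>lborel)"
proof -
  have "emeasure (density plane_mod_lebesgue bar_density) A = (\<integral>\<^sup>+x. bar_density x * indicator A x \<partial>plane_mod_lebesgue)"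
    by (rule emeasure_density) (simp_all add: plane_mod_lebesgue_def)
  also have "\<dots> = (\<integral>\<^sup>+z. bar_density (plane_class z) * indicator A (plane_class z) \<partial>lborel)"
    unfolding plane_mod_lebesgue_def by (rule nn_integral_distr) measurable
  finally show ?thesis unfolding bar_density_plane_class .
qed

text \<open>Here \<open>h\<close> is the indicator of \<open>A\<close> pulled back to the plane;
  that \<open>A\<close> avoids the collapsed point is exactly \<open>h (0, 0) = 0\<close>.\<close>

lemma emeasure_circle_U41:
  assumes A[measurable]: "A \<in> sets borel" and "diagonal_point \<notin> A"
  shows "emeasure (circle_U41 F) A = emeasure (density plane_mod_lebesgue bar_density) A"
proof -
  define h :: "real \<times> real \<Rightarrow> ennreal" where "h z = indicator A (plane_class z)" for z
  have h_borel[measurable]: "h \<in> borel_measurable borel" unfolding h_def by measurable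
  then have h: "h \<in> borel_measurable (borel \<Otimes>\<^sub>M borel)" unfolding borel_prod .
  have "plane_class (0, 0) \<notin> A" using assms(2) by (simp add: diagonal_point_def)
  then have h0: "h (0, 0) = 0" by (simp add: h_def)
  let ?c = "\<lambda>x. circle_vr_class F (x ` {1..4})"
  have "emeasure (circle_U41 F) A = (\<integral>\<^sup>+x. indicator A x \<partial>circle_U41 F)"
    by (simp add: circle_U41_def)
  also have "\<dots> = (\<integral>\<^sup>+x. indicator A (?c x) \<partial>circle_measure4)"
    unfolding circle_U41_def by (rule nn_integral_distr[OF circle_vr_class_measurable]) measurable
  also have "\<dots> = (\<integral>\<^sup>+x. h (four_point_bar (x 1) (x 2) (x 3) (x 4)) \<partial>circle_measure4)"
    by (intro nn_integral_cong) (simp only: circle_vr_class_image h_def)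
  also have "\<dots> = integral4 (\<lambda>p q r s. h (four_point_bar p q r s))"
  proof (rule nn_integral_circle_measure4)
    show "measurable4 (\<lambda>p q r s. h (four_point_bar p q r s))"
      unfolding measurable4_def case_prod_beta by measurable
  qed
  also have "\<dots> = 24 * integral4 (cycle_chamber h)"
    unfolding four_point_bar_cases[of h, OF h0] by (rule integral4_three_cycles[OF h])
  also have "\<dots> = emeasure (density plane_mod_lebesgue bar_density) A"
    unfolding integral4_cycle_chamber[OF h] emeasure_bar_density[OF A] h_def ..
  finally show ?thesis .
qed

text \<open>The density depends on the death time alone, so the birth time is integrated first and
  leaves a quadratic polynomial in \<open>v\<close>.\<close>

lemma total_bar_density:
  "(\<integral>\<^sup>+z. ennreal (12 / pi ^ 3 * (pi - snd z)) * indicator bar_region z \<partial>(lborel :: (real \<times> real) measure)) = ennreal (1 / 9)"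
proof -
  let ?g = "\<lambda>z :: real \<times> real. ennreal (12 / pi ^ 3 * (pi - snd z)) * indicator bar_region z"
  let ?f = "\<lambda>v. 12 / pi ^ 3 * ((pi - v) * (3 * v / 2 - pi))"
  have "(\<integral>\<^sup>+z. ?g z \<partial>lborel) = (\<integral>\<^sup>+v. \<integral>\<^sup>+u. ?g (u, v) \<partial>lborel \<partial>lborel)"
    unfolding lborel_prod[symmetric] by (rule lborel_pair.nn_integral_snd[symmetric]) simp
  also have "\<dots> = (\<integral>\<^sup>+v. ennreal (?f v) * indicator {2 * pi / 3..pi} v \<partial>lborel)"
  proof (rule nn_integral_cong)
    fix v :: real
    \<comment> \<open>The slice at height \<open>v\<close> is an interval of length
      \<open>3 * v / 2 - pi\<close>, which vanishes at the lower limit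
      \<open>2 * pi / 3\<close>.\<close>
    have ind: "(indicator bar_region (u, v) :: ennreal) = (if v \<le> pi then indicator {pi - v / 2..<v} u else 0)" for u
      by (auto simp: bar_region_def indicator_def)
    show "(\<integral>\<^sup>+u. ?g (u, v) \<partial>lborel) = ennreal (?f v) * indicator {2 * pi / 3..pi} v"
    proof (cases "2 * pi / 3 \<le> v \<and> v \<le> pi")
      case True
      then have "(\<integral>\<^sup>+u. ?g (u, v) \<partial>lborel) = ennreal (12 / pi ^ 3 * (pi - v)) * ennreal (v - (pi - v / 2))"
        unfolding ind by (simp add: nn_integral_cmult_indicator)
      also have "\<dots> = ennreal (12 / pi ^ 3 * (pi - v) * (v - (pi - v / 2)))"
        using True by (intro ennreal_mult[symmetric]) auto
      also have "12 / pi ^ 3 * (pi - v) * (v - (pi - v / 2)) = ?f v"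
        by (simp add: field_simps)
      finally show ?thesis using True by simp
    next
      case False
      then have "?g (u, v) = 0" for u
        unfolding ind by (auto simp: indicator_def)
      then have "(\<integral>\<^sup>+u. ?g (u, v) \<partial>lborel) = (\<integral>\<^sup>+u. 0 \<partial>(lborel :: real measure))"
        by (rule nn_integral_cong)
      also have "\<dots> = ennreal (?f v) * indicator {2 * pi / 3..pi} v"
        using False by (auto simp: indicator_def)
      finally show ?thesis .
    qed
  qed
  also have "\<dots> = ennreal (12 / pi ^ 3 * (5 * pi * pi ^ 2 / 4 - pi ^ 2 * pi - pi ^ 3 / 2)
      - 12 / pi ^ 3 * (5 * pi * (2 * pi / 3) ^ 2 / 4 - pi ^ 2 * (2 * pi / 3) - (2 * pi / 3) ^ 3 / 2))"
  proof (rule nn_integral_FTC_Icc[where F = "\<lambda>v. 12 / pi ^ 3 * (5 * pi * v ^ 2 / 4 - pi ^ 2 * v - v ^ 3 / 2)"])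
    fix v assume v: "v \<in> {2 * pi / 3..pi}"
    show "DERIV (\<lambda>v. 12 / pi ^ 3 * (5 * pi * v ^ 2 / 4 - pi ^ 2 * v - v ^ 3 / 2)) v :> ?f v"
      by (auto intro!: derivative_eq_intros simp: field_simps power2_eq_square power3_eq_cube)
    show "0 \<le> ?f v" using v by (intro mult_nonneg_nonneg) auto
  qed auto
  also have "\<dots> = ennreal (1 / 9)"
    by (rule arg_cong[where f = ennreal]) (simp add: field_simps power2_eq_square power3_eq_cube)
  finally show ?thesis .
qed

lemma prob_space_circle_U41: "prob_space (circle_U41 F)"
proof -
  have "prob_space circle_measure4"
    unfolding circle_measure4_def by (rule prob_space_PiM) (rule prob_space_circle_measure)
  then show ?thesis
    unfolding circle_U41_def by (rule prob_space.prob_space_distr[OF _ circle_vr_class_measurable])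
qed

lemma sets_circle_U41: "sets (circle_U41 F) = sets borel"
  by (simp add: circle_U41_def)

text \<open>Nothing is computed on the diagonal itself: it receives what the density leaves,
  \<open>1 - 1 / 9\<close>.\<close>

lemma measure_circle_U41_diagonal: "measure (circle_U41 F) {diagonal_point} = 8 / 9"
proof -
  interpret prob_space "circle_U41 F" by (rule prob_space_circle_U41)
  have borel: "- {diagonal_point} \<in> sets borel" by measurable
  have off: "emeasure (circle_U41 F) (- {diagonal_point}) = ennreal (1 / 9)"
  proof -
    have "emeasure (circle_U41 F) (- {diagonal_point})
      = (\<integral>\<^sup>+z. ennreal (12 / pi ^ 3 * (pi - snd z)) * indicator bar_region z * indicator (- {diagonal_point}) (plane_class z) \<partial>lborel)"
      using emeasure_circle_U41[OF borel] emeasure_bar_density[OF borel] by simp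
    also have "\<dots> = (\<integral>\<^sup>+z. ennreal (12 / pi ^ 3 * (pi - snd z)) * indicator bar_region z \<partial>lborel)"
      by (intro nn_integral_cong) (auto simp: indicator_def plane_class_diagonal_iff bar_region_def)
    finally show ?thesis using total_bar_density by simp
  qed
  then have "measure (circle_U41 F) (- {diagonal_point}) = 1 / 9"
    by (simp add: measure_def)
  moreover have "measure (circle_U41 F) (space (circle_U41 F) - {diagonal_point}) = 1 - measure (circle_U41 F) {diagonal_point}"
    by (rule prob_compl) (simp add: sets_circle_U41)
  moreover have "space (circle_U41 F) - {diagonal_point} = - {diagonal_point}"
    by (auto simp: circle_U41_def)
  ultimately show ?thesis by simp
qed

theorem proposition5p9:
  fixes F :: "'f::field itself"
  shows
    "(\<lambda>x. circle_vr_class F (x ` {1..4})) \<in> measurable circle_measure4 borel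
     \<and> (\<exists>\<mu>s \<mu>c f.
          sets \<mu>s = sets borel \<and> sets \<mu>c = sets borel
          \<and> (\<forall>A\<in>sets borel. emeasure (circle_U41 F) A = emeasure \<mu>s A + emeasure \<mu>c A)
          \<and> mutually_singular \<mu>s plane_mod_lebesgue
          \<and> (AE p in \<mu>s. p = diagonal_point)
          \<and> (AE p in \<mu>c. p \<in> circle_D41 F - {diagonal_point})
          \<and> f \<in> borel_measurable borel
          \<and> \<mu>c = density plane_mod_lebesgue f
          \<and> (\<forall>t\<^sub>b t\<^sub>d. plane_class (t\<^sub>b, t\<^sub>d) \<in> circle_D41 F - {diagonal_point} \<longrightarrow>
                f (plane_class (t\<^sub>b, t\<^sub>d)) = ennreal (12 / pi ^ 3 * (pi - t\<^sub>d))))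
     \<and> measure circle_measure4
         {x \<in> space circle_measure4. circle_vr_class F (x ` {1..4}) = diagonal_point} = 8 / 9"
proof -
  let ?U = "circle_U41 F"
  let ?L = plane_mod_lebesgue
  \<comment> \<open>The part of the law at the collapsed point, encoded as a density so that it
    remains a measure on all Borel sets of the quotient.\<close>
  define \<mu>s where "\<mu>s = density ?U (indicator {diagonal_point})"
  define \<mu>c where "\<mu>c = density ?L bar_density"
  have sets [simp]: "sets ?U = sets borel" "sets ?L = sets borel" "sets \<mu>s = sets borel" "sets \<mu>c = sets borel"
    by (simp_all add: sets_circle_U41 plane_mod_lebesgue_def \<mu>s_def \<mu>c_def)
  have space [simp]: "space ?U = UNIV" "space ?L = UNIV"
    by (simp_all add: circle_U41_def plane_mod_lebesgue_def)
  have meas [measurable]: "bar_density \<in> borel_measurable ?L"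
      "indicator {diagonal_point} \<in> borel_measurable ?U"
    by (simp_all add: measurable_cong_sets[OF sets(1) refl] measurable_cong_sets[OF sets(2) refl])
  have \<mu>s: "emeasure \<mu>s A = emeasure ?U (A \<inter> {diagonal_point})" if "A \<in> sets borel" for A
  proof -
    have "emeasure \<mu>s A = (\<integral>\<^sup>+x. indicator {diagonal_point} x * indicator A x \<partial>?U)"
      unfolding \<mu>s_def using that by (intro emeasure_density meas) simp
    also have "\<dots> = (\<integral>\<^sup>+x. indicator (A \<inter> {diagonal_point}) x \<partial>?U)"
      by (intro nn_integral_cong) (auto simp: indicator_def)
    finally show ?thesis using that by simp
  qed
  have decomposition: "emeasure ?U A = emeasure \<mu>s A + emeasure \<mu>c A" if A: "A \<in> sets borel" for A
  proof -
    have off: "A - {diagonal_point} \<in> sets borel" using A by auto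
    have "emeasure ?U A = emeasure ?U ((A \<inter> {diagonal_point}) \<union> (A - {diagonal_point}))"
      by (rule arg_cong[where f = "emeasure ?U"]) auto
    also have "\<dots> = emeasure ?U (A \<inter> {diagonal_point}) + emeasure ?U (A - {diagonal_point})"
      using A off by (intro plus_emeasure[symmetric]) auto
    also have "emeasure ?U (A - {diagonal_point}) = emeasure \<mu>c (A - {diagonal_point})"
      unfolding \<mu>c_def by (rule emeasure_circle_U41[OF off]) simp
    \<comment> \<open>The density vanishes at the collapsed point, since \<open>bar_region\<close>
      misses the diagonal.\<close>
    also have "\<dots> = emeasure \<mu>c A"
      unfolding \<mu>c_def emeasure_bar_density[OF A] emeasure_bar_density[OF off]
      by (intro nn_integral_cong) (auto simp: indicator_def plane_class_diagonal_iff bar_region_def)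
    finally show ?thesis unfolding \<mu>s[OF A] .
  qed
  have singular: "mutually_singular \<mu>s ?L"
    unfolding mutually_singular_def
  proof (intro conjI bexI[of _ "- {diagonal_point}"])
    have "- {diagonal_point} \<in> sets borel" by auto
    from \<mu>s[OF this] show "emeasure \<mu>s (- {diagonal_point}) = 0" by simp
    show "emeasure ?L (space ?L - - {diagonal_point}) = 0"
      using emeasure_lebesgue_diagonal_point by (simp add: Diff_eq)
  qed auto
  have AE_s: "AE p in \<mu>s. p = diagonal_point"
    unfolding \<mu>s_def by (subst AE_density[OF meas(2)]) (auto simp: indicator_def)
  have AE_c: "AE p in \<mu>c. p \<in> circle_D41 F - {diagonal_point}"
    unfolding \<mu>c_def circle_D41_off_diagonal
  proof (subst AE_density[OF meas(1)], intro AE_I2 impI)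
    fix p assume "0 < bar_density p"
    then have "plane_rep p \<in> bar_region" by (rule contrapos_pp) (simp add: bar_density_def)
    then have "plane_class (plane_rep p) \<in> plane_class ` bar_region" by (rule imageI)
    then show "p \<in> plane_class ` bar_region" by (simp add: plane_class_plane_rep)
  qed
  have value_f: "bar_density (plane_class (t\<^sub>b, t\<^sub>d)) = ennreal (12 / pi ^ 3 * (pi - t\<^sub>d))"
    if "plane_class (t\<^sub>b, t\<^sub>d) \<in> circle_D41 F - {diagonal_point}" for t\<^sub>b t\<^sub>d
  proof -
    \<comment> \<open>Off the diagonal a class has only one representative, so membership of the
      class passes to the pair.\<close>
    from that have "(t\<^sub>b, t\<^sub>d) \<in> bar_region"
      unfolding circle_D41_off_diagonal by (auto simp: plane_class_eq_iff bar_region_def)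
    then show ?thesis by (simp add: bar_density_plane_class)
  qed
  have "measure circle_measure4
      {x \<in> space circle_measure4. circle_vr_class F (x ` {1..4}) = diagonal_point} = measure ?U {diagonal_point}"
    unfolding circle_U41_def
    by (subst measure_distr[OF circle_vr_class_measurable])
       (auto intro!: arg_cong[where f = "measure circle_measure4"])
  then have probability: "measure circle_measure4
      {x \<in> space circle_measure4. circle_vr_class F (x ` {1..4}) = diagonal_point} = 8 / 9"
    using measure_circle_U41_diagonal by simp
  show ?thesis
  proof (rule conjI[OF circle_vr_class_measurable conjI[OF _ probability]],
      rule exI[of _ \<mu>s], rule exI[of _ \<mu>c], rule exI[of _ bar_density], intro conjI)
    show "\<forall>A\<in>sets borel. emeasure ?U A = emeasure \<mu>s A + emeasure \<mu>c A"
      using decomposition by blast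
    show "\<forall>t\<^sub>b t\<^sub>d. plane_class (t\<^sub>b, t\<^sub>d) \<in> circle_D41 F - {diagonal_point} \<longrightarrow>
        bar_density (plane_class (t\<^sub>b, t\<^sub>d)) = ennreal (12 / pi ^ 3 * (pi - t\<^sub>d))"
      using value_f by blast
  qed (fact sets singular AE_s AE_c bar_density_measurable \<mu>c_def)+
qed

end
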